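(* Let $\{X_{k,i}; i \geq 1, k \geq 1\}$ be an array of i.i.d. random variables, write $X_i = X_{1,i}$ for $i \geq 1$, and let $\{p_n; n \geq 1\}$ be a sequence of positive integers such that $n/p_n$ is bounded away from $0$ and $\infty$. For $n \geq 2$ and $1 \leq i \leq p_n$ let $\bar{X}_i^{(n)} = \frac{1}{n}\sum_{k=1}^n X_{k,i}$, and for $1 \leq i, j \leq p_n$ let $$\hat{\rho}_{i,j}^{(n)} = \frac{\sum_{k=1}^n (X_{k,i} - \bar{X}_i^{(n)})(X_{k,j} - \bar{X}_j^{(n)})}{\big(\sum_{k=1}^n (X_{k,i} - \bar{X}_i^{(n)})^2\big)^{1/2} \big(\sum_{k=1}^n (X_{k,j} - \bar{X}_j^{(n)})^2\big)^{1/2}},$$ and let $L_n = \max_{1 \leq i < j \leq p_n} |\hat{\rho}_{i,j}^{(n)}|$. If $X_1$ is nondegenerate and $$\sum_{n=1}^{\infty} P\Big(\max_{1 \leq i < j \leq n} |X_i X_j| \geq \sqrt{n \log n}\Big) < \infty,$$ then $$\lim_{n \to \infty} \Big(\frac{n}{\log n}\Big)^{1/2} L_n = 2 \quad \text{a.s.}$$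
   Context: $\log$ denotes the natural logarithm. *)

theory Defs
  imports "HOL-Probability.Probability"
begin

(* X k i w : the (k,i) entry of the array, k = sample index, i = coordinate, both starting at 1 *)

definition sample_mean :: "(nat \<Rightarrow> nat \<Rightarrow> 'a \<Rightarrow> real) \<Rightarrow> nat \<Rightarrow> nat \<Rightarrow> 'a \<Rightarrow> real" where
  "sample_mean X n i w = (\<Sum>k=1..n. X k i w) / real n"

definition sample_corr :: "(nat \<Rightarrow> nat \<Rightarrow> 'a \<Rightarrow> real) \<Rightarrow> nat \<Rightarrow> nat \<Rightarrow> nat \<Rightarrow> 'a \<Rightarrow> real" where
  "sample_corr X n i j w =
     (\<Sum>k=1..n. (X k i w - sample_mean X n i w) * (X k j w - sample_mean X n j w)) /
     (sqrt (\<Sum>k=1..n. (X k i w - sample_mean X n i w)\<^sup>2) *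
      sqrt (\<Sum>k=1..n. (X k j w - sample_mean X n j w)\<^sup>2))"

(* L_n = max_{1 <= i < j <= p_n} |rho_{ij}|; 0 is inserted only to make Max total when the
   index set is empty (it does not change the value otherwise, all entries being >= 0) *)
definition coherence :: "(nat \<Rightarrow> nat \<Rightarrow> 'a \<Rightarrow> real) \<Rightarrow> nat \<Rightarrow> nat \<Rightarrow> 'a \<Rightarrow> real" where
  "coherence X n p w =
     Max (insert 0 {\<bar>sample_corr X n i j w\<bar> | i j. 1 \<le> i \<and> i < j \<and> j \<le> p})"

(* max_{1 <= i < j <= n} |X_i X_j| (with 0 inserted for totality, harmless) *)
definition max_prod :: "(nat \<Rightarrow> 'a \<Rightarrow> real) \<Rightarrow> nat \<Rightarrow> 'a \<Rightarrow> real" where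
  "max_prod Y n w = Max (insert 0 {\<bar>Y i w * Y j w\<bar> | i j. 1 \<le> i \<and> i < j \<and> j \<le> n})"

end

(* Write a(n) = sqrt(n log n). The hypothesis implies E|X|^5 < oo and that almost surely all products
   X_ki X_kj with k <= n, i < j <= p_n are o(a(n)). Standardise X; then row sums are O(a(n)) and row
   sums of squares are n(1 + o(1)), uniformly in the columns, so the correlations are governed by the
   sums S_ij of the products X_ki X_kj. Truncate the products at n^(9/20): at most one product in each
   S_ij is cut off, and it is o(a(n)).

   Upper bound: Chernoff's inequality gives P(|S_ij| > (2 + eps) a(n)) <= n^(-2 - eps) for the truncated
   sums, which survives the union over n^2 pairs along the subsequence n = m^A with A large; the gaps
   between consecutive values of the subsequence are so short that increments are negligible.
   Lower bound: the expected number of pairs with S_ij > (2 - eps) a(n) is at least n^eps by a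
   moderate deviation lower bound, and its variance is controlled because pairs sharing a column are
   nearly independent in the tails; Chebyshev's inequality along n = m^A concludes. *)

theory Submission
  imports Defs "HOL-Real_Asymp.Real_Asymp"
begin

subsection \<open>Independent families\<close>

text \<open>The constant 2 is where about n^2 pairs balance a Gaussian tail n^(-c^2/2). For c near 2
  what remains is only a small negative power of n, which is not summable over n. This forces a
  subsequence; powers m^A are used because, unlike along a geometric sequence, the increments
  between consecutive members are negligible. The hypothesis bounds the tail of |X| by x^(-6) up to
  logarithms, so moments of every order below six are finite, and five is used. If products are
  truncated at n^a and q moments are finite, Gaussian constants ask for a < 1/2, while two
  exceedances in one S_ij, an event with four free indices, are excluded when 2qa > 4. Hence q must
  exceed 4; for q = 5 the window is 2/5 < a < 1/2, and 9/20 is its midpoint. Five moments do not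
  control the one remaining large product, since there are n^3 products with tails n^(-5/2); the
  summability hypothesis is therefore used a second time, directly. It speaks of uncentred entries,
  but centring changes a product only by terms linear in the entries, which are at most of order
  n^(9/20).\<close>

lemma (in prob_space) indep_vars_group:
  assumes "indep_vars (\<lambda>_. borel) X I"
    and "\<And>j. j \<in> L \<Longrightarrow> K j \<subseteq> I" and "disjoint_family_on K L"
    and "\<And>j. j \<in> L \<Longrightarrow> F j \<in> borel_measurable (PiM (K j) (\<lambda>_. borel))"
  shows "indep_vars (\<lambda>_. borel) (\<lambda>j \<omega>. F j (\<lambda>i\<in>K j. X i \<omega>)) L"
  using indep_vars_compose2[OF indep_vars_restrict[OF assms(1-3)], where N="\<lambda>_. borel"] assms(4)
  by auto

lemma (in prob_space) indep_vars_reindex_inj: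
  assumes "indep_vars (\<lambda>_. borel) X I" and "inj_on f L" and "f ` L \<subseteq> I"
  shows "indep_vars (\<lambda>_. borel) (\<lambda>j. X (f j)) L"
proof -
  have "indep_vars (\<lambda>_. borel) (\<lambda>j \<omega>. (\<lambda>j g. g (f j)) j (\<lambda>i\<in>{f j}. X i \<omega>)) L"
    using assms(2,3) by (intro indep_vars_group[OF assms(1)])
      (auto simp: disjoint_family_on_def inj_on_def)
  then show ?thesis by simp
qed

text \<open>The joint law of an independent family is the product of its marginals, so equal
  marginals give equal probabilities to every event of the product space.\<close>

lemma (in prob_space) prob_indep_law_eq:
  fixes Y Y' :: "'b \<Rightarrow> 'a \<Rightarrow> real"
  assumes "J \<noteq> {}"
    and Y: "indep_vars (\<lambda>_. borel) Y J" and Y': "indep_vars (\<lambda>_. borel) Y' J"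
    and law: "\<And>j. j \<in> J \<Longrightarrow> distr M borel (Y j) = distr M borel (Y' j)"
    and P: "{x \<in> space (PiM J (\<lambda>_. borel)). P x} \<in> sets (PiM J (\<lambda>_. borel))"
  shows "prob {\<omega>\<in>space M. P (\<lambda>j\<in>J. Y j \<omega>)} = prob {\<omega>\<in>space M. P (\<lambda>j\<in>J. Y' j \<omega>)}"
proof -
  let ?P = "PiM J (\<lambda>_. borel :: real measure)"
  \<comment> \<open>The characterisation of independence by the product law asks for measurability
    at every index. The family is therefore continued by 0 outside \<open>J\<close>, which the
    restriction to \<open>J\<close> does not see.\<close>
  define W where "W Z = (\<lambda>j. if j \<in> J then Z j else (\<lambda>_. 0))" for Z :: "'b \<Rightarrow> 'a \<Rightarrow> real"
  have rvW: "random_variable borel (W Z j)" if "indep_vars (\<lambda>_. borel) Z J" for Z j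
    using that by (auto simp: W_def indep_vars_def)
  have iW: "indep_vars (\<lambda>_. borel) (W Z) J" if "indep_vars (\<lambda>_. borel) Z J" for Z
    using that by (subst indep_vars_cong[where J=J and Y=Z and N'="\<lambda>_. borel"]) (auto simp: W_def)
  have restr: "(\<lambda>j\<in>J. W Z j \<omega>) = (\<lambda>j\<in>J. Z j \<omega>)" for Z \<omega> by (auto simp: W_def)
  have d: "distr M ?P (\<lambda>\<omega>. \<lambda>j\<in>J. Z j \<omega>) = (\<Pi>\<^sub>M j\<in>J. distr M borel (Z j))"
    if Z: "indep_vars (\<lambda>_. borel) Z J" for Z
  proof -
    have "distr M ?P (\<lambda>\<omega>. \<lambda>j\<in>J. W Z j \<omega>) = (\<Pi>\<^sub>M j\<in>J. distr M borel (W Z j))"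
      using iW[OF Z] assms(1) by (subst (asm) indep_vars_iff_distr_eq_PiM) (auto intro: rvW[OF Z])
    moreover have "(\<Pi>\<^sub>M j\<in>J. distr M borel (W Z j)) = (\<Pi>\<^sub>M j\<in>J. distr M borel (Z j))"
      by (intro PiM_cong) (auto simp: W_def)
    ultimately show ?thesis by (simp add: restr)
  qed
  have eq: "prob {\<omega>\<in>space M. P (\<lambda>j\<in>J. Z j \<omega>)}
      = measure (distr M ?P (\<lambda>\<omega>. \<lambda>j\<in>J. Z j \<omega>)) {x \<in> space ?P. P x}"
    if Z: "indep_vars (\<lambda>_. borel) Z J" for Z
  proof -
    have m: "(\<lambda>\<omega>. \<lambda>j\<in>J. Z j \<omega>) \<in> measurable M ?P"
      using Z by (intro measurable_restrict) (auto simp: indep_vars_def)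
    show ?thesis
      using measurable_space[OF m]
      by (subst measure_distr[OF m P]) (auto intro!: arg_cong[where f=prob])
  qed
  show ?thesis
    unfolding eq[OF Y] eq[OF Y'] d[OF Y] d[OF Y']
    by (intro arg_cong[where f="\<lambda>D. measure D _"] PiM_cong law) auto
qed

text \<open>Serves three kinds of disjoint index sets: two pairs of columns, two rows of one pair,
  and two halves of one row. The events are encoded as real functions with values in Borel
  sets.\<close>

lemma (in prob_space) prob_conj_indep_group:
  fixes F G :: "('b \<Rightarrow> 'c :: topological_space) \<Rightarrow> real"
  assumes ind: "indep_vars (\<lambda>_. borel) X I"
    and "A \<inter> B = {}" "A \<subseteq> I" "B \<subseteq> I"
    and F[measurable]: "F \<in> borel_measurable (PiM A (\<lambda>_. borel))"
    and G[measurable]: "G \<in> borel_measurable (PiM B (\<lambda>_. borel))"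
    and S: "S \<in> sets borel" and T: "T \<in> sets borel"
  shows "prob {\<omega>\<in>space M. F (\<lambda>i\<in>A. X i \<omega>) \<in> S \<and> G (\<lambda>i\<in>B. X i \<omega>) \<in> T} =
    prob {\<omega>\<in>space M. F (\<lambda>i\<in>A. X i \<omega>) \<in> S} * prob {\<omega>\<in>space M. G (\<lambda>i\<in>B. X i \<omega>) \<in> T}"
proof -
  have "indep_var borel (F \<circ> (\<lambda>\<omega>. \<lambda>i\<in>A. X i \<omega>)) borel (G \<circ> (\<lambda>\<omega>. \<lambda>i\<in>B. X i \<omega>))"
    by (intro indep_var_compose[OF indep_var_restrict[OF assms(1-4)]]) auto
  from indep_varD[OF this S T] show ?thesis
    by (simp add: vimage_def Int_def conj_commute)
qed

subsection \<open>Chernoff bound\<close>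

text \<open>Taylor's formula with Lagrange remainder. The factor \<open>exp b\<close> is kept next
  to 1/2 because it tends to 1 with \<open>b\<close>, which preserves the Gaussian constant in the
  Chernoff bound.\<close>

lemma exp_le_quadratic:
  fixes x b :: real
  assumes "\<bar>x\<bar> \<le> b"
  shows "exp x \<le> 1 + x + x\<^sup>2 / 2 * exp b"
proof -
  obtain t where t: "\<bar>t\<bar> \<le> \<bar>x\<bar>" "exp x = (\<Sum>m<2. x ^ m / fact m) + exp t / fact 2 * x ^ 2"
    using Maclaurin_exp_le[of x 2] by blast
  have "exp t * x\<^sup>2 \<le> exp b * x\<^sup>2"
    using t assms by (intro mult_right_mono) auto
  then show ?thesis using t by (simp add: numeral_2_eq_2 mult.commute)
qed

text \<open>Exponential Markov inequality. The variables need not be centred: a bound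
  \<open>m\<close> on the means enters the exponent linearly, which suits truncated variables whose
  means are tiny but not zero.\<close>

lemma (in prob_space) chernoff_bounded:
  fixes W :: "'b \<Rightarrow> 'a \<Rightarrow> real"
  assumes ind: "indep_vars (\<lambda>_. borel) W I" and fin: "finite I"
    and bd: "\<And>k \<omega>. k \<in> I \<Longrightarrow> \<omega> \<in> space M \<Longrightarrow> \<bar>W k \<omega>\<bar> \<le> B"
    and mean: "\<And>k. k \<in> I \<Longrightarrow> expectation (W k) \<le> m"
    and var: "\<And>k. k \<in> I \<Longrightarrow> expectation (\<lambda>\<omega>. (W k \<omega>)\<^sup>2) \<le> v"
    and "l > 0"
  shows "prob {\<omega>\<in>space M. (\<Sum>k\<in>I. W k \<omega>) \<ge> t}
    \<le> exp (- l * t + card I * (l * m + l\<^sup>2 / 2 * v * exp (l * B)))"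
proof -
  have [measurable]: "k \<in> I \<Longrightarrow> W k \<in> borel_measurable M" for k
    using ind by (auto simp: indep_vars_def)
  \<comment> \<open>A continuous function of a bounded variable is bounded; this covers the
    identity, the square and the exponential at once.\<close>
  have int: "integrable M (\<lambda>\<omega>. g (W k \<omega>))" if "k \<in> I" "continuous_on UNIV g" for k and g :: "real \<Rightarrow> real"
  proof -
    have [measurable]: "g \<in> borel_measurable borel"
      using that by (intro borel_measurable_continuous_onI)
    have "bounded (g ` {-B..B})"
      by (intro compact_imp_bounded compact_continuous_image continuous_on_subset[OF that(2)]) auto
    then obtain C where C: "\<And>x. x \<in> {-B..B} \<Longrightarrow> norm (g x) \<le> C"
      unfolding bounded_iff by blast
    show ?thesis
    proof (rule integrable_const_bound[where B=C])
      show "AE x in M. norm (g (W k x)) \<le> C"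
      proof (rule AE_I2)
        fix x assume "x \<in> space M"
        from bd[OF that(1) this] show "norm (g (W k x)) \<le> C" by (intro C) auto
      qed
      show "(\<lambda>\<omega>. g (W k \<omega>)) \<in> borel_measurable M" using that(1) by measurable
    qed
  qed
  have mgf: "expectation (\<lambda>\<omega>. exp (l * W k \<omega>)) \<le> exp (l * m + l\<^sup>2 / 2 * v * exp (l * B))"
    if k: "k \<in> I" for k
  proof -
    have i1: "integrable M (W k)" using int[OF k, of "\<lambda>x. x"] by simp
    have i2: "integrable M (\<lambda>\<omega>. (W k \<omega>)\<^sup>2)" using int[OF k, of "\<lambda>x. x\<^sup>2"] by (simp add: continuous_intros)
    have "expectation (\<lambda>\<omega>. exp (l * W k \<omega>))
        \<le> expectation (\<lambda>\<omega>. 1 + l * W k \<omega> + l\<^sup>2 / 2 * exp (l * B) * (W k \<omega>)\<^sup>2)"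
    proof (rule integral_mono)
      show "integrable M (\<lambda>\<omega>. exp (l * W k \<omega>))"
        by (rule int[OF k]) (intro continuous_intros)
      show "integrable M (\<lambda>\<omega>. 1 + l * W k \<omega> + l\<^sup>2 / 2 * exp (l * B) * (W k \<omega>)\<^sup>2)"
        using i1 i2 by simp
      fix x assume x: "x \<in> space M"
      have "\<bar>l * W k x\<bar> \<le> l * B"
        using bd[OF k x] \<open>l > 0\<close> by (simp add: abs_mult)
      from exp_le_quadratic[OF this]
      show "exp (l * W k x) \<le> 1 + l * W k x + l\<^sup>2 / 2 * exp (l * B) * (W k x)\<^sup>2"
        by (simp add: power_mult_distrib mult_ac)
    qed
    also have "\<dots> = 1 + l * expectation (W k) + l\<^sup>2 / 2 * exp (l * B) * expectation (\<lambda>\<omega>. (W k \<omega>)\<^sup>2)"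
      using i1 i2 by (simp add: prob_space)
    also have "\<dots> \<le> 1 + (l * m + l\<^sup>2 / 2 * exp (l * B) * v)"
      using mean[OF k] var[OF k] \<open>l > 0\<close> by (simp add: add_mono)
    \<comment> \<open>Passing back to an exponential turns the product over \<open>I\<close> into a
      multiple of \<open>card I\<close> in the exponent.\<close>
    also have "\<dots> \<le> exp (l * m + l\<^sup>2 / 2 * exp (l * B) * v)" by (rule exp_ge_add_one_self)
    finally show ?thesis by (simp add: mult_ac)
  qed
  have expi: "indep_vars (\<lambda>_. borel) (\<lambda>k \<omega>. exp (l * W k \<omega>)) I"
    by (rule indep_vars_compose2[OF ind]) auto
  have iexp: "integrable M (\<lambda>\<omega>. exp (l * W k \<omega>))" if "k \<in> I" for k
    by (rule int[OF that]) (intro continuous_intros)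
  have prod: "(\<lambda>\<omega>. exp (l * (\<Sum>k\<in>I. W k \<omega>))) = (\<lambda>\<omega>. \<Prod>k\<in>I. exp (l * W k \<omega>))"
    using fin by (simp add: sum_distrib_left exp_sum)
  have iprod: "integrable M (\<lambda>\<omega>. exp (l * (\<Sum>k\<in>I. W k \<omega>)))"
    unfolding prod using indep_vars_integrable[OF fin expi iexp] by simp
  have "prob {\<omega>\<in>space M. (\<Sum>k\<in>I. W k \<omega>) \<ge> t}
      \<le> exp (- l * t) * (\<integral>\<omega>\<in>space M. exp (l * (\<Sum>k\<in>I. W k \<omega>)) \<partial>M)"
    using iprod \<open>l > 0\<close>
    by (intro Chernoff_ineq_ge)
      (auto simp: set_integrable_def cong: Bochner_Integration.integrable_cong)
  also have "(\<integral>\<omega>\<in>space M. exp (l * (\<Sum>k\<in>I. W k \<omega>)) \<partial>M) = (\<Prod>k\<in>I. expectation (\<lambda>\<omega>. exp (l * W k \<omega>)))"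
    unfolding set_integral_space[OF iprod] unfolding prod using indep_vars_lebesgue_integral[OF fin expi iexp] by simp
  also have "\<dots> \<le> (\<Prod>k\<in>I. exp (l * m + l\<^sup>2 / 2 * v * exp (l * B)))"
    by (intro prod_mono conjI mgf integral_nonneg_AE) auto
  also have "exp (- l * t) * \<dots> = exp (- l * t + card I * (l * m + l\<^sup>2 / 2 * v * exp (l * B)))"
    by (simp only: prod_constant exp_of_nat_mult[symmetric] mult_exp_exp)
  finally show ?thesis by simp
qed

lemma (in prob_space) chernoff_bounded_abs:
  fixes W :: "'b \<Rightarrow> 'a \<Rightarrow> real"
  assumes ind: "indep_vars (\<lambda>_. borel) W I" and fin: "finite I"
    and bd: "\<And>k \<omega>. k \<in> I \<Longrightarrow> \<omega> \<in> space M \<Longrightarrow> \<bar>W k \<omega>\<bar> \<le> B"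
    and mean: "\<And>k. k \<in> I \<Longrightarrow> \<bar>expectation (W k)\<bar> \<le> m"
    and var: "\<And>k. k \<in> I \<Longrightarrow> expectation (\<lambda>\<omega>. (W k \<omega>)\<^sup>2) \<le> v"
    and "l > 0"
  shows "prob {\<omega>\<in>space M. \<bar>\<Sum>k\<in>I. W k \<omega>\<bar> \<ge> t}
    \<le> 2 * exp (- l * t + card I * (l * m + l\<^sup>2 / 2 * v * exp (l * B)))"
proof -
  have [measurable]: "k \<in> I \<Longrightarrow> W k \<in> borel_measurable M" for k
    using ind by (auto simp: indep_vars_def)
  have p: "prob {\<omega>\<in>space M. (\<Sum>k\<in>I. W k \<omega>) \<ge> t}
      \<le> exp (- l * t + card I * (l * m + l\<^sup>2 / 2 * v * exp (l * B)))"
    using mean by (intro chernoff_bounded[OF ind fin bd _ var \<open>l > 0\<close>]) (auto simp: abs_le_iff)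
  have "prob {\<omega>\<in>space M. (\<Sum>k\<in>I. - W k \<omega>) \<ge> t}
      \<le> exp (- l * t + card I * (l * m + l\<^sup>2 / 2 * v * exp (l * B)))"
  proof (rule chernoff_bounded[OF _ fin _ _ _ \<open>l > 0\<close>])
    show "indep_vars (\<lambda>_. borel) (\<lambda>k \<omega>. - W k \<omega>) I"
      by (rule indep_vars_compose2[OF ind]) auto
    show "expectation (\<lambda>\<omega>. - W k \<omega>) \<le> m" if "k \<in> I" for k
      using mean[OF that] by (simp add: abs_le_iff)
  qed (use bd var in auto)
  then have n: "prob {\<omega>\<in>space M. (\<Sum>k\<in>I. W k \<omega>) \<le> - t}
      \<le> exp (- l * t + card I * (l * m + l\<^sup>2 / 2 * v * exp (l * B)))"
    by (simp add: sum_negf le_minus_iff)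
  have "prob {\<omega>\<in>space M. \<bar>\<Sum>k\<in>I. W k \<omega>\<bar> \<ge> t}
      \<le> prob ({\<omega>\<in>space M. (\<Sum>k\<in>I. W k \<omega>) \<ge> t} \<union> {\<omega>\<in>space M. (\<Sum>k\<in>I. W k \<omega>) \<le> - t})"
    by (intro finite_measure_mono) auto
  also have "\<dots> \<le> prob {\<omega>\<in>space M. (\<Sum>k\<in>I. W k \<omega>) \<ge> t} + prob {\<omega>\<in>space M. (\<Sum>k\<in>I. W k \<omega>) \<le> - t}"
    by (intro measure_Un_le) auto
  finally show ?thesis using p n by simp
qed

subsection \<open>Truncation\<close>

text \<open>Large values are replaced by 0 and not clipped to the level, so the difference from
  \<open>y\<close> is either 0 or \<open>y\<close> itself.\<close>

definition trunc :: "real \<Rightarrow> real \<Rightarrow> real" where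
  "trunc B y = (if \<bar>y\<bar> \<le> B then y else 0)"

lemma trunc_measurable[measurable]: "trunc B \<in> borel_measurable borel"
  unfolding trunc_def by measurable

lemma abs_trunc_le: "0 \<le> B \<Longrightarrow> \<bar>trunc B y\<bar> \<le> B"
  by (simp add: trunc_def)

lemma abs_trunc_le_abs: "\<bar>trunc B y\<bar> \<le> \<bar>y\<bar>"
  by (simp add: trunc_def)

lemma trunc_sq_le: "(trunc B y)\<^sup>2 \<le> y\<^sup>2"
  by (simp add: trunc_def)

text \<open>Where the truncation acts, 1 is at most (|y|/B)^3.\<close>

lemma abs_trunc_diff_le:
  assumes "0 < B" shows "\<bar>y - trunc B y\<bar> \<le> y ^ 4 / B ^ 3"
proof (cases "\<bar>y\<bar> \<le> B")
  case False
  then have "\<bar>y\<bar> * B ^ 3 \<le> \<bar>y\<bar> * \<bar>y\<bar> ^ 3" using assms by (intro mult_left_mono power_mono) auto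
  also have "\<dots> = \<bar>y\<bar> ^ 4" by (simp only: power4_eq_xxxx power3_eq_cube mult.assoc)
  also have "\<dots> = y ^ 4" by simp
  finally show ?thesis using False assms by (simp add: trunc_def field_simps)
qed (use assms in \<open>simp add: trunc_def\<close>)

text \<open>As \<open>Y\<close> is centred, the mean of the kept part is minus the mean of the part
  cut off, and the latter is controlled by the fourth moment.\<close>

lemma (in prob_space) expectation_trunc_le:
  assumes Y[measurable]: "Y \<in> borel_measurable M" and i4: "integrable M (\<lambda>\<omega>. (Y \<omega>) ^ 4)"
    and i1: "integrable M Y" and "expectation Y = 0" and B: "0 < B"
  shows "\<bar>expectation (\<lambda>\<omega>. trunc B (Y \<omega>))\<bar> \<le> expectation (\<lambda>\<omega>. (Y \<omega>) ^ 4) / B ^ 3"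
proof -
  have it: "integrable M (\<lambda>\<omega>. trunc B (Y \<omega>))"
    by (rule Bochner_Integration.integrable_bound[OF i1]) (auto simp: abs_trunc_le_abs)
  have "\<bar>expectation (\<lambda>\<omega>. trunc B (Y \<omega>))\<bar> = \<bar>expectation (\<lambda>\<omega>. Y \<omega> - trunc B (Y \<omega>))\<bar>"
    using it i1 assms(4) by simp
  also have "\<dots> \<le> expectation (\<lambda>\<omega>. \<bar>Y \<omega> - trunc B (Y \<omega>)\<bar>)" by (rule integral_abs_bound)
  also have "\<dots> \<le> expectation (\<lambda>\<omega>. (Y \<omega>) ^ 4 / B ^ 3)"
    using it i1 i4 B by (intro integral_mono abs_trunc_diff_le) auto
  finally show ?thesis by simp
qed

section \<open>The scale a(n) and Gaussian tail bounds at that scale\<close>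

definition nlog :: "nat \<Rightarrow> real" where
  "nlog n = sqrt (real n * ln (real n))"

lemma nlog_nonneg: "0 \<le> nlog n"
  by (cases "n = 0") (auto simp: nlog_def)

lemma nlog_mono: assumes "m \<le> n" shows "nlog m \<le> nlog n"
proof (cases "m = 0")
  case True
  then show ?thesis using nlog_nonneg[of n] by (simp add: nlog_def)
next
  case False
  then show ?thesis using assms unfolding nlog_def by (intro real_sqrt_le_mono mult_mono) auto
qed

text \<open>Truncation at level \<open>N\<^bsup>9/20\<^esup>\<close> is low enough for the exponential bounds to have Gaussian
  constants at the scale \<open>nlog N\<close>, and high enough for fifth moments to exclude two exceedances in
  one sum. The mean of a truncated centred variable is then \<open>O(N\<^bsup>-27/20\<^esup>)\<close> by its fourth moment,
  so no recentring is needed.\<close>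

lemma (in prob_space) chernoff_scale:
  fixes c R K v \<eta> :: real
  assumes "c > 0" "R \<ge> 0" "K \<ge> 0" "v \<ge> 0" "\<eta> > 0"
  shows "\<forall>\<^sub>F N in sequentially. \<forall>(I :: 'b set) W s.
    indep_vars (\<lambda>_. borel) W I \<longrightarrow> finite I \<longrightarrow>
    (\<forall>k\<in>I. \<forall>\<omega>\<in>space M. \<bar>W k \<omega>\<bar> \<le> R * real N powr (9/20)) \<longrightarrow>
    (\<forall>k\<in>I. \<bar>expectation (W k)\<bar> \<le> K * real N powr (-27/20)) \<longrightarrow>
    (\<forall>k\<in>I. expectation (\<lambda>\<omega>. (W k \<omega>)\<^sup>2) \<le> v) \<longrightarrow>
    prob {\<omega>\<in>space M. \<bar>\<Sum>k\<in>I. W k \<omega>\<bar> \<ge> s * nlog N}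
      \<le> 2 * (real N powr (- c * s) *
          exp (card I / real N * (\<eta> + c\<^sup>2 / 2 * v * (1 + \<eta>) * ln (real N))))"
proof -
  have "(\<lambda>N. sqrt (ln (real N) / real N) * (real N * real N powr (-27/20))) \<longlonglongrightarrow> 0"
    by real_asymp
  then have "(\<lambda>N. c * K * (sqrt (ln (real N) / real N) * (real N * real N powr (-27/20)))) \<longlonglongrightarrow> c * K * 0"
    by (rule tendsto_mult_left)
  then have e1: "\<forall>\<^sub>F N in sequentially. c * K * (sqrt (ln (real N) / real N) * (real N * real N powr (-27/20))) < \<eta>"
    using assms by (intro order_tendstoD) auto
  \<comment> \<open>This is where the truncation exponent must lie below 1/2: the tilt times the
    bound is of order sqrt(ln N) N^(-1/20). The limits involve only the constants fixed at the
    start, so the threshold for \<open>N\<close> is uniform in the family.\<close>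
  have "(\<lambda>N. sqrt (ln (real N) / real N) * real N powr (9/20)) \<longlonglongrightarrow> 0"
    by real_asymp
  then have "(\<lambda>N. exp (c * R * (sqrt (ln (real N) / real N) * real N powr (9/20)))) \<longlonglongrightarrow> exp (c * R * 0)"
    by (intro tendsto_intros)
  then have e2: "\<forall>\<^sub>F N in sequentially. exp (c * R * (sqrt (ln (real N) / real N) * real N powr (9/20))) < 1 + \<eta>"
    using assms by (intro order_tendstoD) auto
  show ?thesis
    using e1 e2 eventually_ge_at_top[of 2]
  proof eventually_elim
    case (elim N)
    \<comment> \<open>With this tilt, \<open>l\<close> times \<open>nlog N\<close> is c ln N and N
      l^2 is c^2 ln N, so everything becomes a power of \<open>N\<close>. The number
      \<open>c\<close> stays free: the optimum is the threshold divided by the variance, but short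
      sums allow a much larger tilt.\<close>
    define l where "l = c * sqrt (ln (real N) / real N)"
    have N: "real N > 1" "ln (real N) > 0" using elim(3) by auto
    have l: "l > 0" using N assms by (simp add: l_def)
    have lt: "l * (s * nlog N) = c * s * ln (real N)" for s
      using N by (simp add: l_def nlog_def real_sqrt_mult real_sqrt_divide)
    have l2: "l\<^sup>2 = c\<^sup>2 * ln (real N) / real N"
      using N by (simp add: l_def power_mult_distrib)
    show ?case
    proof (intro allI impI)
      fix I :: "'b set" and W s
      assume W: "indep_vars (\<lambda>_. borel) W I" "finite I"
        and bd: "\<forall>k\<in>I. \<forall>\<omega>\<in>space M. \<bar>W k \<omega>\<bar> \<le> R * real N powr (9/20)"
        and mean: "\<forall>k\<in>I. \<bar>expectation (W k)\<bar> \<le> K * real N powr (-27/20)"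
        and var: "\<forall>k\<in>I. expectation (\<lambda>\<omega>. (W k \<omega>)\<^sup>2) \<le> v"
      let ?m = "K * real N powr (-27/20)" and ?B = "R * real N powr (9/20)"
      have "prob {\<omega>\<in>space M. \<bar>\<Sum>k\<in>I. W k \<omega>\<bar> \<ge> s * nlog N}
          \<le> 2 * exp (- l * (s * nlog N) + card I * (l * ?m + l\<^sup>2 / 2 * v * exp (l * ?B)))"
        using bd mean var by (intro chernoff_bounded_abs W l) auto
      also have "\<dots> = 2 * (real N powr (- c * s) * exp (card I * (l * ?m + l\<^sup>2 / 2 * v * exp (l * ?B))))"
      proof -
        have "real N powr (- c * s) = exp (- l * (s * nlog N))"
          unfolding powr_def minus_mult_left[symmetric] lt using N by simp
        then show ?thesis by (metis mult_exp_exp)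
      qed
      also have "\<dots> \<le> 2 * (real N powr (- c * s) *
          exp (card I / real N * (\<eta> + c\<^sup>2 / 2 * v * (1 + \<eta>) * ln (real N))))"
      proof (intro mult_left_mono iffD2[OF exp_le_cancel_iff])
        have "l * ?m + l\<^sup>2 / 2 * v * exp (l * ?B) \<le> \<eta> / real N + l\<^sup>2 / 2 * v * (1 + \<eta>)"
        proof (intro add_mono mult_left_mono)
          have "l * ?m * real N \<le> \<eta>" using elim(1) unfolding l_def by (simp add: mult_ac)
          then show "l * ?m \<le> \<eta> / real N" using N by (subst pos_le_divide_eq) linarith+
          show "exp (l * ?B) \<le> 1 + \<eta>" using less_imp_le[OF elim(2)] unfolding l_def by (simp add: mult_ac)
        qed (use assms in auto)
        also have "\<dots> = (\<eta> + c\<^sup>2 / 2 * v * (1 + \<eta>) * ln (real N)) / real N"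
          unfolding l2 by (simp add: add_divide_distrib mult.commute mult.left_commute)
        finally have "card I * (l * ?m + l\<^sup>2 / 2 * v * exp (l * ?B))
            \<le> card I * ((\<eta> + c\<^sup>2 / 2 * v * (1 + \<eta>) * ln (real N)) / real N)"
          by (rule mult_left_mono) simp
        then show "card I * (l * ?m + l\<^sup>2 / 2 * v * exp (l * ?B))
            \<le> card I / real N * (\<eta> + c\<^sup>2 / 2 * v * (1 + \<eta>) * ln (real N))" by simp
      qed auto
      finally show "prob {\<omega>\<in>space M. \<bar>\<Sum>k\<in>I. W k \<omega>\<bar> \<ge> s * nlog N}
        \<le> 2 * (real N powr (- c * s) *
          exp (card I / real N * (\<eta> + c\<^sup>2 / 2 * v * (1 + \<eta>) * ln (real N))))" .
    qed
  qed
qed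

lemma (in prob_space) abs5_tail:
  assumes [measurable]: "f \<in> borel_measurable M" and "integrable M (\<lambda>\<omega>. \<bar>f \<omega>\<bar> ^ 5)" and B: "B > 0"
  shows "prob {\<omega>\<in>space M. \<bar>f \<omega>\<bar> > B} \<le> expectation (\<lambda>\<omega>. \<bar>f \<omega>\<bar> ^ 5) / B ^ 5"
proof -
  have "prob {\<omega>\<in>space M. \<bar>f \<omega>\<bar> > B} \<le> prob {\<omega>\<in>space M. \<bar>f \<omega>\<bar> ^ 5 \<ge> B ^ 5}"
    using B by (intro finite_measure_mono) (auto intro!: power_mono)
  also have "\<dots> \<le> expectation (\<lambda>\<omega>. \<bar>f \<omega>\<bar> ^ 5) / B ^ 5"
    using assms by (intro integral_Markov_inequality_measure[where A="{}"]) auto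
  finally show ?thesis .
qed

subsection \<open>Arrays of i.i.d. variables\<close>

text \<open>Interpreted both for the given array, about whose moments nothing is known at first, and
  for its standardisation.\<close>

locale iid_array = prob_space M for M :: "'a measure" +
  fixes Z :: "nat \<Rightarrow> nat \<Rightarrow> 'a \<Rightarrow> real"
  assumes Z_measurable[measurable]: "Z k i \<in> borel_measurable M"
    and indep: "indep_vars (\<lambda>_. borel) (\<lambda>(k, i). Z k i) ({1..} \<times> {1..})"
    and ident: "k \<ge> 1 \<Longrightarrow> i \<ge> 1 \<Longrightarrow> distr M borel (Z k i) = distr M borel (Z 1 1)"
begin

abbreviation entry :: "nat \<times> nat \<Rightarrow> 'a \<Rightarrow> real" where
  "entry \<equiv> (\<lambda>(k, i). Z k i)"

lemma indep_rows:
  assumes "C \<subseteq> {1..}" and f: "\<And>k. f k \<in> borel_measurable (PiM C (\<lambda>_. borel))"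
  shows "indep_vars (\<lambda>_. borel) (\<lambda>k \<omega>. f k (\<lambda>i\<in>C. Z k i \<omega>)) {1..}"
proof -
  have "indep_vars (\<lambda>_. borel)
    (\<lambda>k \<omega>. (\<lambda>k g. f k (\<lambda>i\<in>C. g (k, i))) k (\<lambda>x\<in>{k} \<times> C. entry x \<omega>)) {1..}"
  proof (rule indep_vars_group[OF indep])
    show "(\<lambda>g. f k (\<lambda>i\<in>C. g (k, i))) \<in> borel_measurable (PiM ({k} \<times> C) (\<lambda>_. borel))" for k
      by (intro measurable_compose[OF _ f] measurable_restrict measurable_component_singleton) auto
  qed (use assms in \<open>auto simp: disjoint_family_on_def\<close>)
  moreover have "(\<lambda>i\<in>C. (\<lambda>x\<in>{k} \<times> C. entry x \<omega>) (k, i)) = (\<lambda>i\<in>C. Z k i \<omega>)" for k \<omega>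
    by (auto simp: restrict_def)
  ultimately show ?thesis by simp
qed

lemma indep_row_entries:
  assumes "C \<subseteq> {1..}" and "k \<ge> 1" and f: "\<And>i. i \<in> C \<Longrightarrow> f i \<in> borel_measurable borel"
  shows "indep_vars (\<lambda>_. borel) (\<lambda>i \<omega>. f i (Z k i \<omega>) :: real) C"
proof -
  have "indep_vars (\<lambda>_. borel) (\<lambda>i. entry (k, i)) C"
    using assms by (intro indep_vars_reindex_inj[OF indep]) (auto simp: inj_on_def)
  from indep_vars_compose2[OF this f] show ?thesis by simp
qed

lemma indep_pair_rows:
  fixes f :: "real \<Rightarrow> real \<Rightarrow> real"
  assumes "1 \<le> i" "1 \<le> j" and "case_prod f \<in> borel_measurable (borel \<Otimes>\<^sub>M borel)"
  shows "indep_vars (\<lambda>_. borel) (\<lambda>k \<omega>. f (Z k i \<omega>) (Z k j \<omega>)) {1..}"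
proof -
  have "(\<lambda>g. case_prod f (g i, g j)) \<in> borel_measurable (PiM {i, j} (\<lambda>_. borel))"
    by (intro measurable_compose[OF _ assms(3)] measurable_Pair measurable_component_singleton) auto
  then show ?thesis using indep_rows[of "{i, j}" "\<lambda>_ g. f (g i) (g j)"] assms by simp
qed

lemma indep_triple_rows:
  fixes f :: "real \<Rightarrow> real \<Rightarrow> real \<Rightarrow> real"
  assumes "1 \<le> i" "1 \<le> j" "1 \<le> l"
    and "(\<lambda>(x, y, z). f x y z) \<in> borel_measurable (borel \<Otimes>\<^sub>M borel \<Otimes>\<^sub>M borel)"
  shows "indep_vars (\<lambda>_. borel) (\<lambda>k \<omega>. f (Z k i \<omega>) (Z k j \<omega>) (Z k l \<omega>)) {1..}"
proof -
  have "(\<lambda>g. (\<lambda>(x, y, z). f x y z) (g i, g j, g l)) \<in> borel_measurable (PiM {i, j, l} (\<lambda>_. borel))"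
    by (intro measurable_compose[OF _ assms(4)] measurable_Pair measurable_component_singleton) auto
  then show ?thesis using indep_rows[of "{i, j, l}" "\<lambda>_ g. f (g i) (g j) (g l)"] assms by simp
qed

text \<open>Exchangeability of the array: both relabelled families are independent with the same
  marginals. It allows events to be moved to the first row or to columns 1 and 2.\<close>

lemma prob_reindex:
  assumes "J \<noteq> {}" and "inj_on f J" "f ` J \<subseteq> {1..} \<times> {1..}" and "inj_on g J" "g ` J \<subseteq> {1..} \<times> {1..}"
    and "{x \<in> space (PiM J (\<lambda>_. borel)). P x} \<in> sets (PiM J (\<lambda>_. borel))"
  shows "prob {\<omega>\<in>space M. P (\<lambda>x\<in>J. entry (f x) \<omega>)} = prob {\<omega>\<in>space M. P (\<lambda>x\<in>J. entry (g x) \<omega>)}"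
proof (rule prob_indep_law_eq[OF assms(1) indep_vars_reindex_inj[OF indep assms(2,3)]
      indep_vars_reindex_inj[OF indep assms(4,5)] _ assms(6)])
  fix x assume x: "x \<in> J"
  have "distr M borel (entry y) = distr M borel (Z 1 1)" if "y \<in> {1..} \<times> {1..}" for y
    using that ident[of "fst y" "snd y"] by (cases y) simp
  moreover have "f x \<in> {1..} \<times> {1..}" "g x \<in> {1..} \<times> {1..}" using x assms(3,5) by blast+
  ultimately show "distr M borel (entry (f x)) = distr M borel (entry (g x))" by simp
qed

lemma integrable_entry_iff:
  assumes "k \<ge> 1" "i \<ge> 1" and [measurable]: "g \<in> borel_measurable borel"
  shows "integrable M (\<lambda>\<omega>. g (Z k i \<omega>) :: real) \<longleftrightarrow> integrable M (\<lambda>\<omega>. g (Z 1 1 \<omega>))"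
  using integrable_distr_eq[of "Z k i" M borel g] integrable_distr_eq[of "Z 1 1" M borel g]
    ident[OF assms(1,2)] by simp

lemma expectation_entry:
  assumes "k \<ge> 1" "i \<ge> 1" and [measurable]: "g \<in> borel_measurable borel"
  shows "expectation (\<lambda>\<omega>. g (Z k i \<omega>) :: real) = expectation (\<lambda>\<omega>. g (Z 1 1 \<omega>))"
  using integral_distr[of "Z k i" M borel g] integral_distr[of "Z 1 1" M borel g]
    ident[OF assms(1,2)] by simp

lemma prob_entry:
  assumes "k \<ge> 1" "i \<ge> 1" and [measurable]: "Measurable.pred borel P"
  shows "prob {\<omega>\<in>space M. P (Z k i \<omega>)} = prob {\<omega>\<in>space M. P (Z 1 1 \<omega>)}"
proof -
  have "measure (distr M borel (Z k i)) {x\<in>space borel. P x} = measure (distr M borel (Z 1 1)) {x\<in>space borel. P x}"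
    using ident[OF assms(1,2)] by simp
  then show ?thesis by (simp add: measure_distr vimage_def Int_def conj_commute)
qed

end

section \<open>Moments of standardised entries and of products of two entries\<close>

locale std_array = iid_array +
  assumes int5: "integrable M (\<lambda>\<omega>. \<bar>Z 1 1 \<omega>\<bar> ^ 5)"
    and mean0: "expectation (Z 1 1) = 0"
    and var1: "expectation (\<lambda>\<omega>. (Z 1 1 \<omega>)\<^sup>2) = 1"
begin

definition E4 :: real where "E4 = expectation (\<lambda>\<omega>. (Z 1 1 \<omega>) ^ 4)"
text \<open>The fourth moment of a product of two different entries of a row, by independence. In
  contrast \<open>K5\<close> belongs to a single entry, and its square to the product.\<close>

definition K4 :: real where "K4 = E4\<^sup>2"
definition K5 :: real where "K5 = expectation (\<lambda>\<omega>. \<bar>Z 1 1 \<omega>\<bar> ^ 5)"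

lemma E4_nonneg: "E4 \<ge> 0" and K4_nonneg: "K4 \<ge> 0" and K5_nonneg: "K5 \<ge> 0"
  by (auto simp: E4_def K4_def K5_def)

lemma integrable_abs_power:
  assumes "k \<ge> 1" "i \<ge> 1" "q \<le> 5"
  shows "integrable M (\<lambda>\<omega>. \<bar>Z k i \<omega>\<bar> ^ q)"
proof -
  have b: "\<bar>x\<bar> ^ q \<le> 1 + \<bar>x\<bar> ^ 5" for x :: real
  proof (cases "\<bar>x\<bar> \<le> 1")
    case True then show ?thesis using power_le_one[of "\<bar>x\<bar>" q] by (simp add: add_increasing2)
  next
    case False
    then have "\<bar>x\<bar> ^ q \<le> \<bar>x\<bar> ^ 5" by (intro power_increasing assms(3)) simp
    then show ?thesis by linarith
  qed
  have "integrable M (\<lambda>\<omega>. \<bar>Z 1 1 \<omega>\<bar> ^ q)"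
    by (rule Bochner_Integration.integrable_bound[of _ "\<lambda>\<omega>. 1 + \<bar>Z 1 1 \<omega>\<bar> ^ 5"])
      (use int5 b in \<open>auto intro!: AE_I2 simp: abs_of_nonneg\<close>)
  then show ?thesis using integrable_entry_iff[OF assms(1,2), of "\<lambda>x. \<bar>x\<bar> ^ q"] by simp
qed

lemma integrable_power:
  assumes "k \<ge> 1" "i \<ge> 1" "q \<le> 5"
  shows "integrable M (\<lambda>\<omega>. Z k i \<omega> ^ q)"
  by (rule Bochner_Integration.integrable_bound[OF integrable_abs_power[OF assms]])
    (auto simp: power_abs)

lemma row_prod:
  assumes "finite C" "C \<noteq> {}" "C \<subseteq> {1..}" "k \<ge> 1" "\<And>i. i \<in> C \<Longrightarrow> q i \<le> 5"
  shows "integrable M (\<lambda>\<omega>. \<Prod>i\<in>C. Z k i \<omega> ^ q i)"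
    and "expectation (\<lambda>\<omega>. \<Prod>i\<in>C. Z k i \<omega> ^ q i) = (\<Prod>i\<in>C. expectation (\<lambda>\<omega>. Z 1 1 \<omega> ^ q i))"
proof -
  have i: "integrable M (\<lambda>\<omega>. Z k i \<omega> ^ q i)" if "i \<in> C" for i
    using assms that by (intro integrable_power) auto
  have ind: "indep_vars (\<lambda>_. borel) (\<lambda>i \<omega>. (\<lambda>x. x ^ q i) (Z k i \<omega>)) C"
    using assms by (intro indep_row_entries) auto
  show "integrable M (\<lambda>\<omega>. \<Prod>i\<in>C. Z k i \<omega> ^ q i)"
    using indep_vars_integrable[OF assms(1) ind] i by simp
  have "expectation (\<lambda>\<omega>. \<Prod>i\<in>C. Z k i \<omega> ^ q i) = (\<Prod>i\<in>C. expectation (\<lambda>\<omega>. Z k i \<omega> ^ q i))"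
    using indep_vars_lebesgue_integral[OF assms(1) ind] i by simp
  also have "\<dots> = (\<Prod>i\<in>C. expectation (\<lambda>\<omega>. Z 1 1 \<omega> ^ q i))"
    using assms by (intro prod.cong refl expectation_entry) auto
  finally show "expectation (\<lambda>\<omega>. \<Prod>i\<in>C. Z k i \<omega> ^ q i) = (\<Prod>i\<in>C. expectation (\<lambda>\<omega>. Z 1 1 \<omega> ^ q i))" .
qed

abbreviation Y :: "nat \<Rightarrow> nat \<Rightarrow> nat \<Rightarrow> 'a \<Rightarrow> real" where
  "Y k i j \<omega> \<equiv> Z k i \<omega> * Z k j \<omega>"

lemma Y_power:
  assumes "k \<ge> 1" "i \<ge> 1" "j \<ge> 1" "i \<noteq> j" "q \<le> 5"
  shows "integrable M (\<lambda>\<omega>. (Y k i j \<omega>) ^ q)"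
    and "expectation (\<lambda>\<omega>. (Y k i j \<omega>) ^ q) = (expectation (\<lambda>\<omega>. Z 1 1 \<omega> ^ q))\<^sup>2"
  using row_prod[of "{i, j}" k "\<lambda>_. q"] assms by (auto simp: power_mult_distrib power2_eq_square)

lemma Y_moments:
  assumes "k \<ge> 1" "i \<ge> 1" "j \<ge> 1" "i \<noteq> j"
  shows "integrable M (Y k i j)" "expectation (Y k i j) = 0"
    "integrable M (\<lambda>\<omega>. (Y k i j \<omega>)\<^sup>2)" "expectation (\<lambda>\<omega>. (Y k i j \<omega>)\<^sup>2) = 1"
    "integrable M (\<lambda>\<omega>. (Y k i j \<omega>) ^ 4)" "expectation (\<lambda>\<omega>. (Y k i j \<omega>) ^ 4) = K4"
proof -
  have m: "expectation (Z (Suc 0) (Suc 0)) = 0" "expectation (\<lambda>\<omega>. (Z (Suc 0) (Suc 0) \<omega>)\<^sup>2) = 1"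
    using mean0 var1 by simp_all
  show "integrable M (Y k i j)" "expectation (Y k i j) = 0"
    using Y_power[OF assms, of 1] m by simp_all
  show "integrable M (\<lambda>\<omega>. (Y k i j \<omega>)\<^sup>2)" "expectation (\<lambda>\<omega>. (Y k i j \<omega>)\<^sup>2) = 1"
    using Y_power[OF assms, of 2] m by simp_all
  show "integrable M (\<lambda>\<omega>. (Y k i j \<omega>) ^ 4)" "expectation (\<lambda>\<omega>. (Y k i j \<omega>) ^ 4) = K4"
    using Y_power[OF assms, of 4] by (simp_all add: E4_def K4_def)
qed

lemma Y_abs5:
  assumes "k \<ge> 1" "i \<ge> 1" "j \<ge> 1" "i \<noteq> j"
  shows "integrable M (\<lambda>\<omega>. \<bar>Y k i j \<omega>\<bar> ^ 5)" "expectation (\<lambda>\<omega>. \<bar>Y k i j \<omega>\<bar> ^ 5) = K5\<^sup>2"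
proof -
  have ind: "indep_vars (\<lambda>_. borel) (\<lambda>i \<omega>. (\<lambda>x. \<bar>x\<bar> ^ 5) (Z k i \<omega>)) {i, j}"
    using assms by (intro indep_row_entries) auto
  have i: "integrable M (\<lambda>\<omega>. \<bar>Z k l \<omega>\<bar> ^ 5)" if "l \<in> {i, j}" for l
    using assms that by (intro integrable_abs_power) auto
  show "integrable M (\<lambda>\<omega>. \<bar>Y k i j \<omega>\<bar> ^ 5)"
    using indep_vars_integrable[OF _ ind] i assms(4) by (simp add: abs_mult power_mult_distrib)
  have e: "expectation (\<lambda>\<omega>. \<bar>Z k l \<omega>\<bar> ^ 5) = K5" if "l \<in> {i, j}" for l
    unfolding K5_def using assms that by (intro expectation_entry) auto
  show "expectation (\<lambda>\<omega>. \<bar>Y k i j \<omega>\<bar> ^ 5) = K5\<^sup>2"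
    using indep_vars_lebesgue_integral[OF _ ind] i e assms(4)
    by (simp add: abs_mult power_mult_distrib power2_eq_square)
qed

lemma Z_tail:
  assumes "k \<ge> 1" "i \<ge> 1" "B > 0"
  shows "prob {\<omega>\<in>space M. \<bar>Z k i \<omega>\<bar> > B} \<le> K5 / B ^ 5"
proof -
  have "expectation (\<lambda>\<omega>. \<bar>Z k i \<omega>\<bar> ^ 5) = K5"
    unfolding K5_def using assms by (intro expectation_entry) auto
  then show ?thesis using abs5_tail[OF _ integrable_abs_power[OF assms(1,2)] assms(3)] by simp
qed

lemma Y_tail:
  assumes "k \<ge> 1" "i \<ge> 1" "j \<ge> 1" "i \<noteq> j" "B > 0"
  shows "prob {\<omega>\<in>space M. \<bar>Y k i j \<omega>\<bar> > B} \<le> K5\<^sup>2 / B ^ 5"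
  using abs5_tail[OF _ Y_abs5(1)[OF assms(1-4)] assms(5)] Y_abs5(2)[OF assms(1-4)] by simp

lemma trunc_Y_mean:
  assumes "k \<ge> 1" "i \<ge> 1" "j \<ge> 1" "i \<noteq> j" "B > 0"
  shows "\<bar>expectation (\<lambda>\<omega>. trunc B (Y k i j \<omega>))\<bar> \<le> K4 / B ^ 3"
  using expectation_trunc_le[of "Y k i j", OF _ Y_moments(5,1,2)[OF assms(1-4)] assms(5)]
    Y_moments(6)[OF assms(1-4)] by simp

lemma trunc_Y_integrable:
  assumes "k \<ge> 1" "i \<ge> 1" "j \<ge> 1" "i \<noteq> j"
  shows "integrable M (\<lambda>\<omega>. trunc B (Y k i j \<omega>))" "integrable M (\<lambda>\<omega>. (trunc B (Y k i j \<omega>))\<^sup>2)"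
  by (rule Bochner_Integration.integrable_bound[OF Y_moments(1)[OF assms]],
      simp, simp add: abs_trunc_le_abs,
      rule Bochner_Integration.integrable_bound[OF Y_moments(3)[OF assms]],
      simp, simp add: trunc_sq_le)

lemma trunc_Y_var:
  assumes "k \<ge> 1" "i \<ge> 1" "j \<ge> 1" "i \<noteq> j"
  shows "expectation (\<lambda>\<omega>. (trunc B (Y k i j \<omega>))\<^sup>2) \<le> 1"
proof -
  have "expectation (\<lambda>\<omega>. (trunc B (Y k i j \<omega>))\<^sup>2) \<le> expectation (\<lambda>\<omega>. (Y k i j \<omega>)\<^sup>2)"
    using assms by (intro integral_mono trunc_Y_integrable Y_moments trunc_sq_le)
  then show ?thesis using Y_moments(4)[OF assms] by simp
qed

lemma indep_trunc_Y:
  assumes "i \<ge> 1" "j \<ge> 1" "I \<subseteq> {1..}"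
  shows "indep_vars (\<lambda>_. borel) (\<lambda>k \<omega>. trunc B (Y k i j \<omega>)) I"
  by (rule indep_vars_subset[OF indep_pair_rows[OF assms(1,2)] assms(3)]) measurable

end

subsection \<open>Lower bound for moderate deviations\<close>

text \<open>The standard normal density at x + 1. For nonnegative x it bounds the tail beyond x from
  below, because over the interval from x to x + 1 the density is smallest at the right end.\<close>

definition tail_lb :: "real \<Rightarrow> real" where
  "tail_lb x = exp (- (x + 1)\<^sup>2 / 2) / sqrt (2 * pi)"

lemma tail_lb_pos: "tail_lb x > 0"
  by (simp add: tail_lb_def)

lemma std_normal_tail:
  assumes "x \<ge> 0"
  shows "tail_lb x \<le> measure std_normal_distribution {x<..}"
proof -
  interpret real_distribution std_normal_distribution by (rule real_dist_normal_dist)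
  have "ennreal (tail_lb x) = (\<integral>\<^sup>+y. ennreal (tail_lb x) * indicator {x<..x+1} y \<partial>lborel)"
    by (simp add: nn_integral_cmult_indicator)
  also have "\<dots> \<le> (\<integral>\<^sup>+y. ennreal (std_normal_density y) * indicator {x<..} y \<partial>lborel)"
  proof (intro nn_integral_mono)
    fix y :: real
    have "tail_lb x \<le> std_normal_density y" if "x < y" "y \<le> x + 1"
    proof -
      have "y\<^sup>2 \<le> (x + 1)\<^sup>2" using that assms by (intro power_mono) auto
      then show ?thesis by (simp add: tail_lb_def std_normal_density_def divide_simps)
    qed
    then show "ennreal (tail_lb x) * indicator {x<..x+1} y \<le> ennreal (std_normal_density y) * indicator {x<..} y"
      by (auto simp: indicator_def intro!: ennreal_leI)
  qed
  also have "\<dots> = emeasure std_normal_distribution {x<..}"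
    by (simp add: emeasure_density)
  finally show ?thesis
    unfolding emeasure_eq_measure by (subst (asm) ennreal_le_iff) auto
qed

text \<open>The normal tail is at least \<open>tail_lb x\<close>; a factor below 1 gives the strict
  inequality that passes from the limit to large \<open>n\<close>. With 3/4, another quarter can be
  lost to truncation and one half remains.\<close>

lemma (in prob_space) clt_tail:
  fixes W :: "nat \<Rightarrow> 'a \<Rightarrow> real"
  assumes "indep_vars (\<lambda>_. borel) W UNIV"
    and "\<And>n. expectation (W n) = 0" and "\<And>n. integrable M (\<lambda>\<omega>. (W n \<omega>)\<^sup>2)"
    and "\<And>n. expectation (\<lambda>\<omega>. (W n \<omega>)\<^sup>2) = 1"
    and "\<And>n. distr M borel (W n) = distr M borel (W 0)"
    and "x \<ge> 0"
  shows "\<forall>\<^sub>F n in sequentially.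
    3 / 4 * tail_lb x < prob {\<omega>\<in>space M. (\<Sum>i<n. W i \<omega>) > x * sqrt n}"
proof -
  have [measurable]: "W i \<in> borel_measurable M" for i
    using assms(1) by (auto simp: indep_vars_def)
  interpret N: real_distribution std_normal_distribution by (rule real_dist_normal_dist)
  have "weak_conv_m (\<lambda>n. distr M borel (\<lambda>\<omega>. (\<Sum>i<n. W i \<omega>) / sqrt (real n * 1\<^sup>2))) std_normal_distribution"
    by (rule central_limit_theorem_zero_mean[OF assms(1,2) zero_less_one assms(3) _ assms(5)])
      (simp add: assms(2,4))
  \<comment> \<open>The normal law has no atoms, so weak convergence gives convergence of the
    distribution functions at \<open>x\<close>.\<close>
  moreover have "isCont (cdf std_normal_distribution) x"
    unfolding N.isCont_cdf by (simp add: measure_def emeasure_density)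
  ultimately have "(\<lambda>n. cdf (distr M borel (\<lambda>\<omega>. (\<Sum>i<n. W i \<omega>) / sqrt (real n * 1\<^sup>2))) x)
      \<longlonglongrightarrow> cdf std_normal_distribution x"
    by (auto simp: weak_conv_m_def weak_conv_def)
  moreover have "cdf std_normal_distribution x < 1 - 3 / 4 * tail_lb x"
  proof -
    have "measure std_normal_distribution {x<..} = 1 - cdf std_normal_distribution x"
      unfolding cdf_def by (subst N.prob_compl[symmetric]) (auto intro!: arg_cong[where f="measure _"])
    then show ?thesis using std_normal_tail[OF assms(6)] tail_lb_pos[of x] by simp
  qed
  ultimately have "\<forall>\<^sub>F n in sequentially.
      cdf (distr M borel (\<lambda>\<omega>. (\<Sum>i<n. W i \<omega>) / sqrt (real n * 1\<^sup>2))) x < 1 - 3 / 4 * tail_lb x"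
    by (rule order_tendstoD)
  then show ?thesis using eventually_gt_at_top[of 0]
  proof eventually_elim
    case (elim n)
    have "cdf (distr M borel (\<lambda>\<omega>. (\<Sum>i<n. W i \<omega>) / sqrt (real n * 1\<^sup>2))) x
        = prob {\<omega>\<in>space M. \<not> (\<Sum>i<n. W i \<omega>) > x * sqrt n}"
      unfolding cdf_def using elim(2)
      by (subst measure_distr) (auto simp: divide_simps not_less mult.commute intro!: arg_cong[where f=prob])
    also have "\<dots> = 1 - prob {\<omega>\<in>space M. (\<Sum>i<n. W i \<omega>) > x * sqrt n}"
      by (subst prob_neg) auto
    finally show ?case using elim(1) by simp
  qed
qed

text \<open>Exchangeability for one pair of columns and a shifted stretch of rows. The function
  \<open>h\<close> is a truncation in most uses; as an indicator it yields equality of the laws of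
  single products.\<close>

lemma (in iid_array) prob_pair_sum:
  fixes h :: "real \<Rightarrow> real"
  assumes A: "finite A" "A \<subseteq> {1..}" and "1 \<le> i" "1 \<le> j" "i \<noteq> j"
    and [measurable]: "h \<in> borel_measurable borel"
  shows "prob {\<omega>\<in>space M. (\<Sum>k\<in>A. h (Z (s + k) i \<omega> * Z (s + k) j \<omega>)) > t}
    = prob {\<omega>\<in>space M. (\<Sum>k\<in>A. h (Z k 1 \<omega> * Z k 2 \<omega>)) > t}"
proof (cases "A = {}")
  case False
  \<comment> \<open>The Boolean component tells the two columns apart: \<open>True\<close> stands
    for the first factor and \<open>False\<close> for the second.\<close>
  let ?J = "A \<times> (UNIV :: bool set)"
  define P :: "(nat \<times> bool \<Rightarrow> real) \<Rightarrow> bool" where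
    "P x \<longleftrightarrow> (\<Sum>k\<in>A. h (x (k, True) * x (k, False))) > t" for x
  let ?f = "\<lambda>(k, b). (s + k, if b then i else j)"
  let ?g = "\<lambda>(k, b). (k, if b then 1 else 2 :: nat)"
  have comp[measurable]: "(\<lambda>x. x y) \<in> borel_measurable (PiM ?J (\<lambda>_. borel))" if "y \<in> ?J" for y
    using that by (rule measurable_component_singleton)
  have m: "(\<lambda>x. \<Sum>k\<in>A. h (x (k, True) * x (k, False))) \<in> borel_measurable (PiM ?J (\<lambda>_. borel))"
    by (intro borel_measurable_sum measurable_compose[OF _ assms(6)] borel_measurable_times comp) auto
  have "prob {\<omega>\<in>space M. P (\<lambda>x\<in>?J. entry (?f x) \<omega>)} = prob {\<omega>\<in>space M. P (\<lambda>x\<in>?J. entry (?g x) \<omega>)}"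
  proof (rule prob_reindex)
    show "?J \<noteq> {}" using False by auto
    show "inj_on ?f ?J" "inj_on ?g ?J" using assms by (auto simp: inj_on_def split: if_splits)
    show "?f ` ?J \<subseteq> {1..} \<times> {1..}" "?g ` ?J \<subseteq> {1..} \<times> {1..}" using assms by auto
    show "{x \<in> space (PiM ?J (\<lambda>_. borel)). P x} \<in> sets (PiM ?J (\<lambda>_. borel))"
      unfolding P_def using m by measurable
  qed
  then show ?thesis by (simp add: P_def cong: sum.cong)
qed simp

text \<open>Unless one of the \<open>l\<close> products exceeds \<open>B\<close>, the truncated sum
  is the full sum. The union bound for that exception costs at most a quarter of
  \<open>tail_lb x\<close>.\<close>

lemma (in std_array) block_tail:
  assumes "x \<ge> 0" "l \<ge> 1" "B > 0"
    and "3 / 4 * tail_lb x < prob {\<omega>\<in>space M. (\<Sum>k=1..l. Y k 1 2 \<omega>) > x * sqrt l}"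
    and "real l * (K5\<^sup>2 / B ^ 5) \<le> tail_lb x / 4"
  shows "tail_lb x / 2 \<le> prob {\<omega>\<in>space M. (\<Sum>k=1..l. trunc B (Y (s + k) 1 2 \<omega>)) > x * sqrt l}"
proof -
  have "3 / 4 * tail_lb x \<le> prob {\<omega>\<in>space M. (\<Sum>k=1..l. Y k 1 2 \<omega>) > x * sqrt l}"
    using assms by simp
  also have "\<dots> \<le> prob ({\<omega>\<in>space M. (\<Sum>k=1..l. trunc B (Y k 1 2 \<omega>)) > x * sqrt l} \<union>
      (\<Union>k\<in>{1..l}. {\<omega>\<in>space M. \<bar>Y k 1 2 \<omega>\<bar> > B}))"
  proof (intro finite_measure_mono subsetI)
    fix \<omega> assume *: "\<omega> \<in> {\<omega>\<in>space M. (\<Sum>k=1..l. Y k 1 2 \<omega>) > x * sqrt l}"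
    show "\<omega> \<in> {\<omega>\<in>space M. (\<Sum>k=1..l. trunc B (Y k 1 2 \<omega>)) > x * sqrt l} \<union>
      (\<Union>k\<in>{1..l}. {\<omega>\<in>space M. \<bar>Y k 1 2 \<omega>\<bar> > B})"
    proof (cases "\<exists>k\<in>{1..l}. \<bar>Y k 1 2 \<omega>\<bar> > B")
      case False
      then have "(\<Sum>k=1..l. trunc B (Y k 1 2 \<omega>)) = (\<Sum>k=1..l. Y k 1 2 \<omega>)"
        by (intro sum.cong) (auto simp: trunc_def not_less simp del: mult_eq_0_iff)
      then show ?thesis using * by simp
    qed (use * in auto)
  qed measurable
  also have "\<dots> \<le> prob {\<omega>\<in>space M. (\<Sum>k=1..l. trunc B (Y k 1 2 \<omega>)) > x * sqrt l} +
      prob (\<Union>k\<in>{1..l}. {\<omega>\<in>space M. \<bar>Y k 1 2 \<omega>\<bar> > B})"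
    by (intro measure_Un_le) measurable
  also have "prob (\<Union>k\<in>{1..l}. {\<omega>\<in>space M. \<bar>Y k 1 2 \<omega>\<bar> > B}) \<le> (\<Sum>k\<in>{1..l}. K5\<^sup>2 / B ^ 5)"
    by (rule order_trans[OF measure_UNION_le]) (auto intro!: sum_mono Y_tail \<open>B > 0\<close> simp del: sum_constant)
  also have "\<dots> = real l * (K5\<^sup>2 / B ^ 5)" by simp
  also have "\<dots> \<le> tail_lb x / 4" by fact
  also have "prob {\<omega>\<in>space M. (\<Sum>k=1..l. trunc B (Y k 1 2 \<omega>)) > x * sqrt l}
    = prob {\<omega>\<in>space M. (\<Sum>k=1..l. trunc B (Y (s + k) 1 2 \<omega>)) > x * sqrt l}"
    by (subst prob_pair_sum) auto
  finally show ?thesis by simp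
qed

lemma (in std_array) clt_Y:
  assumes "x \<ge> 0"
  shows "\<forall>\<^sub>F l in sequentially. 3 / 4 * tail_lb x < prob {\<omega>\<in>space M. (\<Sum>k=1..l. Y k 1 2 \<omega>) > x * sqrt l}"
proof -
  have ind: "indep_vars (\<lambda>_. borel) (\<lambda>k. Y k 1 2) {1..}"
    by (rule indep_pair_rows) auto
  have "indep_vars (\<lambda>_. borel) (\<lambda>k. Y (Suc k) 1 2) UNIV"
    by (rule indep_vars_reindex_inj[OF ind]) auto
  moreover have "distr M borel (Y (Suc k) 1 2) = distr M borel (Y (Suc 0) 1 2)" for k
  proof (rule measure_eqI)
    fix A :: "real set" assume "A \<in> sets (distr M borel (Y (Suc k) 1 2))"
    then have [measurable]: "A \<in> sets borel" by simp
    \<comment> \<open>A sum with one term, applied to the indicator of \<open>A\<close>, is positive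
      exactly on the preimage of \<open>A\<close>; this compares the laws of the products in
      different rows.\<close>
    have "prob {\<omega>\<in>space M. (\<Sum>l\<in>{1}. indicator A (Z (k + l) 1 \<omega> * Z (k + l) 2 \<omega>)) > (0::real)}
      = prob {\<omega>\<in>space M. (\<Sum>l\<in>{1}. indicator A (Z l 1 \<omega> * Z l 2 \<omega>)) > (0::real)}"
      by (rule prob_pair_sum) auto
    moreover have "{\<omega>\<in>space M. (indicator A (f \<omega>) :: real) > 0} = f -` A \<inter> space M" for f
      by (auto simp: indicator_def split: if_splits)
    ultimately show "emeasure (distr M borel (Y (Suc k) 1 2)) A = emeasure (distr M borel (Y (Suc 0) 1 2)) A"
      by (simp add: emeasure_distr emeasure_eq_measure)
  qed simp
  ultimately have "\<forall>\<^sub>F l in sequentially. 3 / 4 * tail_lb x <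
      prob {\<omega>\<in>space M. (\<Sum>k<l. Y (Suc k) 1 2 \<omega>) > x * sqrt l}"
    by (intro clt_tail assms) (auto simp: Y_moments)
  moreover have "(\<Sum>k<l. Y (Suc k) 1 2 \<omega>) = (\<Sum>k=1..l. Y k 1 2 \<omega>)" for l \<omega>
    by (simp add: sum.atLeast1_atMost_eq)
  ultimately show ?thesis by simp
qed

text \<open>Force each of \<open>r\<close> consecutive blocks of length \<open>l\<close> to contribute \<open>x sqrt l\<close>. With
  \<open>r \<approx> ln N / \<kappa>\<^sup>2\<close> a block only has to exceed a fixed multiple of its standard deviation, so the
  central limit theorem gives a Cramer-type lower bound without exponential tilting.\<close>

lemma (in std_array) trunc_sum_product_lb:
  fixes N r l :: nat
  assumes "x \<ge> 0" "l \<ge> 1" "B > 0" "r * l \<le> N"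
    and bl: "\<And>s. \<beta> \<le> prob {\<omega>\<in>space M. (\<Sum>k=1..l. trunc B (Y (s + k) 1 2 \<omega>)) > x * sqrt l}"
    and "\<beta> \<ge> 0" and rem: "2 * (N - r * l) \<le> sqrt N" and "N > 0"
    and t: "t \<le> r * (x * sqrt l) - sqrt N"
  shows "\<beta> ^ r / 2 \<le> prob {\<omega>\<in>space M. (\<Sum>k=1..N. trunc B (Y k 1 2 \<omega>)) > t}"
proof -
  \<comment> \<open>Blocks below \<open>r\<close> are full; the one with index \<open>r\<close>
    collects the rows left over. It need not be large, only not below -sqrt N, which happens with
    probability at least 1/2.\<close>
  define K where "K j = (if j < r then {j * l + 1..j * l + l} else {r * l + 1..N})" for j
  define b where "b j \<omega> = (\<Sum>k\<in>K j. trunc B (Y k 1 2 \<omega>))" for j \<omega>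
  have disj: "disjoint_family_on K {..r}"
  proof -
    have "K j \<inter> K j' = {}" if "j < j'" "j' \<le> r" for j j'
    proof -
      have "j * l + l \<le> j' * l" using that by (metis Suc_leI add.commute mult_Suc mult_le_mono1)
      then show ?thesis using that by (auto simp: K_def)
    qed
    then show ?thesis unfolding disjoint_family_on_def
      by (metis Int_commute atMost_iff linorder_neqE_nat)
  qed
  have ind: "indep_vars (\<lambda>_. borel) b {..r}"
  proof -
    have "indep_vars (\<lambda>_. borel) (\<lambda>j \<omega>. (\<lambda>j g. \<Sum>k\<in>K j. g k) j (\<lambda>k\<in>K j. trunc B (Y k 1 2 \<omega>))) {..r}"
      by (rule indep_vars_group[OF indep_trunc_Y[OF _ _ subset_refl] _ disj]) (auto simp: K_def)
    moreover have "(\<Sum>k\<in>K j. (\<lambda>k\<in>K j. trunc B (Y k 1 2 \<omega>)) k) = b j \<omega>" for j \<omega>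
      unfolding b_def by (intro sum.cong) auto
    ultimately show ?thesis by simp
  qed
  have [measurable]: "b j \<in> borel_measurable M" for j unfolding b_def by measurable
  have UN: "(\<Union>j\<in>{..r}. K j) = {1..N}"
  proof
    show "{1..N} \<subseteq> (\<Union>j\<in>{..r}. K j)"
    proof
      fix k assume k: "k \<in> {1..N}"
      show "k \<in> (\<Union>j\<in>{..r}. K j)"
      proof (cases "k \<le> r * l")
        case True
        \<comment> \<open>Rows are counted from 1 and blocks from 0, hence the shift.\<close>
        let ?j = "(k - 1) div l"
        have j: "?j < r" using True k \<open>l \<ge> 1\<close> by (auto simp: div_less_iff_less_mult)
        have "?j * l \<le> k - 1" "k - 1 < ?j * l + l"
          using \<open>l \<ge> 1\<close> div_mult_mod_eq[of "k - 1" l] mod_less_divisor[of l "k - 1"] by linarith+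
        moreover have "k \<ge> 1" using k by simp
        ultimately have "?j * l + 1 \<le> k" "k \<le> ?j * l + l" by linarith+
        then have "k \<in> K ?j" using j by (simp add: K_def)
        then show ?thesis using j by auto
      qed (use k in \<open>auto simp: K_def intro!: bexI[of _ r]\<close>)
    qed
    have "j * l + l \<le> N" if "j < r" for j
      using that assms(4) by (metis Suc_leI add.commute mult_Suc mult_le_mono1 order_trans)
    then show "(\<Union>j\<in>{..r}. K j) \<subseteq> {1..N}" by (fastforce simp: K_def split: if_splits)
  qed
  have total: "(\<Sum>k=1..N. trunc B (Y k 1 2 \<omega>)) = (\<Sum>j\<le>r. b j \<omega>)" for \<omega>
    unfolding UN[symmetric] b_def using disj
    by (intro sum.UNION_disjoint) (auto simp: K_def disjoint_family_on_def)
  define S where "S j = (if j < r then {x * sqrt l<..} else {- sqrt N<..})" for j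
  have pb: "\<beta> \<le> prob (b j -` S j \<inter> space M)" if "j < r" for j
  proof -
    have "b j \<omega> = (\<Sum>k=1..l. trunc B (Y (j * l + k) 1 2 \<omega>))" for \<omega>
      using that sum.shift_bounds_cl_nat_ivl[of "\<lambda>k. trunc B (Y k 1 2 \<omega>)" 1 "j * l" l]
      by (simp add: b_def K_def add.commute)
    then have "b j -` S j \<inter> space M = {\<omega>\<in>space M. (\<Sum>k=1..l. trunc B (Y (j * l + k) 1 2 \<omega>)) > x * sqrt l}"
      using that by (auto simp: S_def)
    then show ?thesis using bl[of "j * l"] by simp
  qed
  \<comment> \<open>Markov's inequality for the first absolute moment: each summand has absolute
    mean at most 1, and there are at most sqrt N / 2 of them.\<close>
  have pr: "1 / 2 \<le> prob (b r -` S r \<inter> space M)"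
  proof -
    have iT: "integrable M (\<lambda>\<omega>. \<bar>trunc B (Y k 1 2 \<omega>)\<bar>)" if "k \<ge> 1" for k
      using trunc_Y_integrable[of k 1 2 B] that by auto
    have e: "expectation (\<lambda>\<omega>. \<bar>trunc B (Y k 1 2 \<omega>)\<bar>) \<le> 1" if "k \<ge> 1" for k
    proof -
      have ab: "\<bar>y\<bar> \<le> (1 + y\<^sup>2) / 2" for y :: real
        using sum_squares_bound[of 1 "\<bar>y\<bar>"] by simp
      have "expectation (\<lambda>\<omega>. \<bar>trunc B (Y k 1 2 \<omega>)\<bar>)
          \<le> expectation (\<lambda>\<omega>. (1 + (trunc B (Y k 1 2 \<omega>))\<^sup>2) / 2)"
        using trunc_Y_integrable[of k 1 2 B] that by (intro integral_mono ab) auto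
      also have "\<dots> \<le> 1"
        using trunc_Y_integrable[of k 1 2 B] trunc_Y_var[of k 1 2 B] that by (simp add: prob_space)
      finally show ?thesis .
    qed
    have K1: "k \<ge> 1" if "k \<in> K r" for k using that by (auto simp: K_def)
    have ib: "integrable M (\<lambda>\<omega>. \<bar>b r \<omega>\<bar>)"
      unfolding b_def using trunc_Y_integrable[of _ 1 2 B] K1
      by (intro integrable_abs Bochner_Integration.integrable_sum) auto
    have "expectation (\<lambda>\<omega>. \<bar>b r \<omega>\<bar>) \<le> expectation (\<lambda>\<omega>. \<Sum>k\<in>K r. \<bar>trunc B (Y k 1 2 \<omega>)\<bar>)"
      using ib iT K1 by (intro integral_mono) (auto simp: b_def sum_abs)
    also have "\<dots> = (\<Sum>k\<in>K r. expectation (\<lambda>\<omega>. \<bar>trunc B (Y k 1 2 \<omega>)\<bar>))"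
      using iT K1 by (intro Bochner_Integration.integral_sum) auto
    also have "\<dots> \<le> (\<Sum>k\<in>K r. 1)" using e K1 by (intro sum_mono) auto
    also have "\<dots> = real (N - r * l)" by (simp add: K_def)
    finally have eb: "expectation (\<lambda>\<omega>. \<bar>b r \<omega>\<bar>) \<le> real (N - r * l)" .
    have "prob {\<omega>\<in>space M. \<bar>b r \<omega>\<bar> \<ge> sqrt N} \<le> expectation (\<lambda>\<omega>. \<bar>b r \<omega>\<bar>) / sqrt N"
      using ib \<open>N > 0\<close> by (intro integral_Markov_inequality_measure[where A="{}"]) auto
    also have "\<dots> \<le> 1 / 2" using eb rem \<open>N > 0\<close> by (simp add: divide_simps)
    finally have "prob {\<omega>\<in>space M. \<bar>b r \<omega>\<bar> \<ge> sqrt N} \<le> 1 / 2" .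
    moreover have "1 - prob {\<omega>\<in>space M. \<bar>b r \<omega>\<bar> \<ge> sqrt N} = prob {\<omega>\<in>space M. \<not> \<bar>b r \<omega>\<bar> \<ge> sqrt N}"
      by (subst prob_neg) auto
    moreover have "\<dots> \<le> prob (b r -` S r \<inter> space M)"
      by (intro finite_measure_mono) (auto simp: S_def)
    ultimately show ?thesis by simp
  qed
  have "\<beta> ^ r / 2 = (\<Prod>j<r. \<beta>) * (1 / 2)" by simp
  also have "\<dots> \<le> (\<Prod>j<r. prob (b j -` S j \<inter> space M)) * prob (b r -` S r \<inter> space M)"
    using \<open>\<beta> \<ge> 0\<close> pb pr by (intro mult_mono prod_mono prod_nonneg) auto
  also have "\<dots> = (\<Prod>j\<in>{..r}. prob (b j -` S j \<inter> space M))"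
    by (simp add: lessThan_Suc_atMost[symmetric])
  also have "\<dots> = prob (\<Inter>j\<in>{..r}. b j -` S j \<inter> space M)"
    by (rule indep_varsD[OF ind, symmetric]) (auto simp: S_def)
  also have "\<dots> \<le> prob {\<omega>\<in>space M. (\<Sum>k=1..N. trunc B (Y k 1 2 \<omega>)) > t}"
  proof (intro finite_measure_mono subsetI)
    fix \<omega> assume "\<omega> \<in> (\<Inter>j\<in>{..r}. b j -` S j \<inter> space M)"
    then have w: "\<omega> \<in> space M" and b: "\<And>j. j \<le> r \<Longrightarrow> b j \<omega> \<in> S j" by auto
    have bj: "b j \<omega> \<ge> x * sqrt l" if "j < r" for j using b[of j] that by (simp add: S_def)
    have br: "b r \<omega> > - sqrt N" using b[of r] by (simp add: S_def)
    have "r * (x * sqrt l) = (\<Sum>j<r. x * sqrt l)" by simp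
    also have "\<dots> \<le> (\<Sum>j<r. b j \<omega>)" using bj by (intro sum_mono) auto
    finally have "t < (\<Sum>j\<le>r. b j \<omega>)" using br t by (simp add: lessThan_Suc_atMost[symmetric])
    then show "\<omega> \<in> {\<omega>\<in>space M. (\<Sum>k=1..N. trunc B (Y k 1 2 \<omega>)) > t}" unfolding mem_Collect_eq total using w by blast
  qed measurable
  finally show ?thesis .
qed

text \<open>With ln N / \<kappa>^2 blocks, each must contribute c \<kappa> standard deviations; the
  added 1 pays for rounding and the remainder. The logarithmic cost of a block is (c \<kappa> + 2)^2
  / 2 plus a constant, and divided by \<kappa>^2 it tends to c^2 / 2 as \<kappa> grows.\<close>

lemma moderate_kappa:
  fixes c \<eta> :: real
  assumes "\<eta> > 0"
  obtains \<kappa> where "\<kappa> > 0" "ln (2 / tail_lb (c * \<kappa> + 1)) \<le> (c\<^sup>2 / 2 + \<eta> / 2) * \<kappa>\<^sup>2"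
proof -
  have "((\<lambda>\<kappa>. ln (2 * sqrt (2 * pi)) / \<kappa>\<^sup>2 + c\<^sup>2 / 2 + 2 * c * (1 / \<kappa>) + 2 / \<kappa>\<^sup>2)
      \<longlongrightarrow> 0 + c\<^sup>2 / 2 + 2 * c * 0 + 0) at_top"
    by (intro tendsto_intros) real_asymp+
  then have "\<forall>\<^sub>F \<kappa> in at_top. ln (2 * sqrt (2 * pi)) / \<kappa>\<^sup>2 + c\<^sup>2 / 2 + 2 * c * (1 / \<kappa>) + 2 / \<kappa>\<^sup>2
      < c\<^sup>2 / 2 + \<eta> / 2"
    using assms by (intro order_tendstoD(2)) auto
  then have "\<forall>\<^sub>F \<kappa> in at_top. \<kappa> > 0 \<and> ln (2 / tail_lb (c * \<kappa> + 1)) \<le> (c\<^sup>2 / 2 + \<eta> / 2) * \<kappa>\<^sup>2"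
    using eventually_gt_at_top[of 0]
  proof eventually_elim
    case (elim \<kappa>)
    have "2 / tail_lb (c * \<kappa> + 1) = 2 * sqrt (2 * pi) * exp ((c * \<kappa> + 2)\<^sup>2 / 2)"
      by (simp add: tail_lb_def exp_minus field_simps)
    then have "ln (2 / tail_lb (c * \<kappa> + 1)) = ln (2 * sqrt (2 * pi)) + (c * \<kappa> + 2)\<^sup>2 / 2"
      by (simp add: ln_mult)
    also have "\<dots> = (ln (2 * sqrt (2 * pi)) / \<kappa>\<^sup>2 + c\<^sup>2 / 2 + 2 * c * (1 / \<kappa>) + 2 / \<kappa>\<^sup>2) * \<kappa>\<^sup>2"
      using elim(2) by (simp add: algebra_simps power2_eq_square add_divide_distrib)
    also have "\<dots> \<le> (c\<^sup>2 / 2 + \<eta> / 2) * \<kappa>\<^sup>2"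
      using elim(1) by (intro mult_right_mono) auto
    finally show ?case using elim(2) by simp
  qed
  from eventually_happens'[OF _ this] show ?thesis using that by auto
qed

lemma (in std_array) moderate_deviation_lb:
  fixes c \<eta> :: real
  assumes "c > 0" "\<eta> > 0"
  shows "\<forall>\<^sub>F N in sequentially. \<forall>B \<ge> real N powr (9/20).
    real N powr (- c\<^sup>2 / 2 - \<eta>) \<le> prob {\<omega>\<in>space M. (\<Sum>k=1..N. trunc B (Y k 1 2 \<omega>)) > c * nlog N}"
proof -
  obtain \<kappa> where \<kappa>: "\<kappa> > 0" "ln (2 / tail_lb (c * \<kappa> + 1)) \<le> (c\<^sup>2 / 2 + \<eta> / 2) * \<kappa>\<^sup>2"
    using moderate_kappa[OF assms(2)] .
  \<comment> \<open>The number of blocks is about \<open>u\<close> times ln N, so the length of a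
    block tends to infinity and the central limit theorem applies to it at the fixed level
    \<open>x\<close>.\<close>
  define x where "x = c * \<kappa> + 1"
  define u where "u = 1 / \<kappa>\<^sup>2"
  define g where "g = tail_lb x"
  have pos: "u > 0" "x > 0" "g > 0" using assms \<kappa> by (auto simp: u_def x_def g_def tail_lb_pos add_pos_pos)
  have su: "sqrt u = 1 / \<kappa>" using \<kappa> by (simp add: u_def real_sqrt_divide)
  define r where "r N = nat \<lfloor>ln (real N) * u\<rfloor>" for N
  define l where "l N = N div r N" for N
  have e_r: "\<forall>\<^sub>F N in sequentially. ln (real N) * u > 1"
    using pos by real_asymp
  have "filterlim l at_top sequentially"
    unfolding filterlim_at_top
  proof
    fix m
    have "\<forall>\<^sub>F N in sequentially. ln (real N) * u * real m < real N"
      using pos by real_asymp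
    then show "\<forall>\<^sub>F N in sequentially. m \<le> l N" using e_r
    proof eventually_elim
      case (elim N)
      have "real (r N) \<le> ln (real N) * u" using elim by (simp add: r_def)
      then have "real (r N) * real m \<le> ln (real N) * u * real m" by (rule mult_right_mono) simp
      then have "real (m * r N) \<le> real N" using elim by (simp add: mult.commute)
      then have "m * r N \<le> N" by linarith
      moreover have "r N > 0" using elim unfolding r_def by linarith
      ultimately show ?case by (simp add: l_def less_eq_div_iff_mult_less_eq)
    qed
  qed
  then have e_clt: "\<forall>\<^sub>F N in sequentially. 3 / 4 * tail_lb x <
      prob {\<omega>\<in>space M. (\<Sum>k=1..l N. Y k 1 2 \<omega>) > x * sqrt (l N)}"
    and e_l: "\<forall>\<^sub>F N in sequentially. l N \<ge> 1"
    using clt_Y[of x] pos by (auto intro: eventually_compose_filterlim simp: filterlim_at_top)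
  have "(\<lambda>N. K5\<^sup>2 * (real N / real N powr (9/4))) \<longlonglongrightarrow> K5\<^sup>2 * 0"
    by (rule tendsto_mult_left) real_asymp
  then have e_K: "\<forall>\<^sub>F N in sequentially. K5\<^sup>2 * (real N / real N powr (9/4)) < g / 4"
    using pos by (intro order_tendstoD) auto
  have e_rem: "\<forall>\<^sub>F N in sequentially. 2 * (ln (real N) * u) < sqrt (real N)"
    using pos by real_asymp
  \<comment> \<open>A lower bound for what the blocks guarantee, after subtracting sqrt N for the
    remainder and dividing by \<open>nlog N\<close>. Its limit is x / \<kappa> = c + 1 / \<kappa>,
    strictly above \<open>c\<close>.\<close>
  have "(\<lambda>N. x * (sqrt ((ln (real N) * u - 1) * (real N - ln (real N) * u)) / sqrt (real N * ln (real N)))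
      - 1 / sqrt (ln (real N))) \<longlonglongrightarrow> x * sqrt u - 0"
  proof (intro tendsto_diff tendsto_mult_left)
    have "(\<lambda>N. sqrt ((ln (real N) * u - 1) * (real N - ln (real N) * u)) / sqrt (real N * ln (real N)))
        \<longlonglongrightarrow> u powr (1 / 2)"
      using pos by real_asymp
    then show "(\<lambda>N. sqrt ((ln (real N) * u - 1) * (real N - ln (real N) * u)) / sqrt (real N * ln (real N)))
        \<longlonglongrightarrow> sqrt u"
      using pos by (simp add: powr_half_sqrt)
    show "(\<lambda>N. 1 / sqrt (ln (real N))) \<longlonglongrightarrow> 0" by real_asymp
  qed
  moreover have "c < x * sqrt u - 0" using \<kappa> by (simp add: su x_def field_simps)
  ultimately have e_t: "\<forall>\<^sub>F N in sequentially. c <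
      x * (sqrt ((ln (real N) * u - 1) * (real N - ln (real N) * u)) / sqrt (real N * ln (real N)))
      - 1 / sqrt (ln (real N))"
    by (rule order_tendstoD)
  \<comment> \<open>Half of \<eta> is reserved for the factor 1/2 of the remainder block; the other
    half is spent in the choice of \<kappa>.\<close>
  have e_half: "\<forall>\<^sub>F N in sequentially. real N powr (- \<eta> / 2) < 1 / 2"
    using assms by real_asymp
  show ?thesis
    using e_r e_clt e_l e_K e_rem e_t e_half eventually_gt_at_top[of 2]
  proof eventually_elim
    case (elim N)
    define L where "L = ln (real N)"
    have L: "L > 0" using elim(8) by (simp add: L_def)
    have N: "real N > 2" using elim(8) by simp
    have r: "r N > 0" "real (r N) \<le> L * u" "L * u - 1 \<le> real (r N)"
      using elim(1) unfolding r_def L_def by linarith+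
    have rl: "r N * l N \<le> N" "N - r N * l N < r N"
      using r(1) by (auto simp: l_def minus_mult_div_eq_mod)
    show ?case
    proof (intro allI impI)
      fix B assume B: "real N powr (9/20) \<le> B"
      have Bpos: "B > 0" using B N by (smt (verit) powr_gt_zero)
      have "(g / 2) ^ r N / 2 \<le> prob {\<omega>\<in>space M. (\<Sum>k=1..N. trunc B (Y k 1 2 \<omega>)) > c * nlog N}"
      proof (rule trunc_sum_product_lb[OF _ elim(3) Bpos rl(1)])
        fix s
        have "real (l N) * (K5\<^sup>2 / B ^ 5) \<le> real N * (K5\<^sup>2 / (real N powr (9/20)) ^ 5)"
          using B N Bpos by (intro mult_mono divide_left_mono power_mono mult_pos_pos zero_less_power) (auto simp: l_def)
        also have "\<dots> = K5\<^sup>2 * (real N / real N powr (9/4))"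
          using N by (simp add: powr_power)
        finally have "real (l N) * (K5\<^sup>2 / B ^ 5) \<le> tail_lb x / 4"
          using elim(4) unfolding g_def by linarith
        from block_tail[OF _ elim(3) Bpos elim(2) this]
        show "g / 2 \<le> prob {\<omega>\<in>space M. (\<Sum>k=1..l N. trunc B (Y (s + k) 1 2 \<omega>)) > x * sqrt (l N)}"
          using pos by (simp add: g_def)
      next
        show "real (2 * (N - r N * l N)) \<le> sqrt (real N)"
        proof -
          have "2 * (N - r N * l N) \<le> 2 * r N" using rl by linarith
          then have "real (2 * (N - r N * l N)) \<le> real (2 * r N)" by (rule of_nat_mono)
          also have "\<dots> \<le> sqrt (real N)" using elim(5) r by (simp add: L_def)
          finally show ?thesis .
        qed
        \<comment> \<open>The quantity to be bounded is r sqrt l, the square root of r (r l); the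
          product r l differs from N by less than r.\<close>
        have "(L * u - 1) * (real N - L * u) \<le> real (r N) * (real (r N) * real (l N))"
        proof (rule mult_mono)
          have "real N - real (r N * l N) \<le> real (r N)" using rl by linarith
          then show "real N - L * u \<le> real (r N) * real (l N)" using r by simp
          have "sqrt (real N) \<le> real N" using N by (intro real_le_lsqrt) (auto simp: power2_eq_square)
          moreover have "0 < L * u" using pos L by simp
          ultimately show "0 \<le> real N - L * u" using elim(5) unfolding L_def by linarith
        qed (use r elim(1) in auto)
        then have "sqrt ((L * u - 1) * (real N - L * u)) \<le> real (r N) * sqrt (real (l N))"
          using real_sqrt_le_mono[of "(L * u - 1) * (real N - L * u)" "real (r N) * (real (r N) * real (l N))"]
          by (simp add: real_sqrt_mult mult.assoc[symmetric])
        then have "x * sqrt ((L * u - 1) * (real N - L * u)) \<le> real (r N) * (x * sqrt (real (l N)))"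
          using pos by (simp add: mult.left_commute)
        moreover have "c * nlog N + sqrt N \<le> x * sqrt ((L * u - 1) * (real N - L * u))"
        proof -
          have "(c + 1 / sqrt L) * sqrt (real N * L) \<le>
              x * (sqrt ((L * u - 1) * (real N - L * u)) / sqrt (real N * L)) * sqrt (real N * L)"
            using elim(6) L N by (intro mult_right_mono) (auto simp: L_def)
          also have "\<dots> = x * sqrt ((L * u - 1) * (real N - L * u))" using L N by simp
          also have "(c + 1 / sqrt L) * sqrt (real N * L) = c * nlog N + sqrt N"
            using L N by (simp add: nlog_def L_def[symmetric] real_sqrt_mult field_simps)
          finally show ?thesis .
        qed
        ultimately show "c * nlog N \<le> real (r N) * (x * sqrt (real (l N))) - sqrt (real N)" by simp
      qed (use pos N in auto)
      moreover have "real N powr (- c\<^sup>2 / 2 - \<eta>) \<le> (g / 2) ^ r N / 2"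
      proof -
        have g1: "g \<le> 1"
        proof -
          have "exp (- (x + 1)\<^sup>2 / 2) \<le> 1" by simp
          moreover have "sqrt (2 * pi) \<ge> 1" using pi_gt3 by (intro real_le_rsqrt) simp
          ultimately have "exp (- (x + 1)\<^sup>2 / 2) \<le> sqrt (2 * pi)" by (rule order_trans)
          then show ?thesis unfolding g_def tail_lb_def by (simp add: divide_le_eq)
        qed
        have "real (r N) * ln (2 / g) \<le> L * u * ((c\<^sup>2 / 2 + \<eta> / 2) * \<kappa>\<^sup>2)"
          using r \<kappa> g1 pos L by (intro mult_mono) (auto simp: g_def x_def)
        also have "\<dots> = L * (c\<^sup>2 / 2 + \<eta> / 2)" using \<kappa> by (simp add: u_def)
        finally have *: "- (L * (c\<^sup>2 / 2 + \<eta> / 2)) \<le> real (r N) * ln (g / 2)"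
          using pos by (simp add: ln_div algebra_simps)
        have "real N powr (- c\<^sup>2 / 2 - \<eta>) = real N powr (- (c\<^sup>2 / 2 + \<eta> / 2)) * real N powr (- \<eta> / 2)"
        proof -
          have "- c\<^sup>2 / 2 - \<eta> = - (c\<^sup>2 / 2 + \<eta> / 2) + - \<eta> / 2" by (simp add: field_simps)
          then show ?thesis by (simp only: powr_add)
        qed
        also have "\<dots> \<le> exp (real (r N) * ln (g / 2)) * (1 / 2)"
          using * elim(7) N by (intro mult_mono) (auto simp: powr_def L_def algebra_simps)
        also have "exp (real (r N) * ln (g / 2)) = (g / 2) ^ r N"
          using pos by (simp add: exp_of_nat_mult)
        finally show ?thesis by simp
      qed
      ultimately show "real N powr (- c\<^sup>2 / 2 - \<eta>)
        \<le> prob {\<omega>\<in>space M. (\<Sum>k=1..N. trunc B (Y k 1 2 \<omega>)) > c * nlog N}" by linarith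
    qed
  qed
qed

subsection \<open>Tails of truncated sums of products\<close>

text \<open>Chebyshev's inequality for the number of events that occur: if none occurs, the number
  deviates from its mean by the whole mean. Far pairs are covered by the squared mean, so only near
  pairs and the diagonal are left in the variance bound.\<close>

lemma (in prob_space) prob_no_event_second_moment:
  fixes u w :: real
  assumes fin: "finite P" "P \<noteq> {}" and E[measurable]: "\<And>\<pi>. \<pi> \<in> P \<Longrightarrow> E \<pi> \<in> sets M"
    and u: "u > 0" "\<And>\<pi>. \<pi> \<in> P \<Longrightarrow> prob (E \<pi>) = u"
    and Nb: "\<And>\<pi>. \<pi> \<in> P \<Longrightarrow> card (Nb \<pi>) \<le> m" "\<And>\<pi>. \<pi> \<in> P \<Longrightarrow> finite (Nb \<pi>)" and "w \<ge> 0"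
    and far: "\<And>\<pi> \<rho>. \<pi> \<in> P \<Longrightarrow> \<rho> \<in> P \<Longrightarrow> \<rho> \<noteq> \<pi> \<Longrightarrow> \<rho> \<notin> Nb \<pi> \<Longrightarrow> prob (E \<pi> \<inter> E \<rho>) \<le> u\<^sup>2"
    and near: "\<And>\<pi> \<rho>. \<pi> \<in> P \<Longrightarrow> \<rho> \<in> P \<Longrightarrow> \<rho> \<noteq> \<pi> \<Longrightarrow> \<rho> \<in> Nb \<pi> \<Longrightarrow> prob (E \<pi> \<inter> E \<rho>) \<le> w"
  shows "prob {\<omega>\<in>space M. \<forall>\<pi>\<in>P. \<omega> \<notin> E \<pi>} \<le> m * w / (card P * u\<^sup>2) + 1 / (card P * u)"
proof -
  let ?n = "real (card P)"
  have n: "?n > 0" using fin by (simp add: card_gt_0_iff)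
  define f where "f \<omega> = (\<Sum>\<pi>\<in>P. indicator (E \<pi>) \<omega> :: real)" for \<omega>
  have f[measurable]: "f \<in> borel_measurable M" unfolding f_def by measurable
  have bf: "\<bar>f \<omega>\<bar> \<le> ?n" for \<omega>
  proof -
    have "\<bar>f \<omega>\<bar> \<le> (\<Sum>\<pi>\<in>P. \<bar>indicator (E \<pi>) \<omega> :: real\<bar>)" unfolding f_def by (rule sum_abs)
    also have "\<dots> \<le> (\<Sum>\<pi>\<in>P. 1)" by (intro sum_mono) (auto simp: indicator_def)
    finally show ?thesis by simp
  qed
  have int: "integrable M f" "integrable M (\<lambda>\<omega>. (f \<omega>)\<^sup>2)"
    by (rule integrable_const_bound[where B="?n"], simp add: bf, simp,
        rule integrable_const_bound[where B="?n\<^sup>2"])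
      (use power_mono[OF bf, where n=2] in auto)
  have ef: "expectation f = ?n * u"
    unfolding f_def using E u by (subst Bochner_Integration.integral_sum) (auto simp: emeasure_eq_measure)
  have cross: "prob (E \<pi> \<inter> E \<rho>) \<le> u\<^sup>2 + (if \<rho> \<in> Nb \<pi> then w else 0) + (if \<rho> = \<pi> then u else 0)"
    if "\<pi> \<in> P" "\<rho> \<in> P" for \<pi> \<rho>
    using far[OF that] near[OF that] u that \<open>w \<ge> 0\<close> by (cases "\<rho> = \<pi>"; cases "\<rho> \<in> Nb \<pi>") (auto intro: add_increasing add_increasing2)
  have "expectation (\<lambda>\<omega>. (f \<omega>)\<^sup>2) = expectation (\<lambda>\<omega>. \<Sum>\<pi>\<in>P. \<Sum>\<rho>\<in>P. indicator (E \<pi> \<inter> E \<rho>) \<omega>)"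
    by (simp add: f_def power2_eq_square sum_product indicator_inter_arith)
  also have "\<dots> = (\<Sum>\<pi>\<in>P. expectation (\<lambda>\<omega>. \<Sum>\<rho>\<in>P. indicator (E \<pi> \<inter> E \<rho>) \<omega>))"
    using E by (intro Bochner_Integration.integral_sum Bochner_Integration.integrable_sum)
      (simp add: emeasure_eq_measure)
  also have "\<dots> = (\<Sum>\<pi>\<in>P. \<Sum>\<rho>\<in>P. expectation (indicator (E \<pi> \<inter> E \<rho>)))"
    using E by (intro sum.cong refl Bochner_Integration.integral_sum) (simp add: emeasure_eq_measure)
  also have "\<dots> = (\<Sum>\<pi>\<in>P. \<Sum>\<rho>\<in>P. prob (E \<pi> \<inter> E \<rho>))"
    using E by (intro sum.cong refl) simp
  also have "\<dots> \<le> (\<Sum>\<pi>\<in>P. \<Sum>\<rho>\<in>P. u\<^sup>2 + (if \<rho> \<in> Nb \<pi> then w else 0) + (if \<rho> = \<pi> then u else 0))"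
    by (intro sum_mono cross)
  also have "\<dots> = (\<Sum>\<pi>\<in>P. ?n * u\<^sup>2 + real (card (P \<inter> Nb \<pi>)) * w + u)"
    using fin by (intro sum.cong refl) (simp add: sum.distrib sum.If_cases)
  also have "\<dots> \<le> (\<Sum>\<pi>\<in>P. ?n * u\<^sup>2 + real m * w + u)"
  proof (intro sum_mono add_mono mult_right_mono)
    fix \<pi> assume "\<pi> \<in> P"
    then have "card (P \<inter> Nb \<pi>) \<le> m" using Nb by (metis card_mono inf_le2 order_trans)
    then show "real (card (P \<inter> Nb \<pi>)) \<le> real m" by simp
  qed (use \<open>w \<ge> 0\<close> in auto)
  also have "\<dots> = (?n * u)\<^sup>2 + ?n * (m * w + u)" by (simp add: power2_eq_square algebra_simps)
  finally have ef2: "expectation (\<lambda>\<omega>. (f \<omega>)\<^sup>2) \<le> (?n * u)\<^sup>2 + ?n * (m * w + u)" .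
  have var: "expectation (\<lambda>\<omega>. (f \<omega> - ?n * u)\<^sup>2) \<le> ?n * (m * w + u)"
  proof -
    have "expectation (\<lambda>\<omega>. (f \<omega> - ?n * u)\<^sup>2) = expectation (\<lambda>\<omega>. (f \<omega>)\<^sup>2) - (?n * u)\<^sup>2"
      using variance_eq[OF int] ef by simp
    then show ?thesis using ef2 by simp
  qed
  have i3: "integrable M (\<lambda>\<omega>. (f \<omega> - ?n * u)\<^sup>2)"
    using int by (simp add: power2_diff)
  have "prob {\<omega>\<in>space M. \<forall>\<pi>\<in>P. \<omega> \<notin> E \<pi>} \<le> prob {\<omega>\<in>space M. (f \<omega> - ?n * u)\<^sup>2 \<ge> (?n * u)\<^sup>2}"
    by (intro finite_measure_mono) (auto simp: f_def)
  also have "\<dots> \<le> expectation (\<lambda>\<omega>. (f \<omega> - ?n * u)\<^sup>2) / (?n * u)\<^sup>2"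
    using i3 n u by (intro integral_Markov_inequality_measure[where A="{}"]) auto
  also have "\<dots> \<le> ?n * (m * w + u) / (?n * u)\<^sup>2"
    using var n u by (intro divide_right_mono) auto
  also have "\<dots> = m * w / (card P * u\<^sup>2) + 1 / (card P * u)"
    using n u(1) by (simp add: divide_simps power2_eq_square)
  finally show ?thesis .
qed

text \<open>If one factor is cut off, the left side is 0 and -yz is at most m^2 with m = max(|y|,
  |z|) > B; then m^2 is at most m^3 / B. A one-sided bound is enough because it enters an upper
  bound for a variance.\<close>

lemma trunc_prod_diff_le:
  assumes "B > 0"
  shows "trunc B y * trunc B z \<le> y * z + (2 + y ^ 4 + z ^ 4) / B"
proof (cases "\<bar>y\<bar> \<le> B \<and> \<bar>z\<bar> \<le> B")
  case True
  then show ?thesis using assms by (simp add: trunc_def add_nonneg_nonneg)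
next
  case False
  define m where "m = max \<bar>y\<bar> \<bar>z\<bar>"
  have m: "m > B" "m \<ge> 0" using False by (auto simp: m_def)
  have "- (y * z) \<le> \<bar>y\<bar> * \<bar>z\<bar>" by (simp add: abs_mult[symmetric])
  also have "\<dots> \<le> m * m" by (intro mult_mono) (auto simp: m_def)
  also have "\<dots> \<le> (2 + m ^ 4) / B"
  proof -
    have "m * m * B \<le> m * m * m" using m by (intro mult_left_mono) auto
    also have "\<dots> \<le> 2 + m ^ 4"
    proof -
      \<comment> \<open>Expanding the two squares gives 2 m^3 <= 2 m^4 - m^2 + 1.\<close>
      have "0 \<le> (m * m - m)\<^sup>2 + (m - 1)\<^sup>2 * 0 + (m * m - 1)\<^sup>2" by simp
      then have "2 * (m * m * m) \<le> 2 * m ^ 4 - m * m + 1"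
        by (simp add: power2_eq_square power4_eq_xxxx algebra_simps)
      moreover have "m * m \<ge> 0" by simp
      ultimately show ?thesis by linarith
    qed
    finally show ?thesis using assms by (simp add: pos_le_divide_eq)
  qed
  also have "\<dots> \<le> (2 + y ^ 4 + z ^ 4) / B"
  proof -
    have "m ^ 4 \<le> y ^ 4 + z ^ 4"
      by (cases "\<bar>y\<bar> \<le> \<bar>z\<bar>") (auto simp: m_def max_def power_even_abs)
    then show ?thesis using assms by (intro divide_right_mono) auto
  qed
  finally have "0 \<le> y * z + (2 + y ^ 4 + z ^ 4) / B" by simp
  moreover have "trunc B y * trunc B z = 0" using False by (auto simp: trunc_def)
  ultimately show ?thesis by linarith
qed

context std_array
begin

text \<open>The set of rows is kept general because both initial segments and increments inside a
  block occur.\<close>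

definition T :: "real \<Rightarrow> nat set \<Rightarrow> nat \<Rightarrow> nat \<Rightarrow> 'a \<Rightarrow> real" where
  "T B I i j \<omega> = (\<Sum>k\<in>I. trunc B (Y k i j \<omega>))"

lemma T_measurable[measurable]: "T B I i j \<in> borel_measurable M"
  unfolding T_def by measurable

lemma T_commute: "T B I i j = T B I j i"
  by (simp add: T_def mult.commute fun_eq_iff)

lemma trunc_mean_scale:
  assumes "real N powr (9/20) \<le> B" "N > 0"
  shows "K4 / B ^ 3 \<le> K4 * real N powr (-27/20)"
proof -
  have "(real N powr (9/20)) ^ 3 \<le> B ^ 3" using assms by (intro power_mono) auto
  moreover have "(real N powr (9/20)) ^ 3 = real N powr (27/20)" using assms by (simp add: powr_power)
  ultimately have "K4 / B ^ 3 \<le> K4 / real N powr (27/20)"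
    using assms K4_nonneg
    by (intro divide_left_mono mult_pos_pos zero_less_power)
      (auto intro: less_le_trans[of 0 "real N powr (9/20)"])
  moreover have "real N powr (-27/20) = 1 / real N powr (27/20)"
    using powr_minus_divide[of "real N" "27/20"] by simp
  ultimately show ?thesis by simp
qed

text \<open>The level \<open>B\<close> ranges over a window since it will be fixed by the end of a
  block, where N^(9/20) is larger by at most a constant factor than at the beginning.\<close>

lemma T_tail:
  fixes c R \<eta> :: real
  assumes "c > 0" "R \<ge> 0" "\<eta> > 0"
  shows "\<forall>\<^sub>F N in sequentially. \<forall>B I i j s. real N powr (9/20) \<le> B \<longrightarrow> B \<le> R * real N powr (9/20) \<longrightarrow>
    finite I \<longrightarrow> I \<subseteq> {1..} \<longrightarrow> 1 \<le> i \<longrightarrow> 1 \<le> j \<longrightarrow> i \<noteq> j \<longrightarrow>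
    prob {\<omega>\<in>space M. \<bar>T B I i j \<omega>\<bar> \<ge> s * nlog N}
      \<le> 2 * (real N powr (- c * s) * exp (card I / real N * (\<eta> + c\<^sup>2 / 2 * (1 + \<eta>) * ln (real N))))"
  using chernoff_scale[where 'b=nat, OF assms(1,2) K4_nonneg zero_le_one assms(3)]
    eventually_gt_at_top[of 0]
proof eventually_elim
  case (elim N)
  show ?case
  proof (intro allI impI)
    fix B s and I :: "nat set" and i j :: nat
    assume B: "real N powr (9/20) \<le> B" "B \<le> R * real N powr (9/20)"
      and I: "finite I" "I \<subseteq> {1..}" and ij: "1 \<le> i" "1 \<le> j" "i \<noteq> j"
    have Bp: "B > 0" using B(1) elim(2) by (smt (verit) powr_gt_zero of_nat_0_less_iff)
    have "prob {\<omega>\<in>space M. \<bar>\<Sum>k\<in>I. trunc B (Y k i j \<omega>)\<bar> \<ge> s * nlog N}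
      \<le> 2 * (real N powr (- c * s) * exp (card I / real N * (\<eta> + c\<^sup>2 / 2 * 1 * (1 + \<eta>) * ln (real N))))"
    proof (rule elim(1)[rule_format, OF _ I(1)])
      show "indep_vars (\<lambda>_. borel) (\<lambda>k \<omega>. trunc B (Y k i j \<omega>)) I"
        using ij I by (intro indep_trunc_Y)
      fix k assume k: "k \<in> I"
      then have k1: "k \<ge> 1" using I by auto
      show "\<bar>trunc B (Y k i j \<omega>)\<bar> \<le> R * real N powr (9/20)" for \<omega>
        using abs_trunc_le[of B] B Bp by (meson less_imp_le order_trans)
      show "\<bar>expectation (\<lambda>\<omega>. trunc B (Y k i j \<omega>))\<bar> \<le> K4 * real N powr (-27/20)"
        using trunc_Y_mean[OF k1 ij Bp] trunc_mean_scale[OF B(1) elim(2)] by linarith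
      show "expectation (\<lambda>\<omega>. (trunc B (Y k i j \<omega>))\<^sup>2) \<le> 1" by (rule trunc_Y_var[OF k1 ij])
    qed
    then show "prob {\<omega>\<in>space M. \<bar>T B I i j \<omega>\<bar> \<ge> s * nlog N}
      \<le> 2 * (real N powr (- c * s) * exp (card I / real N * (\<eta> + c\<^sup>2 / 2 * (1 + \<eta>) * ln (real N))))"
      by (simp add: T_def)
  qed
qed

text \<open>Tilt and threshold are both \<open>c\<close>, the optimal choice for variance 1: the
  exponent is -c^2 + c^2 / 2.\<close>

lemma T_full_tail:
  fixes c R \<eta> :: real
  assumes "c > 0" "R \<ge> 0" "\<eta> > 0"
  shows "\<forall>\<^sub>F N in sequentially. \<forall>B i j. real N powr (9/20) \<le> B \<longrightarrow> B \<le> R * real N powr (9/20) \<longrightarrow>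
    1 \<le> i \<longrightarrow> 1 \<le> j \<longrightarrow> i \<noteq> j \<longrightarrow>
    prob {\<omega>\<in>space M. \<bar>T B {1..N} i j \<omega>\<bar> \<ge> c * nlog N} \<le> real N powr (- c\<^sup>2 / 2 + \<eta>)"
proof -
  \<comment> \<open>The inflation 1 + \<theta> of the variance then costs \<eta> / 2 in the
    exponent; the other half absorbs the constant factor.\<close>
  define \<theta> where "\<theta> = \<eta> / c\<^sup>2"
  have \<theta>: "\<theta> > 0" using assms by (simp add: \<theta>_def)
  have "\<forall>\<^sub>F N in sequentially. 2 * exp \<theta> < real N powr (\<eta> / 2)"
    using assms by real_asymp
  then show ?thesis
    using T_tail[OF assms(1,2) \<theta>] eventually_gt_at_top[of 0]
  proof eventually_elim
    case (elim N)
    show ?case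
    proof (intro allI impI)
      fix B and i j :: nat
      assume B: "real N powr (9/20) \<le> B" "B \<le> R * real N powr (9/20)" and ij: "1 \<le> i" "1 \<le> j" "i \<noteq> j"
      have "prob {\<omega>\<in>space M. \<bar>T B {1..N} i j \<omega>\<bar> \<ge> c * nlog N}
        \<le> 2 * (real N powr (- c * c) * exp (card {1..N} / real N * (\<theta> + c\<^sup>2 / 2 * (1 + \<theta>) * ln (real N))))"
        using elim(2)[rule_format, of B "{1..N}" i j c] B ij by simp
      also have "\<dots> = 2 * exp \<theta> * (real N powr (- c * c) * exp (c\<^sup>2 / 2 * (1 + \<theta>) * ln (real N)))"
        using elim(3) by (simp add: exp_add)
      also have "exp (c\<^sup>2 / 2 * (1 + \<theta>) * ln (real N)) = real N powr (c\<^sup>2 / 2 + \<eta> / 2)"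
        using elim(3) assms by (simp add: powr_def \<theta>_def field_simps)
      also have "real N powr (- c * c) * real N powr (c\<^sup>2 / 2 + \<eta> / 2) = real N powr (- c\<^sup>2 / 2 + \<eta> / 2)"
        by (simp add: powr_add[symmetric] power2_eq_square)
      also have "2 * exp \<theta> * \<dots> \<le> real N powr (\<eta> / 2) * real N powr (- c\<^sup>2 / 2 + \<eta> / 2)"
        using elim(1) by (intro mult_right_mono) auto
      also have "\<dots> = real N powr (- c\<^sup>2 / 2 + \<eta>)" by (simp add: powr_add[symmetric])
      finally show "prob {\<omega>\<in>space M. \<bar>T B {1..N} i j \<omega>\<bar> \<ge> c * nlog N} \<le> real N powr (- c\<^sup>2 / 2 + \<eta>)" .
    qed
  qed
qed

text \<open>For at most N / ln N rows the variance term stays bounded however large the tilt is.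
  Every threshold \<epsilon> a(N) thus has a probability smaller than any prescribed power of
  \<open>N\<close>.\<close>

lemma T_increment_tail:
  fixes \<epsilon> R q :: real
  assumes "\<epsilon> > 0" "R \<ge> 0" "q > 0"
  shows "\<forall>\<^sub>F N in sequentially. \<forall>B I i j. real N powr (9/20) \<le> B \<longrightarrow> B \<le> R * real N powr (9/20) \<longrightarrow>
    finite I \<longrightarrow> I \<subseteq> {1..} \<longrightarrow> card I * ln (real N) \<le> real N \<longrightarrow> 1 \<le> i \<longrightarrow> 1 \<le> j \<longrightarrow> i \<noteq> j \<longrightarrow>
    prob {\<omega>\<in>space M. \<bar>T B I i j \<omega>\<bar> \<ge> \<epsilon> * nlog N} \<le> real N powr (- q)"
proof -
  \<comment> \<open>The tilt makes the main term N^(-q-1); the additional power of \<open>N\<close>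
    absorbs the constant.\<close>
  define c where "c = (q + 1) / \<epsilon>"
  have c: "c > 0" using assms by (simp add: c_def)
  have "\<forall>\<^sub>F N in sequentially. 2 * exp (1 + c\<^sup>2) < real N" by real_asymp
  moreover have "\<forall>\<^sub>F N in sequentially. 1 < ln (real N)" by real_asymp
  ultimately show ?thesis
    using T_tail[OF c assms(2) zero_less_one] eventually_gt_at_top[of 0]
  proof eventually_elim
    case (elim N)
    show ?case
    proof (intro allI impI)
      fix B and I :: "nat set" and i j :: nat
      assume B: "real N powr (9/20) \<le> B" "B \<le> R * real N powr (9/20)" and ij: "1 \<le> i" "1 \<le> j" "i \<noteq> j"
        and I: "finite I" "I \<subseteq> {1..}" and cI: "card I * ln (real N) \<le> real N"
      have cI1: "card I / real N * ln (real N) \<le> 1" using cI elim(4) by (simp add: field_simps)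
      have "card I / real N * 1 \<le> card I / real N * ln (real N)"
        using elim by (intro mult_left_mono) auto
      then have cI2: "card I / real N \<le> 1" using cI1 by simp
      have "card I / real N * (1 + c\<^sup>2 / 2 * (1 + 1) * ln (real N)) = card I / real N + c\<^sup>2 * (card I / real N * ln (real N))"
        by (simp add: algebra_simps)
      also have "\<dots> \<le> 1 + c\<^sup>2 * 1"
        using cI1 cI2 by (intro add_mono mult_left_mono) auto
      finally have ex: "card I / real N * (1 + c\<^sup>2 / 2 * (1 + 1) * ln (real N)) \<le> 1 + c\<^sup>2" by simp
      have "prob {\<omega>\<in>space M. \<bar>T B I i j \<omega>\<bar> \<ge> \<epsilon> * nlog N}
        \<le> 2 * (real N powr (- c * \<epsilon>) * exp (card I / real N * (1 + c\<^sup>2 / 2 * (1 + 1) * ln (real N))))"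
        using elim(3)[rule_format, of B I i j \<epsilon>] B ij I by simp
      also have "\<dots> \<le> 2 * (real N powr (- c * \<epsilon>) * exp (1 + c\<^sup>2))"
        using ex by (intro mult_left_mono) auto
      also have "\<dots> = real N powr (- q - 1) * (2 * exp (1 + c\<^sup>2))"
        using assms by (simp add: c_def)
      also have "\<dots> \<le> real N powr (- q - 1) * real N powr 1"
        using elim(1) by (intro mult_left_mono) auto
      also have "\<dots> = real N powr (- q)" by (subst powr_add[symmetric]) simp
      finally show "prob {\<omega>\<in>space M. \<bar>T B I i j \<omega>\<bar> \<ge> \<epsilon> * nlog N} \<le> real N powr (- q)" .
    qed
  qed
qed

text \<open>Two products sharing column \<open>a\<close> are uncorrelated, since columns
  \<open>b\<close> and \<open>d\<close> each contribute a centred independent factor.\<close>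

lemma expectation_Y_cross:
  assumes "k \<ge> 1" "a \<ge> 1" "b \<ge> 1" "d \<ge> 1" "distinct [a, b, d]"
  shows "integrable M (\<lambda>\<omega>. Y k a b \<omega> * Y k a d \<omega>)" "expectation (\<lambda>\<omega>. Y k a b \<omega> * Y k a d \<omega>) = 0"
proof -
  define q :: "nat \<Rightarrow> nat" where "q i = (if i = a then 2 else 1)" for i
  have q: "q a = 2" "q b = 1" "q d = 1" "\<And>i. q i \<le> 5" using assms(5) by (auto simp: q_def)
  have eq: "(\<lambda>\<omega>. \<Prod>i\<in>{a, b, d}. Z k i \<omega> ^ q i) = (\<lambda>\<omega>. Y k a b \<omega> * Y k a d \<omega>)"
    using assms(5) q by (simp add: fun_eq_iff power2_eq_square mult.assoc mult.left_commute)
  have "{a, b, d} \<noteq> {}" "{a, b, d} \<subseteq> {1..}" using assms by auto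
  note r = row_prod[of "{a, b, d}" k q, OF _ this assms(1) q(4)]
  show "integrable M (\<lambda>\<omega>. Y k a b \<omega> * Y k a d \<omega>)" using r(1) by (simp only: eq finite.intros)
  have "(\<Prod>i\<in>{a, b, d}. expectation (\<lambda>\<omega>. Z 1 1 \<omega> ^ q i)) = 0"
  proof (rule prod_zero)
    show "\<exists>i\<in>{a, b, d}. expectation (\<lambda>\<omega>. Z 1 1 \<omega> ^ q i) = 0"
      using mean0 q by (intro bexI[of _ b]) simp_all
  qed simp
  then show "expectation (\<lambda>\<omega>. Y k a b \<omega> * Y k a d \<omega>) = 0"
    using r(2) by (simp only: eq finite.intros)
qed

text \<open>If both sums exceed c a(N), their sum exceeds 2c a(N). Its variance per row is about 2
  because the two products are uncorrelated, so the exponent is (2c)^2 / 4 = c^2, the same as for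
  independent sums.\<close>

lemma T_joint_tail:
  fixes c R \<eta> :: real
  assumes "c > 0" "R \<ge> 0" "\<eta> > 0"
  shows "\<forall>\<^sub>F N in sequentially. \<forall>B a b d. real N powr (9/20) \<le> B \<longrightarrow> B \<le> R * real N powr (9/20) \<longrightarrow>
    1 \<le> a \<longrightarrow> 1 \<le> b \<longrightarrow> 1 \<le> d \<longrightarrow> distinct [a, b, d] \<longrightarrow>
    prob {\<omega>\<in>space M. T B {1..N} a b \<omega> > c * nlog N \<and> T B {1..N} a d \<omega> > c * nlog N}
      \<le> real N powr (- c\<^sup>2 + \<eta>)"
proof -
  \<comment> \<open>The cap at 1 gives (2 + \<theta>)(1 + \<theta>) / 2 <= 1 + 2 \<theta>; the other
    entry of the minimum turns the excess into at most \<eta> / 2.\<close>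
  define \<theta> where "\<theta> = min 1 (\<eta> / (4 * c\<^sup>2))"
  have \<theta>: "\<theta> > 0" "\<theta> \<le> 1" "\<theta> \<le> \<eta> / (4 * c\<^sup>2)" using assms by (auto simp: \<theta>_def)
  have \<theta>c: "c\<^sup>2 * \<theta> \<le> \<eta> / 4"
  proof -
    have "c\<^sup>2 * \<theta> \<le> c\<^sup>2 * (\<eta> / (4 * c\<^sup>2))" using \<theta> by (intro mult_left_mono) auto
    then show ?thesis using assms by simp
  qed
  have "\<forall>\<^sub>F N in sequentially. 2 * exp \<theta> < real N powr (\<eta> / 2)"
    using assms by real_asymp
  moreover have "\<forall>\<^sub>F N in sequentially. 2 * (2 + 2 * K4) / real N powr (9/20) < \<theta>"
  proof -
    have "(\<lambda>N. 2 * (2 + 2 * K4) * (1 / real N powr (9/20))) \<longlonglongrightarrow> 2 * (2 + 2 * K4) * 0"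
      by (rule tendsto_mult_left) real_asymp
    then show ?thesis using \<theta> by (intro order_tendstoD) auto
  qed
  moreover have "\<forall>\<^sub>F N in sequentially. \<forall>(I :: nat set) W s.
    indep_vars (\<lambda>_. borel) W I \<longrightarrow> finite I \<longrightarrow>
    (\<forall>k\<in>I. \<forall>\<omega>\<in>space M. \<bar>W k \<omega>\<bar> \<le> 2 * R * real N powr (9/20)) \<longrightarrow>
    (\<forall>k\<in>I. \<bar>expectation (W k)\<bar> \<le> 2 * K4 * real N powr (-27/20)) \<longrightarrow>
    (\<forall>k\<in>I. expectation (\<lambda>\<omega>. (W k \<omega>)\<^sup>2) \<le> 2 + \<theta>) \<longrightarrow>
    prob {\<omega>\<in>space M. \<bar>\<Sum>k\<in>I. W k \<omega>\<bar> \<ge> s * nlog N}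
      \<le> 2 * (real N powr (- c * s) *
          exp (card I / real N * (\<theta> + c\<^sup>2 / 2 * (2 + \<theta>) * (1 + \<theta>) * ln (real N))))"
    using assms \<theta> K4_nonneg by (intro chernoff_scale) auto
  ultimately show ?thesis using eventually_gt_at_top[of 0]
  proof eventually_elim
    case (elim N)
    have N: "real N \<ge> 1" using elim(4) by simp
    show ?case
    proof (intro allI impI)
      fix B and a b d :: nat
      assume B: "real N powr (9/20) \<le> B" "B \<le> R * real N powr (9/20)"
        and ab: "1 \<le> a" "1 \<le> b" "1 \<le> d" "distinct [a, b, d]"
      have Bp: "B > 0" using B(1) elim(4) by (smt (verit) powr_gt_zero of_nat_0_less_iff)
      define W where "W k \<omega> = trunc B (Y k a b \<omega>) + trunc B (Y k a d \<omega>)" for k \<omega>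
      have "prob {\<omega>\<in>space M. \<bar>\<Sum>k\<in>{1..N}. W k \<omega>\<bar> \<ge> (2 * c) * nlog N}
        \<le> 2 * (real N powr (- c * (2 * c)) *
          exp (card {1..N} / real N * (\<theta> + c\<^sup>2 / 2 * (2 + \<theta>) * (1 + \<theta>) * ln (real N))))"
      proof (rule elim(3)[rule_format])
        have "indep_vars (\<lambda>_. borel) W {1..}"
          unfolding W_def by (rule indep_triple_rows[OF ab(1-3)]) measurable
        then show "indep_vars (\<lambda>_. borel) W {1..N}" by (rule indep_vars_subset) auto
        fix k assume "k \<in> {1..N}"
        then have k: "k \<ge> 1" by simp
        have nab: "a \<noteq> b" "a \<noteq> d" using ab by auto
        note iab = trunc_Y_integrable[OF k ab(1,2) nab(1), of B] and iad = trunc_Y_integrable[OF k ab(1,3) nab(2), of B]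
        show "\<bar>W k \<omega>\<bar> \<le> 2 * R * real N powr (9/20)" for \<omega>
          using abs_trunc_le[of B "Y k a b \<omega>"] abs_trunc_le[of B "Y k a d \<omega>"] B Bp
          unfolding W_def by linarith
        show "\<bar>expectation (W k)\<bar> \<le> 2 * K4 * real N powr (-27/20)"
        proof -
          have "expectation (W k) = expectation (\<lambda>\<omega>. trunc B (Y k a b \<omega>)) + expectation (\<lambda>\<omega>. trunc B (Y k a d \<omega>))"
            unfolding W_def using iab iad by simp
          then show ?thesis
            using trunc_Y_mean[OF k ab(1,2) nab(1) Bp] trunc_Y_mean[OF k ab(1,3) nab(2) Bp]
              trunc_mean_scale[OF B(1) elim(4)] by linarith
        qed
        show "expectation (\<lambda>\<omega>. (W k \<omega>)\<^sup>2) \<le> 2 + \<theta>"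
        proof -
          have icross: "integrable M (\<lambda>\<omega>. trunc B (Y k a b \<omega>) * trunc B (Y k a d \<omega>))"
          proof (rule integrable_const_bound[where B="B * B"])
            have "\<bar>trunc B y\<bar> * \<bar>trunc B z\<bar> \<le> B * B" for y z
              using Bp by (intro mult_mono abs_trunc_le) auto
            then show "AE \<omega> in M. norm (trunc B (Y k a b \<omega>) * trunc B (Y k a d \<omega>)) \<le> B * B"
              by (simp only: real_norm_def abs_mult) simp
          qed measurable
          have cr: "expectation (\<lambda>\<omega>. trunc B (Y k a b \<omega>) * trunc B (Y k a d \<omega>)) \<le> (2 + 2 * K4) / B"
          proof -
            note Yab = Y_moments[OF k ab(1,2) nab(1)] and Yad = Y_moments[OF k ab(1,3) nab(2)]
            note cross = expectation_Y_cross[OF k ab]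
            have "expectation (\<lambda>\<omega>. trunc B (Y k a b \<omega>) * trunc B (Y k a d \<omega>))
              \<le> expectation (\<lambda>\<omega>. Y k a b \<omega> * Y k a d \<omega> + (2 + (Y k a b \<omega>) ^ 4 + (Y k a d \<omega>) ^ 4) / B)"
              using Yab(5) Yad(5) cross(1) icross by (intro integral_mono trunc_prod_diff_le[OF Bp]) auto
            also have "\<dots> = expectation (\<lambda>\<omega>. Y k a b \<omega> * Y k a d \<omega>)
              + expectation (\<lambda>\<omega>. 2 + (Y k a b \<omega>) ^ 4 + (Y k a d \<omega>) ^ 4) / B"
              using Yab(5) Yad(5) cross(1) by (subst Bochner_Integration.integral_add) auto
            also have "expectation (\<lambda>\<omega>. 2 + (Y k a b \<omega>) ^ 4 + (Y k a d \<omega>) ^ 4) = 2 + K4 + K4"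
              using Yab(5,6) Yad(5,6) by (simp add: prob_space)
            finally show ?thesis using cross(2) by (simp add: add.commute)
          qed
          have "expectation (\<lambda>\<omega>. (W k \<omega>)\<^sup>2) = expectation (\<lambda>\<omega>. (trunc B (Y k a b \<omega>))\<^sup>2)
            + expectation (\<lambda>\<omega>. (trunc B (Y k a d \<omega>))\<^sup>2) + 2 * expectation (\<lambda>\<omega>. trunc B (Y k a b \<omega>) * trunc B (Y k a d \<omega>))"
          proof -
            have "(W k \<omega>)\<^sup>2 = (trunc B (Y k a b \<omega>))\<^sup>2 + (trunc B (Y k a d \<omega>))\<^sup>2
              + 2 * (trunc B (Y k a b \<omega>) * trunc B (Y k a d \<omega>))" for \<omega>
              unfolding W_def by (simp only: power2_sum mult.assoc)
            then show ?thesis using iab iad icross by simp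
          qed
          also have "\<dots> \<le> 1 + 1 + 2 * ((2 + 2 * K4) / B)"
            using trunc_Y_var[OF k ab(1,2) nab(1)] trunc_Y_var[OF k ab(1,3) nab(2)] cr
            by (intro add_mono mult_left_mono) auto
          also have "2 * ((2 + 2 * K4) / B) \<le> 2 * (2 + 2 * K4) / real N powr (9/20)"
            using B(1) Bp elim(4) K4_nonneg by (simp add: divide_left_mono)
          finally show ?thesis using elim(2) by linarith
        qed
      qed simp
      also have "\<dots> = 2 * exp \<theta> * (real N powr (- c * (2 * c)) * exp (c\<^sup>2 / 2 * (2 + \<theta>) * (1 + \<theta>) * ln (real N)))"
        using elim(4) by (simp add: exp_add)
      also have "\<dots> \<le> 2 * exp \<theta> * (real N powr (- c * (2 * c)) * exp ((c\<^sup>2 + \<eta> / 2) * ln (real N)))"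
      proof (intro iffD2[OF exp_le_cancel_iff] mult_right_mono mult_left_mono)
        have "c\<^sup>2 / 2 * (2 + \<theta>) * (1 + \<theta>) = c\<^sup>2 + c\<^sup>2 * \<theta> * (3 / 2 + \<theta> / 2)" by (simp add: field_simps)
        also have "\<dots> \<le> c\<^sup>2 + \<eta> / 4 * 2" using \<theta> \<theta>c assms by (intro add_left_mono mult_mono) auto
        finally show "c\<^sup>2 / 2 * (2 + \<theta>) * (1 + \<theta>) \<le> c\<^sup>2 + \<eta> / 2" by simp
      qed (use N in auto)
      also have "exp ((c\<^sup>2 + \<eta> / 2) * ln (real N)) = real N powr (c\<^sup>2 + \<eta> / 2)"
        using elim(4) by (simp add: powr_def)
      also have "real N powr (- c * (2 * c)) * real N powr (c\<^sup>2 + \<eta> / 2) = real N powr (- c\<^sup>2 + \<eta> / 2)"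
        by (simp add: powr_add[symmetric] power2_eq_square)
      also have "2 * exp \<theta> * \<dots> \<le> real N powr (\<eta> / 2) * real N powr (- c\<^sup>2 + \<eta> / 2)"
        using elim(1) by (intro mult_right_mono) auto
      also have "\<dots> = real N powr (- c\<^sup>2 + \<eta>)" by (simp add: powr_add[symmetric])
      finally have tail: "prob {\<omega>\<in>space M. \<bar>\<Sum>k\<in>{1..N}. W k \<omega>\<bar> \<ge> (2 * c) * nlog N} \<le> real N powr (- c\<^sup>2 + \<eta>)"
        by simp
      have sW: "(\<Sum>k\<in>{1..N}. W k \<omega>) = T B {1..N} a b \<omega> + T B {1..N} a d \<omega>" for \<omega>
        by (simp add: W_def T_def sum.distrib)
      have "prob {\<omega>\<in>space M. T B {1..N} a b \<omega> > c * nlog N \<and> T B {1..N} a d \<omega> > c * nlog N}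
        \<le> prob {\<omega>\<in>space M. \<bar>\<Sum>k\<in>{1..N}. W k \<omega>\<bar> \<ge> (2 * c) * nlog N}"
        unfolding sW by (intro finite_measure_mono) (auto simp: algebra_simps)
      also note tail
      finally show "prob {\<omega>\<in>space M. T B {1..N} a b \<omega> > c * nlog N \<and> T B {1..N} a d \<omega> > c * nlog N}
        \<le> real N powr (- c\<^sup>2 + \<eta>)" .
    qed
  qed
qed

end

subsection \<open>Almost sure bounds along polynomial blocks\<close>

text \<open>Even a tiny power \<gamma> becomes summable along N = m^A once \<open>A\<close> is
  large; the value 2 is a convenient exponent above 1.\<close>

lemma (in prob_space) borel_cantelli_poly:
  assumes E: "\<And>m. E m \<in> events" and "real A * \<gamma> \<ge> 2" and "C \<ge> 0"
    and b: "\<forall>\<^sub>F m in sequentially. prob (E m) \<le> C * real (m ^ A) powr (- \<gamma>)"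
  shows "AE \<omega> in M. \<forall>\<^sub>F m in sequentially. \<omega> \<notin> E m"
proof -
  have "summable (\<lambda>m. C * real m powr (- 2))"
    by (intro summable_mult) (simp add: summable_real_powr_iff)
  moreover have "\<forall>\<^sub>F m in sequentially. norm (prob (E m)) \<le> C * real m powr (- 2)"
    using b eventually_gt_at_top[of 0]
  proof eventually_elim
    case (elim m)
    have "real (m ^ A) powr (- \<gamma>) = real m powr (- (real A * \<gamma>))"
      using elim(2) by (simp add: powr_realpow[symmetric] powr_powr)
    also have "\<dots> \<le> real m powr (- 2)" using assms(2) elim(2) by (intro powr_mono) auto
    finally show ?case using elim(1) \<open>C \<ge> 0\<close> by (simp add: order_trans[OF _ mult_left_mono])
  qed
  ultimately have "summable (\<lambda>m. prob (E m))" by (rule summable_comparison_test_ev[rotated])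
  then have "AE \<omega> in M. \<forall>\<^sub>F m in sequentially. \<omega> \<in> space M - E m"
    by (intro borel_cantelli_AE1 E) (auto simp: emeasure_eq_measure)
  then show ?thesis by eventually_elim (auto elim: eventually_mono)
qed

lemma filterlim_power_sequentially: "A \<ge> 1 \<Longrightarrow> filterlim (\<lambda>m::nat. m ^ A) at_top sequentially"
  by (rule filterlim_at_top_mono[OF filterlim_ident])
    (auto intro!: eventually_mono[OF eventually_gt_at_top[of 0]] self_le_power)

text \<open>Every large n lies in the block that starts at the largest A-th power not above n. Both
  end points belong to a block, so neighbouring blocks overlap, which does no harm.\<close>

lemma eventually_power_blocks:
  fixes A :: nat
  assumes "A \<ge> 1" and ev: "\<forall>\<^sub>F m in sequentially. \<forall>n. m ^ A \<le> n \<longrightarrow> n \<le> Suc m ^ A \<longrightarrow> Q n"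
  shows "eventually Q sequentially"
proof -
  obtain m0 where m0: "\<And>m n. m0 \<le> m \<Longrightarrow> m ^ A \<le> n \<Longrightarrow> n \<le> Suc m ^ A \<Longrightarrow> Q n"
    using ev unfolding eventually_sequentially by blast
  have "Q n" if n: "n \<ge> m0 ^ A" for n
  proof -
    define m where "m = Max {m. m ^ A \<le> n}"
    have "m \<le> n" if "m ^ A \<le> n" for m
      using that self_le_power[of m A] \<open>A \<ge> 1\<close> by (cases "m = 0") auto
    then have fin: "finite {m. m ^ A \<le> n}" by (auto intro: finite_subset[of _ "{..n}"])
    have "m \<in> {m. m ^ A \<le> n}" unfolding m_def using n fin by (intro Max_in) auto
    moreover have "m0 \<le> m" unfolding m_def using n fin by (intro Max_ge) auto
    moreover have "\<not> Suc m ^ A \<le> n"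
      using Max_ge[OF fin, of "Suc m"] by (auto simp: m_def[symmetric])
    ultimately show ?thesis using m0[of m n] by simp
  qed
  then show ?thesis unfolding eventually_sequentially by blast
qed

lemma Suc_power_le:
  fixes m A :: nat
  assumes "m \<ge> 1"
  shows "Suc m ^ A \<le> 2 ^ A * m ^ A"
proof -
  have "Suc m ^ A \<le> (2 * m) ^ A" using assms by (intro power_mono) auto
  then show ?thesis by (simp add: power_mult_distrib)
qed

text \<open>The gap is of order A m^(A-1), hence smaller than m^A / ln(m^A) by a factor of order ln
  m / m. The inequality is the size condition of \<open>T_increment_tail\<close>.\<close>

lemma eventually_power_gap:
  fixes A :: nat
  shows "\<forall>\<^sub>F m in sequentially. (real (Suc m ^ A) - real (m ^ A)) * ln (real (m ^ A)) \<le> real (m ^ A)"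
proof -
  have "(\<lambda>m. 2 * real A * real A * (ln (real m) / real m)) \<longlonglongrightarrow> 2 * real A * real A * 0"
    by (rule tendsto_mult_left) real_asymp
  then have e1: "\<forall>\<^sub>F m in sequentially. 2 * real A * real A * (ln (real m) / real m) < 1"
    by (rule order_tendstoD) simp
  show ?thesis
    using e1 eventually_gt_at_top[of "A"] eventually_gt_at_top[of 0]
  proof eventually_elim
    case (elim m)
    have m: "real m > 0" using elim by simp
    have "real (Suc m ^ A) = real (m ^ A) * (1 + 1 / real m) ^ A"
      using m by (simp add: power_mult_distrib[symmetric] field_simps)
    \<comment> \<open>The exponential replaces the binomial expansion: (1 + 1/m)^A <= exp(A/m) <= 1
      + 2A/m as soon as m >= A.\<close>
    also have "(1 + 1 / real m) ^ A \<le> exp (1 / real m) ^ A"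
      by (intro power_mono exp_ge_add_one_self) auto
    also have "\<dots> = exp (real A / real m)" by (simp add: exp_of_nat_mult[symmetric])
    also have "\<dots> \<le> 1 + real A / real m + (real A / real m)\<^sup>2"
      using elim m by (intro exp_bound) (auto simp: field_simps)
    also have "(real A / real m)\<^sup>2 \<le> real A / real m"
    proof -
      have "real A / real m * (real A / real m) \<le> real A / real m * 1"
        using elim m by (intro mult_left_mono) auto
      then show ?thesis by (simp add: power2_eq_square)
    qed
    finally have "real (Suc m ^ A) \<le> real (m ^ A) * (1 + real A / real m + real A / real m)"
      by (simp add: mult_left_mono)
    then have "real (Suc m ^ A) - real (m ^ A) \<le> real (m ^ A) * (2 * real A / real m)"
      by (simp add: algebra_simps)
    then have "(real (Suc m ^ A) - real (m ^ A)) * ln (real (m ^ A))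
        \<le> real (m ^ A) * (2 * real A / real m) * ln (real (m ^ A))"
      using elim by (intro mult_right_mono) auto
    also have "\<dots> = real (m ^ A) * (2 * real A * real A * (ln (real m) / real m))"
      using m by (simp add: ln_realpow)
    also have "\<dots> \<le> real (m ^ A) * 1" using elim by (intro mult_left_mono) auto
    finally show ?case by simp
  qed
qed

section \<open>Truncated sums and exceptional large values along blocks\<close>

context std_array
begin

text \<open>The second moment method for pairs with one column in the first \<open>h\<close> and the
  other in the next \<open>h\<close>. In this bipartite grid two different pairs share at most one
  column, and each pair has only of order \<open>h\<close> neighbours.\<close>

lemma T_no_exceedance:
  fixes c :: real
  assumes "0 < c" "c < 2"
  obtains \<alpha> where "\<alpha> > 0"
    "\<And>R D. R \<ge> 0 \<Longrightarrow> D > 0 \<Longrightarrow>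
      \<forall>\<^sub>F N in sequentially. \<forall>B h. real N powr (9/20) \<le> B \<longrightarrow> B \<le> R * real N powr (9/20) \<longrightarrow>
        real N \<le> D * real h \<longrightarrow>
        prob {\<omega>\<in>space M. \<forall>i\<in>{1..h}. \<forall>j\<in>{h+1..2*h}. \<not> T B {1..N} i j \<omega> > c * nlog N}
          \<le> (2 * D + D\<^sup>2) * real N powr (- \<alpha>)"
proof -
  \<comment> \<open>Near pairs contribute N^(3 \<eta> - 1) and the diagonal N^(c^2/2 + \<eta> - 2).
    The two entries of the minimum make both at most N^(-\<eta>).\<close>
  define \<eta> where "\<eta> = min (1/6) ((2 - c\<^sup>2 / 2) / 2)"
  have "c\<^sup>2 < 2\<^sup>2" using assms by (intro power_strict_mono) auto
  then have \<eta>: "\<eta> > 0" "\<eta> \<le> 1/6" "c\<^sup>2 / 2 + 2 * \<eta> \<le> 2" by (auto simp: \<eta>_def min_def field_simps)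
  have "\<forall>\<^sub>F N in sequentially. \<forall>B h. real N powr (9/20) \<le> B \<longrightarrow> B \<le> R * real N powr (9/20) \<longrightarrow>
      real N \<le> D * real h \<longrightarrow>
      prob {\<omega>\<in>space M. \<forall>i\<in>{1..h}. \<forall>j\<in>{h+1..2*h}. \<not> T B {1..N} i j \<omega> > c * nlog N}
        \<le> (2 * D + D\<^sup>2) * real N powr (- \<eta>)" if RD: "R \<ge> 0" "D > 0" for R D
    using moderate_deviation_lb[OF assms(1) \<eta>(1)] T_joint_tail[OF assms(1) RD(1) \<eta>(1)] eventually_gt_at_top[of 0]
  proof eventually_elim
    case (elim N)
    have N: "real N \<ge> 1" using elim by simp
    show ?case
    proof (intro allI impI)
      fix B and h :: nat
      assume B: "real N powr (9/20) \<le> B" "B \<le> R * real N powr (9/20)" and h: "real N \<le> D * real h"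
      define t where "t = c * nlog N"
      define E where "E \<pi> = {\<omega>\<in>space M. T B {1..N} (fst \<pi>) (snd \<pi>) \<omega> > t}" for \<pi> :: "nat \<times> nat"
      define P where "P = {1..h} \<times> {h+1..2*h}"
      define u where "u = prob (E (1, 2))"
      \<comment> \<open>The pairs in the same line of the grid as \<pi>. The pair itself is
        included, which only affects the count.\<close>
      define Nb where "Nb \<pi> = {fst \<pi>} \<times> {h+1..2*h} \<union> {1..h} \<times> {snd \<pi>}" for \<pi> :: "nat \<times> nat"
      have hp: "h > 0" using h N RD by (cases h) auto
      have u: "u \<ge> real N powr (- c\<^sup>2 / 2 - \<eta>)"
        using elim(1) B(1) by (simp add: u_def E_def t_def T_def)
      have up: "u > 0" using u N by (smt (verit) powr_gt_zero)
      have Em[measurable]: "E \<pi> \<in> events" for \<pi> unfolding E_def by measurable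
      have pE: "prob (E (i, j)) = u" if "1 \<le> i" "1 \<le> j" "i \<noteq> j" for i j
        using prob_pair_sum[of "{1..N}" i j "trunc B", where s=0 and t=t] that
        by (simp add: u_def E_def T_def)
      have far: "prob (E (i, j) \<inter> E (i', j')) \<le> u\<^sup>2"
        if ij: "1 \<le> i" "1 \<le> j" "1 \<le> i'" "1 \<le> j'" "i \<noteq> j" "i' \<noteq> j'" "{i, j} \<inter> {i', j'} = {}" for i j i' j'
      proof -
        define F where "F i j g = (\<Sum>k\<in>{1..N}. trunc B (g (k, i) * g (k, j)))" for i j and g :: "nat \<times> nat \<Rightarrow> real"
        have F: "F i j \<in> borel_measurable (PiM ({1..N} \<times> {i, j}) (\<lambda>_. borel))" for i j
          unfolding F_def
          by (intro borel_measurable_sum measurable_compose[OF _ trunc_measurable] borel_measurable_times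
              measurable_component_singleton) auto
        have FT: "F i j (\<lambda>x\<in>{1..N} \<times> {i, j}. entry x \<omega>) = T B {1..N} i j \<omega>" for i j \<omega>
          unfolding F_def T_def by (intro sum.cong) auto
        have "prob {\<omega>\<in>space M. F i j (\<lambda>x\<in>{1..N} \<times> {i, j}. entry x \<omega>) \<in> {t<..} \<and>
              F i' j' (\<lambda>x\<in>{1..N} \<times> {i', j'}. entry x \<omega>) \<in> {t<..}}
          = prob {\<omega>\<in>space M. F i j (\<lambda>x\<in>{1..N} \<times> {i, j}. entry x \<omega>) \<in> {t<..}}
            * prob {\<omega>\<in>space M. F i' j' (\<lambda>x\<in>{1..N} \<times> {i', j'}. entry x \<omega>) \<in> {t<..}}"
          using ij by (intro prob_conj_indep_group[OF indep _ _ _ F F]) auto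
        then have "prob (E (i, j) \<inter> E (i', j')) = prob (E (i, j)) * prob (E (i', j'))"
          unfolding FT by (simp add: E_def Int_def conj_ac)
        then show ?thesis using pE ij by (simp add: power2_eq_square)
      qed
      have near: "prob (E (a, b) \<inter> E (a, d)) \<le> real N powr (- c\<^sup>2 + \<eta>)"
        if "1 \<le> a" "1 \<le> b" "1 \<le> d" "distinct [a, b, d]" for a b d
      proof -
        have "E (a, b) \<inter> E (a, d) = {\<omega>\<in>space M. T B {1..N} a b \<omega> > c * nlog N \<and> T B {1..N} a d \<omega> > c * nlog N}"
          by (auto simp: E_def t_def)
        then show ?thesis using elim(2)[rule_format, of B a b d] B that by simp
      qed
      \<comment> \<open>By symmetry a shared second column can be treated as a shared first
        one.\<close>
      have E_comm: "E (i, j) = E (j, i)" for i j by (simp add: E_def T_commute)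
      have "prob {\<omega>\<in>space M. \<forall>\<pi>\<in>P. \<omega> \<notin> E \<pi>}
        \<le> (2 * h) * real N powr (- c\<^sup>2 + \<eta>) / (card P * u\<^sup>2) + 1 / (card P * u)"
      proof (rule prob_no_event_second_moment[where Nb=Nb])
        show "finite P" "P \<noteq> {}" using hp by (auto simp: P_def)
        show "prob (E \<pi>) = u" if "\<pi> \<in> P" for \<pi> using that pE by (auto simp: P_def)
        show "card (Nb \<pi>) \<le> 2 * h" for \<pi>
          unfolding Nb_def by (rule order_trans[OF card_Un_le]) (simp add: card_cartesian_product)
        show "finite (Nb \<pi>)" for \<pi> by (auto simp: Nb_def)
        show "prob (E \<pi> \<inter> E \<rho>) \<le> u\<^sup>2" if "\<pi> \<in> P" "\<rho> \<in> P" "\<rho> \<noteq> \<pi>" "\<rho> \<notin> Nb \<pi>" for \<pi> \<rho>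
        proof -
          obtain i j i' j' where [simp]: "\<pi> = (i, j)" "\<rho> = (i', j')" by (cases \<pi>, cases \<rho>) auto
          have "i \<in> {1..h}" "i' \<in> {1..h}" "j \<in> {h+1..2*h}" "j' \<in> {h+1..2*h}" "i \<noteq> i'" "j \<noteq> j'"
            using that by (auto simp: P_def Nb_def)
          then show ?thesis unfolding \<open>\<pi> = (i, j)\<close> \<open>\<rho> = (i', j')\<close> by (intro far) auto
        qed
        show "prob (E \<pi> \<inter> E \<rho>) \<le> real N powr (- c\<^sup>2 + \<eta>)" if \<pi>: "\<pi> \<in> P" "\<rho> \<in> P" "\<rho> \<noteq> \<pi>" "\<rho> \<in> Nb \<pi>" for \<pi> \<rho>
        proof -
          obtain i j i' j' where [simp]: "\<pi> = (i, j)" "\<rho> = (i', j')" by (cases \<pi>, cases \<rho>) auto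
          have ij: "i \<in> {1..h}" "i' \<in> {1..h}" "j \<in> {h+1..2*h}" "j' \<in> {h+1..2*h}"
            using \<pi> by (auto simp: P_def)
          consider "i' = i" "j' \<noteq> j" | "j' = j" "i' \<noteq> i" using \<pi> by (auto simp: Nb_def)
          then show ?thesis
          proof cases
            case 1
            then show ?thesis using near[of i j j'] ij by simp
          next
            case 2
            then show ?thesis using near[of j i i'] ij by (simp add: E_comm[of _ j])
          qed
        qed
      qed (use up in auto)
      also have "\<dots> \<le> 2 * D * real N powr (- \<eta>) + D\<^sup>2 * real N powr (- \<eta>)"
      proof (rule add_mono)
        have cP: "real (card P) = real h * real h" by (simp add: P_def)
        have "(real N powr (- c\<^sup>2 / 2 - \<eta>))\<^sup>2 \<le> u\<^sup>2" using u by (intro power_mono) auto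
        then have u2: "real N powr (- c\<^sup>2 - 2 * \<eta>) \<le> u\<^sup>2"
          using N by (simp add: powr_power algebra_simps)
        have hN: "real N / D \<le> real h" using h RD by (simp add: field_simps)
        have "(2 * h) * real N powr (- c\<^sup>2 + \<eta>) / (card P * u\<^sup>2) = 2 * real N powr (- c\<^sup>2 + \<eta>) / (real h * u\<^sup>2)"
          using hp up by (simp add: cP field_simps)
        also have "\<dots> \<le> 2 * real N powr (- c\<^sup>2 + \<eta>) / (real N / D * real N powr (- c\<^sup>2 - 2 * \<eta>))"
          using hN u2 N hp up RD by (intro divide_left_mono mult_mono mult_pos_pos) auto
        also have "\<dots> = 2 * D * (real N powr (- c\<^sup>2 + \<eta>) / (real N powr 1 * real N powr (- c\<^sup>2 - 2 * \<eta>)))"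
          using N RD by (simp add: field_simps)
        also have "real N powr (- c\<^sup>2 + \<eta>) / (real N powr 1 * real N powr (- c\<^sup>2 - 2 * \<eta>)) = real N powr (3 * \<eta> - 1)"
          unfolding powr_add[symmetric] powr_diff[symmetric] by (simp add: algebra_simps)
        also have "\<dots> \<le> real N powr (- \<eta>)" using N \<eta> by (intro powr_mono) auto
        finally show "(2 * h) * real N powr (- c\<^sup>2 + \<eta>) / (card P * u\<^sup>2) \<le> 2 * D * real N powr (- \<eta>)"
          using RD by (simp add: mult_left_mono)
        have "1 / (card P * u) = 1 / (real h * real h * u)" by (simp add: cP)
        also have "\<dots> \<le> 1 / (real N / D * (real N / D) * real N powr (- c\<^sup>2 / 2 - \<eta>))"
          using hN u N hp up RD by (intro divide_left_mono mult_mono mult_pos_pos) auto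
        also have "\<dots> = D\<^sup>2 * (1 / (real N powr 2 * real N powr (- c\<^sup>2 / 2 - \<eta>)))"
          using N RD by (simp add: field_simps power2_eq_square)
        also have "1 / (real N powr 2 * real N powr (- c\<^sup>2 / 2 - \<eta>)) = real N powr (c\<^sup>2 / 2 + \<eta> - 2)"
          unfolding powr_add[symmetric] powr_minus_divide[symmetric] by (simp add: algebra_simps)
        also have "\<dots> \<le> real N powr (- \<eta>)" using N \<eta> by (intro powr_mono) auto
        finally show "1 / (card P * u) \<le> D\<^sup>2 * real N powr (- \<eta>)"
          by (simp add: mult_left_mono)
      qed
      also have "\<dots> = (2 * D + D\<^sup>2) * real N powr (- \<eta>)" by (simp add: algebra_simps)
      also have "{\<omega>\<in>space M. \<forall>\<pi>\<in>P. \<omega> \<notin> E \<pi>}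
        = {\<omega>\<in>space M. \<forall>i\<in>{1..h}. \<forall>j\<in>{h+1..2*h}. \<not> T B {1..N} i j \<omega> > c * nlog N}"
        by (auto simp: P_def E_def t_def)
      finally show "prob {\<omega>\<in>space M. \<forall>i\<in>{1..h}. \<forall>j\<in>{h+1..2*h}. \<not> T B {1..N} i j \<omega> > c * nlog N}
        \<le> (2 * D + D\<^sup>2) * real N powr (- \<eta>)" .
    qed
  qed
  then show ?thesis by (rule that[OF \<eta>(1)])
qed

text \<open>The truncation level is frozen at the end of each block, so that increments within a block are
  sums of truncated products.\<close>

definition lev :: "nat \<Rightarrow> nat \<Rightarrow> real" where
  "lev A m = real (Suc m ^ A) powr (9/20)"

lemma lev_bounds:
  assumes "m \<ge> 1"
  shows "real (m ^ A) powr (9/20) \<le> lev A m" "lev A m \<le> 2 ^ A * real (m ^ A) powr (9/20)"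
proof -
  have "m ^ A \<le> Suc m ^ A" by (intro power_mono) auto
  then have "real (m ^ A) \<le> real (Suc m ^ A)" by (rule of_nat_mono)
  then show "real (m ^ A) powr (9/20) \<le> lev A m" unfolding lev_def by (intro powr_mono2) simp_all
  have "real (Suc m ^ A) \<le> 2 ^ A * real (m ^ A)"
    using of_nat_mono[OF Suc_power_le[OF assms, of A], where 'a=real] by simp
  then have "lev A m \<le> (2 ^ A * real (m ^ A)) powr (9/20)" unfolding lev_def by (intro powr_mono2) auto
  also have "\<dots> = (2 ^ A) powr (9/20) * real (m ^ A) powr (9/20)" by (simp add: powr_mult)
  also have "(2 ^ A :: real) powr (9/20) \<le> (2 ^ A) powr 1" by (intro powr_mono) auto
  finally show "lev A m \<le> 2 ^ A * real (m ^ A) powr (9/20)" by (simp add: mult_right_mono)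
qed

text \<open>Besides pairs of columns it also serves for pairs of rows, in the exclusion of two large
  products.\<close>

lemma pairs_union_bound:
  assumes "\<And>i j. i \<ge> 1 \<Longrightarrow> j \<ge> 1 \<Longrightarrow> i \<noteq> j \<Longrightarrow> E i j \<in> events"
    and "\<And>i j. i \<ge> 1 \<Longrightarrow> j \<ge> 1 \<Longrightarrow> i \<noteq> j \<Longrightarrow> prob (E i j) \<le> b" and "b \<ge> 0"
  shows "prob (\<Union>(i, j)\<in>{(i, j). 1 \<le> i \<and> i < j \<and> j \<le> p}. E i j) \<le> (real p)\<^sup>2 * b"
    and "(\<Union>(i, j)\<in>{(i, j). 1 \<le> i \<and> i < j \<and> j \<le> p}. E i j) \<in> events"
proof -
  let ?S = "{(i, j). 1 \<le> i \<and> i < j \<and> j \<le> p}"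
  have sub: "?S \<subseteq> {1..p} \<times> {1..p}" by auto
  then have fin: "finite ?S" by (rule finite_subset) simp
  show ev: "(\<Union>(i, j)\<in>?S. E i j) \<in> events"
    using fin assms(1) by (intro sets.finite_UN) auto
  have "prob (\<Union>(i, j)\<in>?S. E i j) \<le> (\<Sum>(i, j)\<in>?S. prob (E i j))"
    using fin assms(1) measure_UNION_le[of ?S "case_prod E" M] by (auto simp: case_prod_beta)
  also have "\<dots> \<le> (\<Sum>(i, j)\<in>?S. b)" using assms(2) by (intro sum_mono) auto
  also have "\<dots> = real (card ?S) * b" by simp
  also have "\<dots> \<le> real (card ({1..p} \<times> {1..p})) * b"
    using assms(3) sub by (intro mult_right_mono of_nat_mono card_mono) auto
  finally show "prob (\<Union>(i, j)\<in>?S. E i j) \<le> (real p)\<^sup>2 * b"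
    by (simp add: card_cartesian_product power2_eq_square)
qed

text \<open>Only the beginning of each block is tested, but for all columns that occur anywhere in
  the block; this changes their number by a constant factor.\<close>

lemma AE_T_upper:
  fixes \<epsilon> :: real and A D :: nat
  assumes "\<epsilon> > 0" "real A * \<epsilon> \<ge> 2" "A \<ge> 1"
  shows "AE \<omega> in M. \<forall>\<^sub>F m in sequentially. \<forall>i j. 1 \<le> i \<longrightarrow> i < j \<longrightarrow> j \<le> D * Suc m ^ A \<longrightarrow>
    \<bar>T (lev A m) {1..m ^ A} i j \<omega>\<bar> < (2 + \<epsilon>) * nlog (m ^ A)"
proof -
  define E where "E m i j = {\<omega>\<in>space M. \<bar>T (lev A m) {1..m ^ A} i j \<omega>\<bar> \<ge> (2 + \<epsilon>) * nlog (m ^ A)}" for m i j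
  define U where "U m = (\<Union>(i, j)\<in>{(i, j). 1 \<le> i \<and> i < j \<and> j \<le> D * Suc m ^ A}. E m i j)" for m
  have [measurable]: "E m i j \<in> events" for m i j unfolding E_def by measurable
  have [measurable]: "U m \<in> events" for m
    unfolding U_def by (rule pairs_union_bound(2)[where b=1]) auto
  have "\<forall>\<^sub>F m in sequentially. \<forall>B i j. real (m ^ A) powr (9/20) \<le> B \<longrightarrow> B \<le> 2 ^ A * real (m ^ A) powr (9/20) \<longrightarrow>
    1 \<le> i \<longrightarrow> 1 \<le> j \<longrightarrow> i \<noteq> j \<longrightarrow>
    prob {\<omega>\<in>space M. \<bar>T B {1..m ^ A} i j \<omega>\<bar> \<ge> (2 + \<epsilon>) * nlog (m ^ A)}
      \<le> real (m ^ A) powr (- (2 + \<epsilon>)\<^sup>2 / 2 + \<epsilon>)"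
    by (rule eventually_compose_filterlim[OF T_full_tail[of "2 + \<epsilon>" "2 ^ A" \<epsilon>] filterlim_power_sequentially])
      (use assms in auto)
  then have "\<forall>\<^sub>F m in sequentially. prob (U m) \<le> (real D * 2 ^ A)\<^sup>2 * real (m ^ A) powr (- \<epsilon>)"
    using eventually_ge_at_top[of 1]
  proof eventually_elim
    case (elim m)
    let ?N = "real (m ^ A)"
    have N: "?N \<ge> 1" using elim(2) by simp
    have "prob (U m) \<le> (real (D * Suc m ^ A))\<^sup>2 * ?N powr (- (2 + \<epsilon>)\<^sup>2 / 2 + \<epsilon>)"
      unfolding U_def using elim(1) lev_bounds[OF elim(2), of A]
      by (intro pairs_union_bound) (auto simp: E_def)
    also have "\<dots> \<le> (real D * 2 ^ A * ?N)\<^sup>2 * ?N powr (- 2 - \<epsilon>)"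
    proof (intro mult_mono power_mono powr_mono)
      show "real (D * Suc m ^ A) \<le> real D * 2 ^ A * ?N"
        using of_nat_mono[OF Suc_power_le[OF elim(2), of A], where 'a=real] by (simp add: mult.assoc mult_left_mono)
      \<comment> \<open>The left side equals -2 - \<epsilon> - \<epsilon>^2 / 2. The part -2 pays
        for the pairs, and N^(-\<epsilon>) is left for Borel-Cantelli.\<close>
      show "- (2 + \<epsilon>)\<^sup>2 / 2 + \<epsilon> \<le> - 2 - \<epsilon>" by (simp add: power2_eq_square field_simps)
    qed (use N in auto)
    also have "\<dots> = (real D * 2 ^ A)\<^sup>2 * (?N powr 2 * ?N powr (- 2 - \<epsilon>))"
      using N by (simp add: power_mult_distrib)
    also have "?N powr 2 * ?N powr (- 2 - \<epsilon>) = ?N powr (- \<epsilon>)"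
      unfolding powr_add[symmetric] by simp
    finally show ?case .
  qed
  then have "AE \<omega> in M. \<forall>\<^sub>F m in sequentially. \<omega> \<notin> U m"
    using assms by (intro borel_cantelli_poly[of U A \<epsilon>]) auto
  then show ?thesis
  proof (rule AE_mp, intro AE_I2 impI)
    fix \<omega> assume w: "\<omega> \<in> space M" and "\<forall>\<^sub>F m in sequentially. \<omega> \<notin> U m"
    from this(2) show "\<forall>\<^sub>F m in sequentially. \<forall>i j. 1 \<le> i \<longrightarrow> i < j \<longrightarrow> j \<le> D * Suc m ^ A \<longrightarrow>
      \<bar>T (lev A m) {1..m ^ A} i j \<omega>\<bar> < (2 + \<epsilon>) * nlog (m ^ A)"
    proof (eventually_elim, intro allI impI)
      fix m i j
      assume U: "\<omega> \<notin> U m" and ij: "1 \<le> i" "i < j" "j \<le> D * Suc m ^ A"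
      have "(i, j) \<in> {(i, j). 1 \<le> i \<and> i < j \<and> j \<le> D * Suc m ^ A}" using ij by blast
      then have "\<omega> \<notin> E m i j" using U unfolding U_def by blast
      then show "\<bar>T (lev A m) {1..m ^ A} i j \<omega>\<bar> < (2 + \<epsilon>) * nlog (m ^ A)"
        using w unfolding E_def by (simp add: not_le)
    qed
  qed
qed

text \<open>No maximal inequality is used: there are of order N end points and N^2 pairs, and each
  event has probability at most N^(-4). The resulting 1/N is summable along m^A because A is at
  least 2.\<close>

lemma AE_T_increment:
  fixes \<epsilon> :: real and A D :: nat
  assumes "\<epsilon> > 0" "A \<ge> 2"
  shows "AE \<omega> in M. \<forall>\<^sub>F m in sequentially. \<forall>n i j. m ^ A \<le> n \<longrightarrow> n \<le> Suc m ^ A \<longrightarrow>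
    1 \<le> i \<longrightarrow> i < j \<longrightarrow> j \<le> D * Suc m ^ A \<longrightarrow>
    \<bar>T (lev A m) {m ^ A<..n} i j \<omega>\<bar> < \<epsilon> * nlog (m ^ A)"
proof -
  define E where "E m i j = (\<Union>n\<in>{m ^ A..Suc m ^ A}.
    {\<omega>\<in>space M. \<bar>T (lev A m) {m ^ A<..n} i j \<omega>\<bar> \<ge> \<epsilon> * nlog (m ^ A)})" for m i j
  define U where "U m = (\<Union>(i, j)\<in>{(i, j). 1 \<le> i \<and> i < j \<and> j \<le> D * Suc m ^ A}. E m i j)" for m
  have [measurable]: "E m i j \<in> events" for m i j unfolding E_def by measurable
  have [measurable]: "U m \<in> events" for m
    unfolding U_def by (rule pairs_union_bound(2)[where b=1]) auto
  have "\<forall>\<^sub>F m in sequentially. \<forall>B I i j. real (m ^ A) powr (9/20) \<le> B \<longrightarrow> B \<le> 2 ^ A * real (m ^ A) powr (9/20) \<longrightarrow>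
    finite I \<longrightarrow> I \<subseteq> {1..} \<longrightarrow> card I * ln (real (m ^ A)) \<le> real (m ^ A) \<longrightarrow> 1 \<le> i \<longrightarrow> 1 \<le> j \<longrightarrow> i \<noteq> j \<longrightarrow>
    prob {\<omega>\<in>space M. \<bar>T B I i j \<omega>\<bar> \<ge> \<epsilon> * nlog (m ^ A)} \<le> real (m ^ A) powr (- 4)"
    by (rule eventually_compose_filterlim[OF T_increment_tail[of \<epsilon> "2 ^ A" 4] filterlim_power_sequentially])
      (use assms in auto)
  then have "\<forall>\<^sub>F m in sequentially. prob (U m) \<le> (real D * 2 ^ A)\<^sup>2 * 2 ^ A * real (m ^ A) powr (- 1)"
    using eventually_ge_at_top[of 1] eventually_power_gap[of A]
  proof eventually_elim
    case (elim m)
    let ?N = "real (m ^ A)"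
    have N: "?N \<ge> 1" using elim(2) by simp
    have SN: "real (Suc m ^ A) \<le> 2 ^ A * ?N"
      using of_nat_mono[OF Suc_power_le[OF elim(2), of A], where 'a=real] by simp
    have "prob (E m i j) \<le> 2 ^ A * ?N * ?N powr (- 4)" if ij: "i \<ge> 1" "j \<ge> 1" "i \<noteq> j" for i j
    proof -
      have "prob {\<omega>\<in>space M. \<bar>T (lev A m) {m ^ A<..n} i j \<omega>\<bar> \<ge> \<epsilon> * nlog (m ^ A)} \<le> ?N powr (- 4)"
        if n: "n \<in> {m ^ A..Suc m ^ A}" for n
      proof -
        have "real n \<le> real (Suc m ^ A)" using n by (intro of_nat_mono) simp
        then have "real (card {m ^ A<..n}) * ln ?N \<le> (real (Suc m ^ A) - ?N) * ln ?N"
          using n N by (intro mult_right_mono) (simp_all add: of_nat_diff)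
        then have "real (card {m ^ A<..n}) * ln ?N \<le> ?N" using elim(3) by linarith
        moreover have "{m ^ A<..n} \<subseteq> {1..}" by auto
        ultimately show ?thesis
          using elim(1)[rule_format, of "lev A m" "{m ^ A<..n}" i j] lev_bounds[OF elim(2), of A] ij by auto
      qed
      then have "prob (E m i j) \<le> (\<Sum>n\<in>{m ^ A..Suc m ^ A}. ?N powr (- 4))"
        unfolding E_def by (intro order_trans[OF measure_UNION_le] sum_mono) auto
      also have "\<dots> = real (card {m ^ A..Suc m ^ A}) * ?N powr (- 4)" by simp
      also have "\<dots> \<le> 2 ^ A * ?N * ?N powr (- 4)"
      proof (rule mult_right_mono)
        have "m ^ A \<ge> 1" using elim(2) by simp
        then have "card {m ^ A..Suc m ^ A} \<le> Suc m ^ A" unfolding card_atLeastAtMost by linarith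
        then show "real (card {m ^ A..Suc m ^ A}) \<le> 2 ^ A * ?N" using SN by linarith
      qed simp
      finally show ?thesis .
    qed
    then have "prob (U m) \<le> (real (D * Suc m ^ A))\<^sup>2 * (2 ^ A * ?N * ?N powr (- 4))"
      unfolding U_def by (intro pairs_union_bound) auto
    also have "\<dots> \<le> (real D * 2 ^ A * ?N)\<^sup>2 * (2 ^ A * ?N * ?N powr (- 4))"
      using SN by (intro mult_right_mono power_mono) (auto simp: mult.assoc intro!: mult_left_mono)
    also have "\<dots> = (real D * 2 ^ A)\<^sup>2 * 2 ^ A * (?N powr 2 * ?N powr 1 * ?N powr (- 4))"
      using N by (simp add: power_mult_distrib)
    also have "?N powr 2 * ?N powr 1 * ?N powr (- 4) = ?N powr (- 1)"
      unfolding powr_add[symmetric] by simp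
    finally show ?case .
  qed
  then have "AE \<omega> in M. \<forall>\<^sub>F m in sequentially. \<omega> \<notin> U m"
    using assms by (intro borel_cantelli_poly[of U A 1]) auto
  then show ?thesis
  proof (rule AE_mp, intro AE_I2 impI)
    fix \<omega> assume w: "\<omega> \<in> space M" and "\<forall>\<^sub>F m in sequentially. \<omega> \<notin> U m"
    from this(2) show "\<forall>\<^sub>F m in sequentially. \<forall>n i j. m ^ A \<le> n \<longrightarrow> n \<le> Suc m ^ A \<longrightarrow>
      1 \<le> i \<longrightarrow> i < j \<longrightarrow> j \<le> D * Suc m ^ A \<longrightarrow> \<bar>T (lev A m) {m ^ A<..n} i j \<omega>\<bar> < \<epsilon> * nlog (m ^ A)"
    proof (eventually_elim, intro allI impI)
      fix m n i j
      assume U: "\<omega> \<notin> U m" and n: "m ^ A \<le> n" "n \<le> Suc m ^ A"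
        and ij: "1 \<le> i" "i < j" "j \<le> D * Suc m ^ A"
      have "(i, j) \<in> {(i, j). 1 \<le> i \<and> i < j \<and> j \<le> D * Suc m ^ A}" using ij by blast
      then have "\<omega> \<notin> E m i j" using U unfolding U_def by blast
      moreover have "n \<in> {m ^ A..Suc m ^ A}" using n by simp
      ultimately have "\<not> \<bar>T (lev A m) {m ^ A<..n} i j \<omega>\<bar> \<ge> \<epsilon> * nlog (m ^ A)"
        using w unfolding E_def by blast
      then show "\<bar>T (lev A m) {m ^ A<..n} i j \<omega>\<bar> < \<epsilon> * nlog (m ^ A)" by simp
    qed
  qed
qed

text \<open>The exponent is required only to exceed a threshold, so that the choice can be combined
  with the condition on \<open>A\<close> for negligible increments.\<close>

lemma AE_T_lower:
  fixes c D :: real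
  assumes "0 < c" "c < 2" "D > 0"
  shows "\<exists>A0. \<forall>A\<ge>A0. AE \<omega> in M. \<forall>\<^sub>F m in sequentially. \<forall>h. real (m ^ A) \<le> D * real h \<longrightarrow>
    (\<exists>i j. 1 \<le> i \<and> i < j \<and> j \<le> 2 * h \<and> T (lev A m) {1..m ^ A} i j \<omega> > c * nlog (m ^ A))"
proof -
  obtain \<alpha> where \<alpha>: "\<alpha> > 0" and ex: "\<And>R D. R \<ge> 0 \<Longrightarrow> D > 0 \<Longrightarrow>
      \<forall>\<^sub>F N in sequentially. \<forall>B h. real N powr (9/20) \<le> B \<longrightarrow> B \<le> R * real N powr (9/20) \<longrightarrow>
        real N \<le> D * real h \<longrightarrow>
        prob {\<omega>\<in>space M. \<forall>i\<in>{1..h}. \<forall>j\<in>{h+1..2*h}. \<not> T B {1..N} i j \<omega> > c * nlog N}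
          \<le> (2 * D + D\<^sup>2) * real N powr (- \<alpha>)"
    using T_no_exceedance[OF assms(1,2)] by blast
  define A0 where "A0 = max 1 (nat \<lceil>2 / \<alpha>\<rceil>)"
  show ?thesis
  proof (intro exI[of _ A0] allI impI)
    fix A assume A: "A0 \<le> A"
    have A1: "A \<ge> 1" using A by (simp add: A0_def)
    have "2 / \<alpha> \<le> real A" using A unfolding A0_def by linarith
    then have A2: "real A * \<alpha> \<ge> 2" using \<alpha> by (simp add: field_simps)
    \<comment> \<open>It suffices to treat the smallest admissible \<open>h\<close>: the pair found
      there is also admissible for every larger one, and no union over \<open>h\<close>
      arises.\<close>
    define h0 where "h0 m = nat \<lceil>real (m ^ A) / D\<rceil>" for m
    define U where "U m = {\<omega>\<in>space M. \<forall>i\<in>{1..h0 m}. \<forall>j\<in>{h0 m+1..2*h0 m}.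
      \<not> T (lev A m) {1..m ^ A} i j \<omega> > c * nlog (m ^ A)}" for m
    have "\<forall>\<^sub>F m in sequentially. \<forall>B h. real (m ^ A) powr (9/20) \<le> B \<longrightarrow> B \<le> 2 ^ A * real (m ^ A) powr (9/20) \<longrightarrow>
        real (m ^ A) \<le> D * real h \<longrightarrow>
        prob {\<omega>\<in>space M. \<forall>i\<in>{1..h}. \<forall>j\<in>{h+1..2*h}. \<not> T B {1..m ^ A} i j \<omega> > c * nlog (m ^ A)}
          \<le> (2 * D + D\<^sup>2) * real (m ^ A) powr (- \<alpha>)"
      by (rule eventually_compose_filterlim[OF ex filterlim_power_sequentially[OF A1]]) (use assms in auto)
    then have "\<forall>\<^sub>F m in sequentially. prob (U m) \<le> (2 * D + D\<^sup>2) * real (m ^ A) powr (- \<alpha>)"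
      using eventually_ge_at_top[of 1]
    proof eventually_elim
      case (elim m)
      have "real (m ^ A) / D \<le> real (h0 m)" unfolding h0_def by linarith
      then have "real (m ^ A) \<le> D * real (h0 m)" using assms by (simp add: field_simps)
      then show ?case unfolding U_def using elim(1) lev_bounds[OF elim(2), of A] by blast
    qed
    then have "AE \<omega> in M. \<forall>\<^sub>F m in sequentially. \<omega> \<notin> U m"
      using assms A2 by (intro borel_cantelli_poly[of U A \<alpha>]) (auto simp: U_def)
    then show "AE \<omega> in M. \<forall>\<^sub>F m in sequentially. \<forall>h. real (m ^ A) \<le> D * real h \<longrightarrow>
      (\<exists>i j. 1 \<le> i \<and> i < j \<and> j \<le> 2 * h \<and> T (lev A m) {1..m ^ A} i j \<omega> > c * nlog (m ^ A))"
    proof (rule AE_mp, intro AE_I2 impI)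
      fix \<omega> assume w: "\<omega> \<in> space M" and "\<forall>\<^sub>F m in sequentially. \<omega> \<notin> U m"
      from this(2) show "\<forall>\<^sub>F m in sequentially. \<forall>h. real (m ^ A) \<le> D * real h \<longrightarrow>
        (\<exists>i j. 1 \<le> i \<and> i < j \<and> j \<le> 2 * h \<and> T (lev A m) {1..m ^ A} i j \<omega> > c * nlog (m ^ A))"
      proof (eventually_elim, intro allI impI)
        fix m h assume U: "\<omega> \<notin> U m" and h: "real (m ^ A) \<le> D * real h"
        obtain i j where ij: "i \<in> {1..h0 m}" "j \<in> {h0 m+1..2*h0 m}"
          "T (lev A m) {1..m ^ A} i j \<omega> > c * nlog (m ^ A)"
          using U w by (auto simp: U_def)
        have "real (m ^ A) / D \<le> real h" using h assms by (simp add: field_simps)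
        then have "h0 m \<le> h" unfolding h0_def by linarith
        then show "\<exists>i j. 1 \<le> i \<and> i < j \<and> j \<le> 2 * h \<and> T (lev A m) {1..m ^ A} i j \<omega> > c * nlog (m ^ A)"
          using ij by (intro exI[of _ i] exI[of _ j]) auto
      qed
    qed
  qed
qed

text \<open>Different rows are independent, so two exceedances have probability of order N^(-9/2),
  against N^4 choices of two columns and two rows. The remaining N^(-1/2) is summable along fourth
  powers.\<close>

lemma AE_one_big_jump:
  fixes D :: nat
  shows "AE \<omega> in M. \<forall>\<^sub>F n in sequentially. \<forall>i j k l. 1 \<le> i \<longrightarrow> i < j \<longrightarrow> j \<le> D * n \<longrightarrow>
    1 \<le> k \<longrightarrow> k < l \<longrightarrow> l \<le> n \<longrightarrow>
    \<not> (\<bar>Y k i j \<omega>\<bar> > real n powr (9/20) \<and> \<bar>Y l i j \<omega>\<bar> > real n powr (9/20))"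
proof -
  \<comment> \<open>The threshold is taken at the beginning of the block and the index ranges at its
    end, so one event covers all sample sizes of the block.\<close>
  let ?b = "\<lambda>m. real (m ^ 4) powr (9/20)"
  define F where "F m i j k l = {\<omega>\<in>space M. \<bar>Y k i j \<omega>\<bar> > ?b m \<and> \<bar>Y l i j \<omega>\<bar> > ?b m}" for m i j k l
  define E where "E m i j = (\<Union>(k, l)\<in>{(k, l). 1 \<le> k \<and> k < l \<and> l \<le> Suc m ^ 4}. F m i j k l)" for m i j
  define U where "U m = (\<Union>(i, j)\<in>{(i, j). 1 \<le> i \<and> i < j \<and> j \<le> D * Suc m ^ 4}. E m i j)" for m
  have [measurable]: "F m i j k l \<in> events" for m i j k l unfolding F_def by measurable
  have [measurable]: "E m i j \<in> events" for m i j
    unfolding E_def by (rule pairs_union_bound(2)[where b=1]) auto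
  have [measurable]: "U m \<in> events" for m
    unfolding U_def by (rule pairs_union_bound(2)[where b=1]) auto
  have "\<forall>\<^sub>F m in sequentially. prob (U m) \<le> (real D * 16)\<^sup>2 * 16\<^sup>2 * (K5\<^sup>2)\<^sup>2 * real (m ^ 4) powr (- 1/2)"
    using eventually_ge_at_top[of 1]
  proof eventually_elim
    case (elim m)
    let ?N = "real (m ^ 4)"
    have N: "?N \<ge> 1" using elim by simp
    have bp: "?b m > 0" using elim by simp
    have b5: "(?b m) ^ 5 = ?N powr (9/4)" using elim by (simp add: powr_power)
    have SN: "real (Suc m ^ 4) \<le> 16 * ?N"
      using of_nat_mono[OF Suc_power_le[OF elim, of 4], where 'a=real] by simp
    have pF: "prob (F m i j k l) \<le> (K5\<^sup>2 / ?N powr (9/4))\<^sup>2"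
      if ij: "i \<ge> 1" "j \<ge> 1" "i \<noteq> j" and kl: "k \<ge> 1" "l \<ge> 1" "k \<noteq> l" for i j k l
    proof -
      define G where "G k g = \<bar>g (k, i) * g (k, j)\<bar>" for k :: nat and g :: "nat \<times> nat \<Rightarrow> real"
      have Gm: "G k \<in> borel_measurable (PiM ({k} \<times> {i, j}) (\<lambda>_. borel))" for k
        unfolding G_def
        by (intro borel_measurable_abs borel_measurable_times measurable_component_singleton) auto
      have GY: "G k (\<lambda>x\<in>{k} \<times> {i, j}. entry x \<omega>) = \<bar>Y k i j \<omega>\<bar>" for k \<omega>
        by (simp add: G_def)
      have "prob {\<omega>\<in>space M. G k (\<lambda>x\<in>{k} \<times> {i, j}. entry x \<omega>) \<in> {?b m<..} \<and>
          G l (\<lambda>x\<in>{l} \<times> {i, j}. entry x \<omega>) \<in> {?b m<..}}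
        = prob {\<omega>\<in>space M. G k (\<lambda>x\<in>{k} \<times> {i, j}. entry x \<omega>) \<in> {?b m<..}}
          * prob {\<omega>\<in>space M. G l (\<lambda>x\<in>{l} \<times> {i, j}. entry x \<omega>) \<in> {?b m<..}}"
        using ij kl by (intro prob_conj_indep_group[OF indep _ _ _ Gm Gm]) auto
      then have "prob (F m i j k l) = prob {\<omega>\<in>space M. \<bar>Y k i j \<omega>\<bar> > ?b m} * prob {\<omega>\<in>space M. \<bar>Y l i j \<omega>\<bar> > ?b m}"
        unfolding GY by (simp add: F_def)
      also have "\<dots> \<le> (K5\<^sup>2 / ?N powr (9/4)) * (K5\<^sup>2 / ?N powr (9/4))"
        using Y_tail[OF kl(1) ij bp] Y_tail[OF kl(2) ij bp] unfolding b5 by (intro mult_mono) auto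
      finally show ?thesis by (simp add: power2_eq_square)
    qed
    have pE: "prob (E m i j) \<le> (real (Suc m ^ 4))\<^sup>2 * (K5\<^sup>2 / ?N powr (9/4))\<^sup>2"
      if ij: "i \<ge> 1" "j \<ge> 1" "i \<noteq> j" for i j
      unfolding E_def by (intro pairs_union_bound pF ij) auto
    have "prob (U m) \<le> (real (D * Suc m ^ 4))\<^sup>2 * ((real (Suc m ^ 4))\<^sup>2 * (K5\<^sup>2 / ?N powr (9/4))\<^sup>2)"
      unfolding U_def by (intro pairs_union_bound pE) auto
    also have "\<dots> \<le> (real D * 16 * ?N)\<^sup>2 * ((16 * ?N)\<^sup>2 * (K5\<^sup>2 / ?N powr (9/4))\<^sup>2)"
      using SN by (intro mult_mono mult_right_mono power_mono) (auto simp: mult.assoc intro!: mult_left_mono)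
    also have "\<dots> = (real D * 16)\<^sup>2 * 16\<^sup>2 * (K5\<^sup>2)\<^sup>2 * (?N ^ 4 / (?N powr (9/4))\<^sup>2)"
      by (simp add: power_mult_distrib power_divide power4_eq_xxxx power2_eq_square)
    also have "?N ^ 4 / (?N powr (9/4))\<^sup>2 = ?N powr 4 / ?N powr (9/2)"
      using elim by (simp add: powr_power)
    also have "\<dots> = ?N powr (- 1/2)" unfolding powr_diff[symmetric] by simp
    finally show ?case .
  qed
  then have "AE \<omega> in M. \<forall>\<^sub>F m in sequentially. \<omega> \<notin> U m"
    by (intro borel_cantelli_poly[of U 4 "1/2"]) auto
  then show ?thesis
  proof (rule AE_mp, intro AE_I2 impI)
    fix \<omega> assume w: "\<omega> \<in> space M" and ev: "\<forall>\<^sub>F m in sequentially. \<omega> \<notin> U m"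
    show "\<forall>\<^sub>F n in sequentially. \<forall>i j k l. 1 \<le> i \<longrightarrow> i < j \<longrightarrow> j \<le> D * n \<longrightarrow>
      1 \<le> k \<longrightarrow> k < l \<longrightarrow> l \<le> n \<longrightarrow>
      \<not> (\<bar>Y k i j \<omega>\<bar> > real n powr (9/20) \<and> \<bar>Y l i j \<omega>\<bar> > real n powr (9/20))"
    proof (rule eventually_power_blocks[of 4])
      show "\<forall>\<^sub>F m in sequentially. \<forall>n. m ^ 4 \<le> n \<longrightarrow> n \<le> Suc m ^ 4 \<longrightarrow> (\<forall>i j k l. 1 \<le> i \<longrightarrow> i < j \<longrightarrow> j \<le> D * n \<longrightarrow>
        1 \<le> k \<longrightarrow> k < l \<longrightarrow> l \<le> n \<longrightarrow>
        \<not> (\<bar>Y k i j \<omega>\<bar> > real n powr (9/20) \<and> \<bar>Y l i j \<omega>\<bar> > real n powr (9/20)))"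
        using ev
      proof (eventually_elim, intro allI impI notI)
        fix m n i j k l
        assume U: "\<omega> \<notin> U m" and n: "m ^ 4 \<le> n" "n \<le> Suc m ^ 4" and ij: "1 \<le> i" "i < j" "j \<le> D * n"
          and kl: "1 \<le> k" "k < l" "l \<le> n"
          and b: "\<bar>Y k i j \<omega>\<bar> > real n powr (9/20) \<and> \<bar>Y l i j \<omega>\<bar> > real n powr (9/20)"
        have "?b m \<le> real n powr (9/20)" using n by (intro powr_mono2) auto
        then have "\<omega> \<in> F m i j k l" using b w by (auto simp: F_def)
        moreover have "(k, l) \<in> {(k, l). 1 \<le> k \<and> k < l \<and> l \<le> Suc m ^ 4}" using kl n by simp
        ultimately have "\<omega> \<in> E m i j" unfolding E_def by blast
        moreover have "j \<le> D * Suc m ^ 4" using ij(3) mult_le_mono2[OF n(2), of D] by (rule order_trans)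
        then have "(i, j) \<in> {(i, j). 1 \<le> i \<and> i < j \<and> j \<le> D * Suc m ^ 4}" using ij by blast
        ultimately have "\<omega> \<in> U m" unfolding U_def by blast
        then show False using U by simp
      qed
    qed simp
  qed
qed

text \<open>Of order N^2 entries against a tail of order N^(-9/4). What is left is N^(-1/4), and
  this is why eighth powers appear.\<close>

lemma AE_entries_bounded:
  fixes D :: nat
  shows "AE \<omega> in M. \<forall>\<^sub>F n in sequentially. \<forall>k i. 1 \<le> k \<longrightarrow> k \<le> n \<longrightarrow> 1 \<le> i \<longrightarrow> i \<le> D * n \<longrightarrow>
    \<bar>Z k i \<omega>\<bar> \<le> real n powr (9/20)"
proof -
  let ?b = "\<lambda>m. real (m ^ 8) powr (9/20)"
  define F where "F m x = {\<omega>\<in>space M. \<bar>entry x \<omega>\<bar> > ?b m}" for m x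
  define U where "U m = (\<Union>x\<in>{1..Suc m ^ 8} \<times> {1..D * Suc m ^ 8}. F m x)" for m
  have [measurable]: "F m x \<in> events" for m x unfolding F_def by (cases x) simp
  have [measurable]: "U m \<in> events" for m unfolding U_def by measurable
  have "\<forall>\<^sub>F m in sequentially. prob (U m) \<le> real D * 256\<^sup>2 * K5 * real (m ^ 8) powr (- 1/4)"
    using eventually_ge_at_top[of 1]
  proof eventually_elim
    case (elim m)
    let ?N = "real (m ^ 8)"
    have N: "?N \<ge> 1" using elim by simp
    have bp: "?b m > 0" using elim by simp
    have b5: "(?b m) ^ 5 = ?N powr (9/4)" using elim by (simp add: powr_power)
    have SN: "real (Suc m ^ 8) \<le> 256 * ?N"
      using of_nat_mono[OF Suc_power_le[OF elim, of 8], where 'a=real] by simp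
    have "prob (U m) \<le> (\<Sum>x\<in>{1..Suc m ^ 8} \<times> {1..D * Suc m ^ 8}. prob (F m x))"
      unfolding U_def by (intro measure_UNION_le) auto
    also have "\<dots> \<le> (\<Sum>x\<in>{1..Suc m ^ 8} \<times> {1..D * Suc m ^ 8}. K5 / ?N powr (9/4))"
    proof (rule sum_mono)
      fix x assume "x \<in> {1..Suc m ^ 8} \<times> {1..D * Suc m ^ 8}"
      then obtain k i where [simp]: "x = (k, i)" and ki: "k \<ge> 1" "i \<ge> 1" by auto
      show "prob (F m x) \<le> K5 / ?N powr (9/4)"
        using Z_tail[OF ki bp] by (simp only: F_def \<open>x = (k, i)\<close> prod.case b5)
    qed
    also have "\<dots> = real D * ((real (Suc m ^ 8))\<^sup>2 * (K5 / ?N powr (9/4)))"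
      by (simp add: card_cartesian_product power2_eq_square)
    also have "\<dots> \<le> real D * ((256 * ?N)\<^sup>2 * (K5 / ?N powr (9/4)))"
      using SN K5_nonneg by (intro mult_left_mono mult_right_mono power_mono) auto
    also have "\<dots> = real D * 256\<^sup>2 * K5 * (?N powr 2 / ?N powr (9/4))"
      using N by (simp add: power_mult_distrib)
    also have "?N powr 2 / ?N powr (9/4) = ?N powr (- 1/4)" unfolding powr_diff[symmetric] by simp
    finally show ?case .
  qed
  then have "AE \<omega> in M. \<forall>\<^sub>F m in sequentially. \<omega> \<notin> U m"
    using K5_nonneg by (intro borel_cantelli_poly[of U 8 "1/4"]) auto
  then show ?thesis
  proof (rule AE_mp, intro AE_I2 impI)
    fix \<omega> assume w: "\<omega> \<in> space M" and ev: "\<forall>\<^sub>F m in sequentially. \<omega> \<notin> U m"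
    show "\<forall>\<^sub>F n in sequentially. \<forall>k i. 1 \<le> k \<longrightarrow> k \<le> n \<longrightarrow> 1 \<le> i \<longrightarrow> i \<le> D * n \<longrightarrow>
      \<bar>Z k i \<omega>\<bar> \<le> real n powr (9/20)"
    proof (rule eventually_power_blocks[of 8])
      show "\<forall>\<^sub>F m in sequentially. \<forall>n. m ^ 8 \<le> n \<longrightarrow> n \<le> Suc m ^ 8 \<longrightarrow>
        (\<forall>k i. 1 \<le> k \<longrightarrow> k \<le> n \<longrightarrow> 1 \<le> i \<longrightarrow> i \<le> D * n \<longrightarrow> \<bar>Z k i \<omega>\<bar> \<le> real n powr (9/20))"
        using ev
      proof (eventually_elim, intro allI impI)
        fix m n k i
        assume U: "\<omega> \<notin> U m" and n: "m ^ 8 \<le> n" "n \<le> Suc m ^ 8" and ki: "1 \<le> k" "k \<le> n" "1 \<le> i" "i \<le> D * n"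
        have "i \<le> D * Suc m ^ 8" using ki n by (meson mult_le_mono2 order_trans)
        then have "(k, i) \<in> {1..Suc m ^ 8} \<times> {1..D * Suc m ^ 8}" using ki n by auto
        then have "\<omega> \<notin> F m (k, i)" using U unfolding U_def by blast
        then have "\<bar>Z k i \<omega>\<bar> \<le> ?b m" using w by (simp add: F_def)
        also have "\<dots> \<le> real n powr (9/20)" using n by (intro powr_mono2) auto
        finally show "\<bar>Z k i \<omega>\<bar> \<le> real n powr (9/20)" .
      qed
    qed simp
  qed
qed

end

section \<open>Comparison inside a block, for the scale and for truncated sums\<close>

lemma nlog_Suc_power_ratio:
  fixes \<epsilon> :: real and A :: nat
  assumes "\<epsilon> > 0" "A \<ge> 1"
  shows "\<forall>\<^sub>F m in sequentially. nlog (Suc m ^ A) * (1 - \<epsilon>) \<le> nlog (m ^ A)"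
proof -
  have "(\<lambda>m. sqrt ((1 + 1 / real m) ^ A * (ln (real (Suc m)) / ln (real m)))) \<longlonglongrightarrow> sqrt ((1 + 0) ^ A * 1)"
  proof (intro tendsto_real_sqrt tendsto_mult tendsto_power tendsto_add tendsto_const)
    show "(\<lambda>m. 1 / real m) \<longlonglongrightarrow> 0" by real_asymp
    show "(\<lambda>m. ln (real (Suc m)) / ln (real m)) \<longlonglongrightarrow> 1" by real_asymp
  qed
  then have "\<forall>\<^sub>F m in sequentially. sqrt ((1 + 1 / real m) ^ A * (ln (real (Suc m)) / ln (real m))) < 1 + \<epsilon>"
    using assms by (intro order_tendstoD(2)) auto
  then show ?thesis using eventually_gt_at_top[of 1]
  proof eventually_elim
    case (elim m)
    have m: "real m > 1" using elim by simp
    have "real (Suc m ^ A) * ln (real (Suc m ^ A)) =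
        ((1 + 1 / real m) ^ A * (ln (real (Suc m)) / ln (real m))) * (real (m ^ A) * ln (real (m ^ A)))"
    proof -
      have "real (Suc m ^ A) = (1 + 1 / real m) ^ A * real (m ^ A)"
        using m by (simp add: power_mult_distrib[symmetric] field_simps)
      moreover have "ln (real (Suc m ^ A)) = real A * ln (real (Suc m))" by (simp add: ln_realpow)
      moreover have "ln (real (m ^ A)) = real A * ln (real m)" using m by (simp add: ln_realpow)
      ultimately show ?thesis using m by simp
    qed
    then have "nlog (Suc m ^ A) = sqrt ((1 + 1 / real m) ^ A * (ln (real (Suc m)) / ln (real m))) * nlog (m ^ A)"
      unfolding nlog_def by (simp only: real_sqrt_mult)
    also have "\<dots> \<le> (1 + \<epsilon>) * nlog (m ^ A)"
      using elim(1) nlog_nonneg by (intro mult_right_mono) auto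
    finally have *: "nlog (Suc m ^ A) \<le> (1 + \<epsilon>) * nlog (m ^ A)" .
    show ?case
    proof (cases "\<epsilon> \<le> 1")
      case True
      have "nlog (Suc m ^ A) * (1 - \<epsilon>) \<le> (1 + \<epsilon>) * nlog (m ^ A) * (1 - \<epsilon>)"
        using * True by (intro mult_right_mono) auto
      also have "\<dots> = nlog (m ^ A) - \<epsilon>\<^sup>2 * nlog (m ^ A)" by (simp add: power2_eq_square algebra_simps)
      also have "\<dots> \<le> nlog (m ^ A)" using nlog_nonneg by simp
      finally show ?thesis .
    next
      case False
      then have "nlog (Suc m ^ A) * (1 - \<epsilon>) \<le> 0" using nlog_nonneg by (simp add: mult_nonneg_nonpos)
      then show ?thesis using nlog_nonneg[of "m ^ A"] by linarith
    qed
  qed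
qed

text \<open>At most one index lies above \<open>b\<close>, and all others survive truncation at
  \<open>B\<close>. Two levels appear because \<open>b\<close> depends on the current sample size
  while \<open>B\<close> is frozen for the block.\<close>

lemma sum_trunc_diff_le:
  fixes y :: "nat \<Rightarrow> real"
  assumes fin: "finite I" and le: "\<And>k. k \<in> I \<Longrightarrow> \<bar>y k\<bar> \<le> e" and "0 \<le> e"
    and one: "\<And>k l. k \<in> I \<Longrightarrow> l \<in> I \<Longrightarrow> k < l \<Longrightarrow> \<not> (\<bar>y k\<bar> > b \<and> \<bar>y l\<bar> > b)" and "b \<le> B"
  shows "\<bar>(\<Sum>k\<in>I. y k) - (\<Sum>k\<in>I. trunc B (y k))\<bar> \<le> e"
proof -
  have zero: "y k - trunc B (y k) = 0" if "\<bar>y k\<bar> \<le> b" for k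
    using that \<open>b \<le> B\<close> by (simp add: trunc_def)
  have small: "\<bar>y k - trunc B (y k)\<bar> \<le> \<bar>y k\<bar>" for k by (simp add: trunc_def)
  have "(\<Sum>k\<in>I. y k) - (\<Sum>k\<in>I. trunc B (y k)) = (\<Sum>k\<in>I. y k - trunc B (y k))" by (simp add: sum_subtractf)
  also have "\<bar>\<dots>\<bar> \<le> e"
  proof (cases "\<exists>k\<in>I. \<bar>y k\<bar> > b")
    case True
    then obtain k where k: "k \<in> I" "\<bar>y k\<bar> > b" by auto
    have "(\<Sum>l\<in>I - {k}. y l - trunc B (y l)) = 0"
    proof (intro sum.neutral ballI zero)
      fix l assume "l \<in> I - {k}"
      then show "\<bar>y l\<bar> \<le> b" using one[of l k] one[of k l] k by (cases "l < k") auto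
    qed
    then have "(\<Sum>l\<in>I. y l - trunc B (y l)) = y k - trunc B (y k)"
      using sum.remove[OF fin k(1), of "\<lambda>l. y l - trunc B (y l)"] by simp
    then show ?thesis using small[of k] le[OF k(1)] by simp
  next
    case False
    then have "(\<Sum>l\<in>I. y l - trunc B (y l)) = 0" by (intro sum.neutral ballI zero) auto
    then show ?thesis using \<open>0 \<le> e\<close> by simp
  qed
  finally show ?thesis .
qed

section \<open>Sums and sums of squares of single columns\<close>

context std_array
begin


lemma indep_single_rows:
  assumes "1 \<le> i" and [measurable]: "f \<in> borel_measurable borel"
  shows "indep_vars (\<lambda>_. borel) (\<lambda>k \<omega>. f (Z k i \<omega>) :: real) {1..n}"
  by (rule indep_vars_subset[OF indep_pair_rows[of i i "\<lambda>x _. f x"]]) (use assms in auto)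

text \<open>Only the order \<open>nlog n\<close> matters here, so the constant is chosen generously
  enough for the probabilities to be summable over all \<open>n\<close>, without blocks.\<close>

lemma AE_transformed_row_sums:
  fixes D :: nat and w :: "nat \<Rightarrow> real \<Rightarrow> real" and K v :: real
  assumes [measurable]: "\<And>n. w n \<in> borel_measurable borel" and "K \<ge> 0" "v \<ge> 0"
    and bd: "\<And>n x. n \<ge> 1 \<Longrightarrow> \<bar>w n x\<bar> \<le> real n powr (9/20)"
    and mean: "\<And>n. n \<ge> 1 \<Longrightarrow> \<bar>expectation (\<lambda>\<omega>. w n (Z 1 1 \<omega>))\<bar> \<le> K * real n powr (-27/20)"
    and var: "\<And>n. n \<ge> 1 \<Longrightarrow> expectation (\<lambda>\<omega>. (w n (Z 1 1 \<omega>))\<^sup>2) \<le> v"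
  shows "AE \<omega> in M. \<forall>\<^sub>F n in sequentially. \<forall>i. 1 \<le> i \<longrightarrow> i \<le> D * n \<longrightarrow>
    \<bar>\<Sum>k=1..n. w n (Z k i \<omega>)\<bar> < (v + 4) * nlog n"
proof -
  define F where "F n i = {\<omega>\<in>space M. \<bar>\<Sum>k\<in>{1..n}. w n (Z k i \<omega>)\<bar> \<ge> (v + 4) * nlog n}" for n i
  define U where "U n = (\<Union>i\<in>{1..D * n}. F n i)" for n
  have [measurable]: "F n i \<in> events" for n i unfolding F_def by measurable
  have [measurable]: "U n \<in> events" for n unfolding U_def by measurable
  have "\<forall>\<^sub>F N in sequentially. \<forall>(I :: nat set) W s.
    indep_vars (\<lambda>_. borel) W I \<longrightarrow> finite I \<longrightarrow>
    (\<forall>k\<in>I. \<forall>\<omega>\<in>space M. \<bar>W k \<omega>\<bar> \<le> 1 * real N powr (9/20)) \<longrightarrow>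
    (\<forall>k\<in>I. \<bar>expectation (W k)\<bar> \<le> K * real N powr (-27/20)) \<longrightarrow>
    (\<forall>k\<in>I. expectation (\<lambda>\<omega>. (W k \<omega>)\<^sup>2) \<le> v) \<longrightarrow>
    prob {\<omega>\<in>space M. \<bar>\<Sum>k\<in>I. W k \<omega>\<bar> \<ge> s * nlog N}
      \<le> 2 * (real N powr (- 1 * s) * exp (card I / real N * (1 + 1\<^sup>2 / 2 * v * (1 + 1) * ln (real N))))"
    using assms(2,3) by (intro chernoff_scale) auto
  then have "\<forall>\<^sub>F n in sequentially. prob (U n) \<le> 2 * exp 1 * real D * real (n ^ 1) powr (- 3)"
    using eventually_ge_at_top[of 1]
  proof eventually_elim
    case (elim n)
    have pF: "prob (F n i) \<le> 2 * exp 1 * real n powr (- 4)" if i: "i \<ge> 1" for i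
    proof -
      have "prob (F n i) \<le> 2 * (real n powr (- 1 * (v + 4)) *
          exp (card {1..n} / real n * (1 + 1\<^sup>2 / 2 * v * (1 + 1) * ln (real n))))"
        unfolding F_def
      proof (rule elim(1)[rule_format])
        show "indep_vars (\<lambda>_. borel) (\<lambda>k \<omega>. w n (Z k i \<omega>)) {1..n}"
          using i by (rule indep_single_rows) measurable
        show "\<bar>w n (Z k i \<omega>)\<bar> \<le> 1 * real n powr (9/20)" for k \<omega>
          using bd[OF elim(2)] by simp
        fix k assume "k \<in> {1..n}"
        then have k: "k \<ge> 1" by simp
        show "\<bar>expectation (\<lambda>\<omega>. w n (Z k i \<omega>))\<bar> \<le> K * real n powr (-27/20)"
          using mean[OF elim(2)] expectation_entry[OF k i, of "w n"] by simp
        show "expectation (\<lambda>\<omega>. (w n (Z k i \<omega>))\<^sup>2) \<le> v"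
          using var[OF elim(2)] expectation_entry[OF k i, of "\<lambda>x. (w n x)\<^sup>2"] by simp
      qed simp
      \<comment> \<open>With tilt 1 and \<eta> = 1 the variance term is exactly n^v, against
        n^(-v-4) from the threshold.\<close>
      also have "\<dots> = 2 * exp 1 * (real n powr (- 1 * (v + 4)) * real n powr v)"
        using elim(2) by (simp add: exp_add powr_def)
      also have "real n powr (- 1 * (v + 4)) * real n powr v = real n powr (- 4)"
        unfolding powr_add[symmetric] by simp
      finally show ?thesis .
    qed
    have "prob (U n) \<le> (\<Sum>i\<in>{1..D * n}. prob (F n i))"
      unfolding U_def by (intro measure_UNION_le) auto
    also have "\<dots> \<le> (\<Sum>i\<in>{1..D * n}. 2 * exp 1 * real n powr (- 4))" by (intro sum_mono pF) simp
    also have "\<dots> = 2 * exp 1 * real D * (real n powr 1 * real n powr (- 4))" using elim(2) by simp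
    also have "real n powr 1 * real n powr (- 4) = real (n ^ 1) powr (- 3)"
      unfolding powr_add[symmetric] by simp
    finally show ?case .
  qed
  then have "AE \<omega> in M. \<forall>\<^sub>F n in sequentially. \<omega> \<notin> U n"
    by (intro borel_cantelli_poly[of U 1 3]) auto
  then show ?thesis using AE_space
  proof eventually_elim
    case (elim \<omega>)
    from elim(1) show ?case
    proof (eventually_elim, intro allI impI)
      fix n i
      assume U: "\<omega> \<notin> U n" and i: "1 \<le> i" "i \<le> D * n"
      have "\<omega> \<notin> F n i" using U i unfolding U_def by auto
      then show "\<bar>\<Sum>k=1..n. w n (Z k i \<omega>)\<bar> < (v + 4) * nlog n" using elim(2) by (simp add: F_def)
    qed
  qed
qed

lemma Z_moments:
  shows "integrable M (Z 1 1)" "integrable M (\<lambda>\<omega>. (Z 1 1 \<omega>)\<^sup>2)" "integrable M (\<lambda>\<omega>. (Z 1 1 \<omega>) ^ 4)"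
  using integrable_power[of 1 1 1] integrable_power[of 1 1 2] integrable_power[of 1 1 4] by auto

lemma AE_row_sums:
  fixes D :: nat
  shows "AE \<omega> in M. \<forall>\<^sub>F n in sequentially. \<forall>i. 1 \<le> i \<longrightarrow> i \<le> D * n \<longrightarrow>
    \<bar>\<Sum>k=1..n. Z k i \<omega>\<bar> < 5 * nlog n"
proof -
  have "AE \<omega> in M. \<forall>\<^sub>F n in sequentially. \<forall>i. 1 \<le> i \<longrightarrow> i \<le> D * n \<longrightarrow>
    \<bar>\<Sum>k=1..n. trunc (real n powr (9/20)) (Z k i \<omega>)\<bar> < (1 + 4) * nlog n"
  proof (rule AE_transformed_row_sums[OF _ E4_nonneg zero_le_one])
    fix n :: nat assume n: "n \<ge> 1"
    let ?B = "real n powr (9/20)"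
    have B: "?B > 0" using n by simp
    have "E4 / ?B ^ 3 = E4 * real n powr (-27/20)"
    proof -
      have "?B ^ 3 = real n powr (27/20)" using n by (simp add: powr_power)
      then show ?thesis using powr_minus_divide[of "real n" "27/20"] by simp
    qed
    then show "\<bar>expectation (\<lambda>\<omega>. trunc ?B (Z 1 1 \<omega>))\<bar> \<le> E4 * real n powr (-27/20)"
      using expectation_trunc_le[OF _ Z_moments(3,1) mean0 B] by (simp add: E4_def)
    have "integrable M (\<lambda>\<omega>. (trunc ?B (Z 1 1 \<omega>))\<^sup>2)"
      by (rule Bochner_Integration.integrable_bound[OF Z_moments(2)]) (auto simp: trunc_sq_le)
    then have "expectation (\<lambda>\<omega>. (trunc ?B (Z 1 1 \<omega>))\<^sup>2) \<le> expectation (\<lambda>\<omega>. (Z 1 1 \<omega>)\<^sup>2)"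
      by (intro integral_mono trunc_sq_le Z_moments)
    then show "expectation (\<lambda>\<omega>. (trunc ?B (Z 1 1 \<omega>))\<^sup>2) \<le> 1" using var1 by linarith
  qed (simp_all add: abs_trunc_le)
  then show ?thesis using AE_entries_bounded[of D]
  proof eventually_elim
    case (elim \<omega>)
    then show ?case
    proof (eventually_elim, intro allI impI)
      fix n i
      assume s: "\<forall>i. 1 \<le> i \<longrightarrow> i \<le> D * n \<longrightarrow> \<bar>\<Sum>k=1..n. trunc (real n powr (9/20)) (Z k i \<omega>)\<bar> < (1 + 4) * nlog n"
        and b: "\<forall>k i. 1 \<le> k \<longrightarrow> k \<le> n \<longrightarrow> 1 \<le> i \<longrightarrow> i \<le> D * n \<longrightarrow> \<bar>Z k i \<omega>\<bar> \<le> real n powr (9/20)"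
        and i: "1 \<le> i" "i \<le> D * n"
      have "(\<Sum>k=1..n. Z k i \<omega>) = (\<Sum>k=1..n. trunc (real n powr (9/20)) (Z k i \<omega>))"
        using b i by (intro sum.cong) (auto simp: trunc_def)
      then show "\<bar>\<Sum>k=1..n. Z k i \<omega>\<bar> < 5 * nlog n" using s i by simp
    qed
  qed
qed

text \<open>The error is o(n) because 1/2 + 9/20 < 1, which is all that the denominators of the
  correlations require.\<close>

lemma AE_row_squares:
  fixes D :: nat
  shows "AE \<omega> in M. \<forall>\<^sub>F n in sequentially. \<forall>i. 1 \<le> i \<longrightarrow> i \<le> D * n \<longrightarrow>
    \<bar>(\<Sum>k=1..n. (Z k i \<omega>)\<^sup>2) - real n\<bar> < (E4 + 5) * nlog n * real n powr (9/20)"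
proof -
  \<comment> \<open>Truncated squares may be as large as n^(9/10). Division by n^(9/20) brings them
    under the bound required of a transformed entry, and the factor is restored at the end.\<close>
  define w where "w n x = ((trunc (real n powr (9/20)) x)\<^sup>2 - 1) / real n powr (9/20)" for n and x :: real
  have [measurable]: "w n \<in> borel_measurable borel" for n unfolding w_def by measurable
  have "AE \<omega> in M. \<forall>\<^sub>F n in sequentially. \<forall>i. 1 \<le> i \<longrightarrow> i \<le> D * n \<longrightarrow>
    \<bar>\<Sum>k=1..n. w n (Z k i \<omega>)\<bar> < ((E4 + 1) + 4) * nlog n"
  proof (rule AE_transformed_row_sums[OF _ E4_nonneg])
    fix n :: nat assume n: "n \<ge> 1"
    let ?B = "real n powr (9/20)"
    have B: "?B \<ge> 1" using n by (simp add: ge_one_powr_ge_zero)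
    show "\<bar>w n x\<bar> \<le> ?B" for x
    proof -
      define t where "t = trunc ?B x"
      have "\<bar>t\<bar> \<le> ?B" unfolding t_def using B by (intro abs_trunc_le) simp
      then have "\<bar>t\<bar>\<^sup>2 \<le> ?B\<^sup>2" by (intro power_mono) auto
      moreover have "1 \<le> ?B\<^sup>2" using B by (simp add: one_le_power)
      moreover have "0 \<le> t\<^sup>2" by simp
      ultimately have "\<bar>t\<^sup>2 - 1\<bar> \<le> ?B\<^sup>2" unfolding power2_abs by linarith
      then have "\<bar>t\<^sup>2 - 1\<bar> / ?B \<le> ?B" using B n by (subst pos_divide_le_eq) (auto simp: power2_eq_square)
      then show ?thesis using B by (simp add: w_def t_def[symmetric])
    qed
    have it: "integrable M (\<lambda>\<omega>. (trunc ?B (Z 1 1 \<omega>))\<^sup>2)"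
      by (rule Bochner_Integration.integrable_bound[OF Z_moments(2)]) (auto simp: trunc_sq_le)
    have d: "0 \<le> z\<^sup>2 - (trunc ?B z)\<^sup>2" "z\<^sup>2 - (trunc ?B z)\<^sup>2 \<le> z ^ 4 / ?B\<^sup>2" for z
    proof -
      show "0 \<le> z\<^sup>2 - (trunc ?B z)\<^sup>2" using trunc_sq_le[of ?B z] by simp
      show "z\<^sup>2 - (trunc ?B z)\<^sup>2 \<le> z ^ 4 / ?B\<^sup>2"
      proof (cases "\<bar>z\<bar> \<le> ?B")
        case False
        then have "?B\<^sup>2 \<le> \<bar>z\<bar>\<^sup>2" using B by (intro power_mono) auto
        then have "z\<^sup>2 * ?B\<^sup>2 \<le> z\<^sup>2 * z\<^sup>2" by (intro mult_left_mono) auto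
        also have "\<dots> = z ^ 4" by (simp add: power4_eq_xxxx power2_eq_square)
        finally show ?thesis using False n by (simp add: trunc_def pos_le_divide_eq)
      qed (simp add: trunc_def)
    qed
    have "1 - expectation (\<lambda>\<omega>. (trunc ?B (Z 1 1 \<omega>))\<^sup>2) = expectation (\<lambda>\<omega>. (Z 1 1 \<omega>)\<^sup>2 - (trunc ?B (Z 1 1 \<omega>))\<^sup>2)"
      using Bochner_Integration.integral_diff[OF Z_moments(2) it] var1 by linarith
    moreover have "0 \<le> \<dots>" by (intro integral_nonneg_AE AE_I2 d)
    moreover have "expectation (\<lambda>\<omega>. (Z 1 1 \<omega>)\<^sup>2 - (trunc ?B (Z 1 1 \<omega>))\<^sup>2) \<le> expectation (\<lambda>\<omega>. (Z 1 1 \<omega>) ^ 4 / ?B\<^sup>2)"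
      using Z_moments it by (intro integral_mono d) auto
    moreover have "expectation (\<lambda>\<omega>. (Z 1 1 \<omega>) ^ 4 / ?B\<^sup>2) = E4 / ?B\<^sup>2" by (simp add: E4_def)
    ultimately have "\<bar>expectation (\<lambda>\<omega>. (trunc ?B (Z 1 1 \<omega>))\<^sup>2) - 1\<bar> \<le> E4 / ?B\<^sup>2" by linarith
    then have "\<bar>expectation (\<lambda>\<omega>. (trunc ?B (Z 1 1 \<omega>))\<^sup>2) - 1\<bar> / ?B \<le> E4 / ?B\<^sup>2 / ?B"
      using B by (intro divide_right_mono) auto
    moreover have "E4 / ?B\<^sup>2 / ?B = E4 * real n powr (-27/20)"
    proof -
      have "E4 / ?B\<^sup>2 / ?B = E4 / ?B ^ 3" by (simp add: power3_eq_cube power2_eq_square)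
      moreover have "?B ^ 3 = real n powr (27/20)" using n by (simp add: powr_power)
      ultimately show ?thesis using powr_minus_divide[of "real n" "27/20"] by simp
    qed
    moreover have "expectation (\<lambda>\<omega>. w n (Z 1 1 \<omega>)) = (expectation (\<lambda>\<omega>. (trunc ?B (Z 1 1 \<omega>))\<^sup>2) - 1) / ?B"
      unfolding w_def using it by (simp add: prob_space)
    ultimately show "\<bar>expectation (\<lambda>\<omega>. w n (Z 1 1 \<omega>))\<bar> \<le> E4 * real n powr (-27/20)"
      using B by simp
    have w2: "(w n z)\<^sup>2 \<le> z ^ 4 + 1" for z
    proof -
      define t where "t = trunc ?B z"
      have "(w n z)\<^sup>2 = (t\<^sup>2 - 1)\<^sup>2 / ?B\<^sup>2" by (simp add: w_def t_def power_divide)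
      also have "\<dots> \<le> (t\<^sup>2 - 1)\<^sup>2 / 1" using B n by (intro divide_left_mono) (auto simp: one_le_power)
      also have "\<dots> = t ^ 4 - 2 * t\<^sup>2 + 1" by (simp add: power2_eq_square power4_eq_xxxx algebra_simps)
      also have "\<dots> \<le> t ^ 4 + 1" by simp
      also have "t ^ 4 \<le> z ^ 4" by (simp add: t_def trunc_def)
      finally show ?thesis by simp
    qed
    have i41: "integrable M (\<lambda>\<omega>. (Z 1 1 \<omega>) ^ 4 + 1)" by (intro Bochner_Integration.integrable_add Z_moments) simp
    then have "integrable M (\<lambda>\<omega>. (w n (Z 1 1 \<omega>))\<^sup>2)"
      by (rule Bochner_Integration.integrable_bound) (use w2 in auto)
    then have "expectation (\<lambda>\<omega>. (w n (Z 1 1 \<omega>))\<^sup>2) \<le> expectation (\<lambda>\<omega>. (Z 1 1 \<omega>) ^ 4 + 1)"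
      using i41 by (rule integral_mono) (rule w2)
    also have "\<dots> = E4 + 1"
      using Bochner_Integration.integral_add[OF Z_moments(3) integrable_const[of 1]] by (simp add: E4_def prob_space)
    finally show "expectation (\<lambda>\<omega>. (w n (Z 1 1 \<omega>))\<^sup>2) \<le> E4 + 1" .
  qed (use E4_nonneg in auto)
  then show ?thesis using AE_entries_bounded[of D]
  proof eventually_elim
    case (elim \<omega>)
    from elim eventually_ge_at_top[of 1] show ?case
    proof (eventually_elim, intro allI impI)
      fix n i :: nat
      assume s: "\<forall>i. 1 \<le> i \<longrightarrow> i \<le> D * n \<longrightarrow> \<bar>\<Sum>k=1..n. w n (Z k i \<omega>)\<bar> < ((E4 + 1) + 4) * nlog n"
        and b: "\<forall>k i. 1 \<le> k \<longrightarrow> k \<le> n \<longrightarrow> 1 \<le> i \<longrightarrow> i \<le> D * n \<longrightarrow> \<bar>Z k i \<omega>\<bar> \<le> real n powr (9/20)"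
        and i: "1 \<le> i" "i \<le> D * n" and n: "1 \<le> n"
      have B: "real n powr (9/20) > 0" using n by simp
      have "(\<Sum>k=1..n. w n (Z k i \<omega>)) = (\<Sum>k=1..n. ((Z k i \<omega>)\<^sup>2 - 1) / real n powr (9/20))"
        using b i by (intro sum.cong) (auto simp: trunc_def w_def)
      also have "\<dots> = ((\<Sum>k=1..n. (Z k i \<omega>)\<^sup>2) - real n) / real n powr (9/20)"
        by (simp add: sum_divide_distrib[symmetric] sum_subtractf)
      finally have eq: "(\<Sum>k=1..n. w n (Z k i \<omega>)) = ((\<Sum>k=1..n. (Z k i \<omega>)\<^sup>2) - real n) / real n powr (9/20)" .
      have "\<bar>\<Sum>k=1..n. w n (Z k i \<omega>)\<bar> < (E4 + 5) * nlog n" using s[rule_format, OF i] by (simp add: add.commute)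
      then have "\<bar>((\<Sum>k=1..n. (Z k i \<omega>)\<^sup>2) - real n) / real n powr (9/20)\<bar> < (E4 + 5) * nlog n"
        unfolding eq .
      then show "\<bar>(\<Sum>k=1..n. (Z k i \<omega>)\<^sup>2) - real n\<bar> < (E4 + 5) * nlog n * real n powr (9/20)"
        using B by (simp add: abs_divide pos_divide_less_eq)
    qed
  qed
qed

text \<open>A property of a single outcome. It serves as an interface: the summability hypothesis
  yields it for the uncentred array, and it is then transferred to the standardised one.\<close>

definition small_products :: "nat \<Rightarrow> 'a \<Rightarrow> bool" where
  "small_products D \<omega> \<longleftrightarrow> (\<forall>\<epsilon>>0. \<forall>\<^sub>F n in sequentially. \<forall>k i j. 1 \<le> k \<longrightarrow> k \<le> n \<longrightarrow>
    1 \<le> i \<longrightarrow> i < j \<longrightarrow> j \<le> D * n \<longrightarrow> \<bar>Y k i j \<omega>\<bar> \<le> \<epsilon> * nlog n)"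

section \<open>Full sums of products for all sample sizes\<close>

lemma eventually_on_blocks:
  fixes A :: nat
  assumes "eventually P sequentially" "A \<ge> 1"
  shows "\<forall>\<^sub>F m in sequentially. \<forall>n. m ^ A \<le> n \<longrightarrow> P n"
proof -
  have "\<forall>\<^sub>F N in sequentially. \<forall>n\<ge>N. P n" using assms(1) by (rule eventually_all_ge_at_top)
  from eventually_compose_filterlim[OF this filterlim_power_sequentially[OF assms(2)]] show ?thesis .
qed

text \<open>On a block, the sum of products differs from the truncated sum at the start of the block by
  the increment of the truncated sum and by at most one large product.\<close>

lemma AE_S_block:
  fixes \<epsilon> :: real and A D :: nat
  assumes "\<epsilon> > 0" "A \<ge> 2"
  shows "AE \<omega> in M. small_products D \<omega> \<longrightarrow> (\<forall>\<^sub>F m in sequentially. \<forall>n i j. m ^ A \<le> n \<longrightarrow> n \<le> Suc m ^ A \<longrightarrow>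
    1 \<le> i \<longrightarrow> i < j \<longrightarrow> j \<le> D * n \<longrightarrow>
    \<bar>(\<Sum>k=1..n. Y k i j \<omega>) - T (lev A m) {1..m ^ A} i j \<omega>\<bar> \<le> 2 * \<epsilon> * nlog n)"
    (is "AE \<omega> in M. _ \<longrightarrow> ?Q \<omega>")
  using AE_T_increment[OF assms, of D] AE_one_big_jump[of D]
proof eventually_elim
  case (elim \<omega>)
  have A1: "A \<ge> 1" using assms by simp
  show ?case
  proof
  assume "small_products D \<omega>"
  then
  have sp: "\<forall>\<^sub>F n in sequentially. \<forall>k i j. 1 \<le> k \<longrightarrow> k \<le> n \<longrightarrow>
    1 \<le> i \<longrightarrow> i < j \<longrightarrow> j \<le> D * n \<longrightarrow> \<bar>Y k i j \<omega>\<bar> \<le> \<epsilon> * nlog n"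
    using assms unfolding small_products_def by blast
  show "?Q \<omega>"
    using elim(1) eventually_on_blocks[OF elim(2) A1] eventually_on_blocks[OF sp A1]
  proof (eventually_elim, intro allI impI)
    fix m n i j
    assume inc: "\<forall>n i j. m ^ A \<le> n \<longrightarrow> n \<le> Suc m ^ A \<longrightarrow>
        1 \<le> i \<longrightarrow> i < j \<longrightarrow> j \<le> D * Suc m ^ A \<longrightarrow> \<bar>T (lev A m) {m ^ A<..n} i j \<omega>\<bar> < \<epsilon> * nlog (m ^ A)"
      and jump: "\<forall>n. m ^ A \<le> n \<longrightarrow> (\<forall>i j k l. 1 \<le> i \<longrightarrow> i < j \<longrightarrow> j \<le> D * n \<longrightarrow> 1 \<le> k \<longrightarrow> k < l \<longrightarrow> l \<le> n \<longrightarrow>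
        \<not> (\<bar>Y k i j \<omega>\<bar> > real n powr (9/20) \<and> \<bar>Y l i j \<omega>\<bar> > real n powr (9/20)))"
      and small: "\<forall>n. m ^ A \<le> n \<longrightarrow> (\<forall>k i j. 1 \<le> k \<longrightarrow> k \<le> n \<longrightarrow>
        1 \<le> i \<longrightarrow> i < j \<longrightarrow> j \<le> D * n \<longrightarrow> \<bar>Y k i j \<omega>\<bar> \<le> \<epsilon> * nlog n)"
      and n: "m ^ A \<le> n" "n \<le> Suc m ^ A" and ij: "1 \<le> i" "i < j" "j \<le> D * n"
    have "\<bar>(\<Sum>k\<in>{1..n}. Y k i j \<omega>) - (\<Sum>k\<in>{1..n}. trunc (lev A m) (Y k i j \<omega>))\<bar> \<le> \<epsilon> * nlog n"
    proof (rule sum_trunc_diff_le)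
      show "\<bar>Y k i j \<omega>\<bar> \<le> \<epsilon> * nlog n" if "k \<in> {1..n}" for k
        using small n ij that by simp
      show "\<not> (\<bar>Y k i j \<omega>\<bar> > real n powr (9/20) \<and> \<bar>Y l i j \<omega>\<bar> > real n powr (9/20))"
        if "k \<in> {1..n}" "l \<in> {1..n}" "k < l" for k l
        using jump[rule_format, of n i j k l] n ij that by simp
      have "real n \<le> real (Suc m ^ A)" using n(2) by (rule of_nat_mono)
      then show "real n powr (9/20) \<le> lev A m" unfolding lev_def by (intro powr_mono2) simp_all
    qed (use assms nlog_nonneg in auto)
    moreover have "(\<Sum>k\<in>{1..n}. trunc (lev A m) (Y k i j \<omega>))
      = T (lev A m) {1..m ^ A} i j \<omega> + T (lev A m) {m ^ A<..n} i j \<omega>"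
    proof -
      have "{1..n} = {1..m ^ A} \<union> {m ^ A<..n}" using n by auto
      then show ?thesis unfolding T_def by (simp only:) (rule sum.union_disjoint, auto)
    qed
    moreover have "\<bar>T (lev A m) {m ^ A<..n} i j \<omega>\<bar> < \<epsilon> * nlog (m ^ A)"
      using inc n ij mult_le_mono2[OF n(2), of D] by (meson order_trans)
    moreover have "\<epsilon> * nlog (m ^ A) \<le> \<epsilon> * nlog n"
      using assms nlog_mono[OF n(1)] by simp
    ultimately show "\<bar>(\<Sum>k=1..n. Y k i j \<omega>) - T (lev A m) {1..m ^ A} i j \<omega>\<bar> \<le> 2 * \<epsilon> * nlog n"
      by linarith
  qed
  qed
qed

lemma AE_S_upper:
  fixes \<epsilon> :: real and D :: nat
  assumes "\<epsilon> > 0"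
  shows "AE \<omega> in M. small_products D \<omega> \<longrightarrow> (\<forall>\<^sub>F n in sequentially. \<forall>i j. 1 \<le> i \<longrightarrow> i < j \<longrightarrow> j \<le> D * n \<longrightarrow>
    \<bar>\<Sum>k=1..n. Y k i j \<omega>\<bar> \<le> (2 + \<epsilon>) * nlog n)"
    (is "AE \<omega> in M. _ \<longrightarrow> ?Q \<omega>")
proof -
  \<comment> \<open>One share is for the truncated sum at the beginning of the block, two are for
    the block error.\<close>
  define \<delta> where "\<delta> = \<epsilon> / 3"
  define A where "A = max 2 (nat \<lceil>2 / \<delta>\<rceil>)"
  have \<delta>: "\<delta> > 0" "\<epsilon> = 3 * \<delta>" using assms by (auto simp: \<delta>_def)
  have "2 / \<delta> \<le> real A" unfolding A_def by linarith
  then have A: "real A * \<delta> \<ge> 2" "A \<ge> 2" "A \<ge> 1" using \<delta> by (auto simp: field_simps A_def)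
  show ?thesis
    using AE_T_upper[OF \<delta>(1) A(1,3), of D] AE_S_block[OF \<delta>(1) A(2), of D]
  proof eventually_elim
    case (elim \<omega>)
    have "?Q \<omega>" if sp: "small_products D \<omega>"
    proof (rule eventually_power_blocks[OF A(3)])
      from elim(1) mp[OF elim(2) sp]
      show "\<forall>\<^sub>F m in sequentially. \<forall>n. m ^ A \<le> n \<longrightarrow> n \<le> Suc m ^ A \<longrightarrow>
        (\<forall>i j. 1 \<le> i \<longrightarrow> i < j \<longrightarrow> j \<le> D * n \<longrightarrow> \<bar>\<Sum>k=1..n. Y k i j \<omega>\<bar> \<le> (2 + \<epsilon>) * nlog n)"
      proof (eventually_elim, intro allI impI)
        fix m n i j
        assume up: "\<forall>i j. 1 \<le> i \<longrightarrow> i < j \<longrightarrow> j \<le> D * Suc m ^ A \<longrightarrow>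
            \<bar>T (lev A m) {1..m ^ A} i j \<omega>\<bar> < (2 + \<delta>) * nlog (m ^ A)"
          and bl: "\<forall>n i j. m ^ A \<le> n \<longrightarrow> n \<le> Suc m ^ A \<longrightarrow> 1 \<le> i \<longrightarrow> i < j \<longrightarrow> j \<le> D * n \<longrightarrow>
            \<bar>(\<Sum>k=1..n. Y k i j \<omega>) - T (lev A m) {1..m ^ A} i j \<omega>\<bar> \<le> 2 * \<delta> * nlog n"
          and n: "m ^ A \<le> n" "n \<le> Suc m ^ A" and ij: "1 \<le> i" "i < j" "j \<le> D * n"
        have "\<bar>T (lev A m) {1..m ^ A} i j \<omega>\<bar> < (2 + \<delta>) * nlog (m ^ A)"
          using up ij mult_le_mono2[OF n(2), of D] by (meson order_trans)
        moreover have "(2 + \<delta>) * nlog (m ^ A) \<le> (2 + \<delta>) * nlog n"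
          using \<delta> nlog_mono[OF n(1)] by (intro mult_left_mono) auto
        moreover have "\<bar>(\<Sum>k=1..n. Y k i j \<omega>) - T (lev A m) {1..m ^ A} i j \<omega>\<bar> \<le> 2 * \<delta> * nlog n"
          using bl n ij by blast
        moreover have "(2 + \<epsilon>) * nlog n = (2 + \<delta>) * nlog n + 2 * \<delta> * nlog n"
          by (simp add: \<delta>(2) algebra_simps)
        ultimately show "\<bar>\<Sum>k=1..n. Y k i j \<omega>\<bar> \<le> (2 + \<epsilon>) * nlog n" by linarith
      qed
    qed
    then show ?case ..
  qed
qed

lemma AE_S_lower:
  fixes \<epsilon> :: real and D :: nat
  assumes "0 < \<epsilon>" "\<epsilon> < 1" "D \<ge> 1"
  shows "AE \<omega> in M. small_products D \<omega> \<longrightarrow> (\<forall>\<^sub>F n in sequentially. \<forall>q. n \<le> D * q \<longrightarrow>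
    (\<exists>i j. 1 \<le> i \<and> i < j \<and> j \<le> q \<and> j \<le> D * n \<and> (2 - \<epsilon>) * nlog n \<le> \<bar>\<Sum>k=1..n. Y k i j \<omega>\<bar>))"
    (is "AE \<omega> in M. _ \<longrightarrow> ?Q \<omega>")
proof -
  \<comment> \<open>The product (2 - \<delta>)(1 - \<delta>) loses at most three shares, the second
    factor coming from the growth of the scale over the block; the block error takes two
    more.\<close>
  define \<delta> where "\<delta> = \<epsilon> / 5"
  have \<delta>: "\<delta> > 0" "\<epsilon> = 5 * \<delta>" "\<delta> < 1" using assms by (auto simp: \<delta>_def)
  \<comment> \<open>The factor 3 pays for halving the number of columns with rounding: r <= 3 (r div
    2) for r at least 2.\<close>
  obtain A0 where A0: "\<And>A. A \<ge> A0 \<Longrightarrow> AE \<omega> in M. \<forall>\<^sub>F m in sequentially. \<forall>h. real (m ^ A) \<le> real (3 * D) * real h \<longrightarrow>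
    (\<exists>i j. 1 \<le> i \<and> i < j \<and> j \<le> 2 * h \<and> T (lev A m) {1..m ^ A} i j \<omega> > (2 - \<delta>) * nlog (m ^ A))"
    using AE_T_lower[of "2 - \<delta>" "real (3 * D)"] \<delta> assms by auto
  define A where "A = max 2 A0"
  have A: "A \<ge> 2" "A \<ge> 1" "A \<ge> A0" by (auto simp: A_def)
  have big: "\<forall>\<^sub>F n in sequentially. 3 * D < n" by (rule eventually_gt_at_top)
  show ?thesis
    using A0[OF A(3)] AE_S_block[OF \<delta>(1) A(1), of D]
  proof eventually_elim
    case (elim \<omega>)
    have "?Q \<omega>" if sp: "small_products D \<omega>"
    proof (rule eventually_power_blocks[OF A(2)])
      from elim(1) mp[OF elim(2) sp] nlog_Suc_power_ratio[OF \<delta>(1) A(2)] eventually_on_blocks[OF big A(2)]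
      show "\<forall>\<^sub>F m in sequentially. \<forall>n. m ^ A \<le> n \<longrightarrow> n \<le> Suc m ^ A \<longrightarrow> (\<forall>q. n \<le> D * q \<longrightarrow>
        (\<exists>i j. 1 \<le> i \<and> i < j \<and> j \<le> q \<and> j \<le> D * n \<and> (2 - \<epsilon>) * nlog n \<le> \<bar>\<Sum>k=1..n. Y k i j \<omega>\<bar>))"
      proof (eventually_elim, intro allI impI)
        fix m n q
        assume lo: "\<forall>h. real (m ^ A) \<le> real (3 * D) * real h \<longrightarrow>
            (\<exists>i j. 1 \<le> i \<and> i < j \<and> j \<le> 2 * h \<and> T (lev A m) {1..m ^ A} i j \<omega> > (2 - \<delta>) * nlog (m ^ A))"
          and bl: "\<forall>n i j. m ^ A \<le> n \<longrightarrow> n \<le> Suc m ^ A \<longrightarrow> 1 \<le> i \<longrightarrow> i < j \<longrightarrow> j \<le> D * n \<longrightarrow>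
            \<bar>(\<Sum>k=1..n. Y k i j \<omega>) - T (lev A m) {1..m ^ A} i j \<omega>\<bar> \<le> 2 * \<delta> * nlog n"
          and ratio: "nlog (Suc m ^ A) * (1 - \<delta>) \<le> nlog (m ^ A)"
          and big: "\<forall>n. m ^ A \<le> n \<longrightarrow> 3 * D < n"
          and n: "m ^ A \<le> n" "n \<le> Suc m ^ A" and q: "n \<le> D * q"
        \<comment> \<open>Capping the number of columns at \<open>n\<close> keeps the pair in the
          range where the block estimate holds; n <= D r persists because D is at least 1.\<close>
        define r where "r = min q n"
        have r: "n \<le> D * r" "r \<le> q" "r \<le> n" using q assms(3) by (auto simp: r_def min_def)
        have "D * 3 < D * r" using big n r by (metis mult.commute order_less_le_trans)
        then have r3: "r \<ge> 3" using assms(3) by simp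
        have "m ^ A \<le> 3 * D * (r div 2)"
        proof -
          have "r \<le> 3 * (r div 2)" using r3 by linarith
          then have "D * r \<le> D * (3 * (r div 2))" by (rule mult_le_mono2)
          then have "m ^ A \<le> D * (3 * (r div 2))" using n(1) r(1) by linarith
          then show ?thesis by (simp add: mult.commute mult.left_commute)
        qed
        then have "real (m ^ A) \<le> real (3 * D) * real (r div 2)"
          by (simp only: of_nat_mult[symmetric] of_nat_le_iff)
        then obtain i j where ij: "1 \<le> i" "i < j" "j \<le> 2 * (r div 2)"
          and t: "T (lev A m) {1..m ^ A} i j \<omega> > (2 - \<delta>) * nlog (m ^ A)" using lo by blast
        have jr: "j \<le> r" using ij(3) by linarith
        have jD: "j \<le> D * n" using jr r(3) assms(3)
          by (metis One_nat_def le_trans mult.commute mult_le_mono2 nat_mult_1_right)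
        have "\<bar>(\<Sum>k=1..n. Y k i j \<omega>) - T (lev A m) {1..m ^ A} i j \<omega>\<bar> \<le> 2 * \<delta> * nlog n"
          using bl n ij jD by blast
        moreover have "nlog n * (1 - \<delta>) \<le> nlog (m ^ A)"
        proof -
          have "nlog n * (1 - \<delta>) \<le> nlog (Suc m ^ A) * (1 - \<delta>)"
            using \<delta> nlog_mono[OF n(2)] by (intro mult_right_mono) auto
          then show ?thesis using ratio by linarith
        qed
        then have "(2 - \<delta>) * (nlog n * (1 - \<delta>)) \<le> (2 - \<delta>) * nlog (m ^ A)"
          using \<delta> by (intro mult_left_mono) auto
        moreover have "(2 - \<delta>) * (nlog n * (1 - \<delta>)) = (2 - 3 * \<delta>) * nlog n + \<delta>\<^sup>2 * nlog n"
          by (simp add: power2_eq_square algebra_simps)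
        moreover have "\<delta>\<^sup>2 * nlog n \<ge> 0" using nlog_nonneg by simp
        moreover have "(2 - \<epsilon>) * nlog n = (2 - 3 * \<delta>) * nlog n - 2 * \<delta> * nlog n"
          by (simp add: \<delta>(2) algebra_simps)
        ultimately have "(2 - \<epsilon>) * nlog n \<le> \<bar>\<Sum>k=1..n. Y k i j \<omega>\<bar>" using t by linarith
        then show "\<exists>i j. 1 \<le> i \<and> i < j \<and> j \<le> q \<and> j \<le> D * n \<and> (2 - \<epsilon>) * nlog n \<le> \<bar>\<Sum>k=1..n. Y k i j \<omega>\<bar>"
          using ij jr r jD by (meson order_trans)
      qed
    qed
    then show ?case ..
  qed
qed

end

subsection \<open>Consequences of the summability hypothesis\<close>

text \<open>Positivity of \<open>a\<close> rules out the value 0 inserted into the maximum. The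
  unordered condition on the indices is invariant under permutations of the columns.\<close>

lemma max_prod_ge_iff:
  assumes "a > 0"
  shows "max_prod Y n \<omega> \<ge> a \<longleftrightarrow> (\<exists>i\<in>{1..n}. \<exists>j\<in>{1..n}. i \<noteq> j \<and> \<bar>Y i \<omega> * Y j \<omega>\<bar> \<ge> a)"
proof -
  let ?S = "{\<bar>Y i \<omega> * Y j \<omega>\<bar> | i j. 1 \<le> i \<and> i < j \<and> j \<le> n}"
  have "?S \<subseteq> (\<lambda>(i, j). \<bar>Y i \<omega> * Y j \<omega>\<bar>) ` ({1..n} \<times> {1..n})" by auto
  then have "finite ?S" by (rule finite_subset) simp
  then have "max_prod Y n \<omega> \<ge> a \<longleftrightarrow> (\<exists>i j. 1 \<le> i \<and> i < j \<and> j \<le> n \<and> \<bar>Y i \<omega> * Y j \<omega>\<bar> \<ge> a)"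
    unfolding max_prod_def using assms by (subst Max_ge_iff) auto
  also have "\<dots> \<longleftrightarrow> (\<exists>i\<in>{1..n}. \<exists>j\<in>{1..n}. i \<noteq> j \<and> \<bar>Y i \<omega> * Y j \<omega>\<bar> \<ge> a)" (is "?L = ?R")
  proof
    show ?R if ?L using that by (metis atLeastAtMost_iff less_imp_le less_irrefl order_trans)
    show ?L if R: ?R
    proof -
      obtain i j where "i \<in> {1..n}" "j \<in> {1..n}" "i \<noteq> j" "\<bar>Y i \<omega> * Y j \<omega>\<bar> \<ge> a" using R by blast
      then have "1 \<le> min i j \<and> min i j < max i j \<and> max i j \<le> n \<and> \<bar>Y (min i j) \<omega> * Y (max i j) \<omega>\<bar> \<ge> a"
        by (auto simp: min_def max_def mult.commute)
      then show ?thesis by blast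
    qed
  qed
  finally show ?thesis .
qed

lemma sum_dyadic:
  fixes P :: "nat \<Rightarrow> real"
  shows "(\<Sum>m<s. \<Sum>n\<in>{2^m..<2^Suc m}. P n) = (\<Sum>n\<in>{1..<2^s}. P n)"
proof (induction s)
  case (Suc s)
  have "{1..<2^Suc s} = {1..<2^s} \<union> {2^s..<2^Suc s :: nat}" by auto
  moreover have "(\<Sum>n\<in>{1..<2^s} \<union> {2^s..<2^Suc s}. P n) = (\<Sum>n\<in>{1..<2^s}. P n) + (\<Sum>n\<in>{2^s..<2^Suc s}. P n)"
    by (rule sum.union_disjoint) auto
  ultimately show ?case using Suc by simp
qed simp

lemma dyadic_sums:
  fixes P :: "nat \<Rightarrow> real"
  assumes "\<And>n. P n \<ge> 0" "summable P"
  shows "summable (\<lambda>m. \<Sum>n\<in>{2^m..<2^Suc m}. P n)" and "(\<Sum>n\<in>{2^m..<2^Suc m}. P n) \<le> suminf P"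
proof -
  show "summable (\<lambda>m. \<Sum>n\<in>{2^m..<2^Suc m}. P n)"
  proof (rule summableI_nonneg_bounded[where x="suminf P"])
    show "(\<Sum>m<s. \<Sum>n\<in>{2^m..<2^Suc m}. P n) \<le> suminf P" for s
      unfolding sum_dyadic using assms by (intro sum_le_suminf) auto
  qed (use assms in \<open>auto intro: sum_nonneg\<close>)
  show "(\<Sum>n\<in>{2^m..<2^Suc m}. P n) \<le> suminf P"
    using assms by (intro sum_le_suminf) auto
qed

lemma eventually_dyadic_blocks:
  assumes ev: "\<forall>\<^sub>F m in sequentially. \<forall>n. 2 ^ m \<le> n \<longrightarrow> n \<le> 2 ^ Suc m \<longrightarrow> Q n"
  shows "eventually Q sequentially"
proof -
  obtain m0 where m0: "\<And>m n. m0 \<le> m \<Longrightarrow> 2 ^ m \<le> n \<Longrightarrow> n \<le> 2 ^ Suc m \<Longrightarrow> Q n"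
    using ev unfolding eventually_sequentially by blast
  have "Q n" if n: "n \<ge> 2 ^ m0" for n
  proof -
    have "n \<ge> 1" using n by (metis one_le_numeral one_le_power order_trans)
    then obtain m where m: "2 ^ m \<le> n" "n < 2 ^ (m + 1)" using ex_power_ivl1[of 2 n] by auto
    have "m0 \<le> m"
    proof (rule ccontr)
      assume "\<not> m0 \<le> m"
      then have "(2::nat) ^ (m + 1) \<le> 2 ^ m0" by (intro power_increasing) auto
      then show False using m n by simp
    qed
    then show ?thesis using m0[of m n] m by simp
  qed
  then show ?thesis unfolding eventually_sequentially by blast
qed

section \<open>Large products in one row\<close>

context iid_array
begin

definition exceed :: "nat \<Rightarrow> nat set \<Rightarrow> real \<Rightarrow> 'a set" where
  "exceed k J a = {\<omega>\<in>space M. \<exists>i\<in>J. \<exists>j\<in>J. i \<noteq> j \<and> \<bar>Z k i \<omega> * Z k j \<omega>\<bar> \<ge> a}"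

lemma exceed_sets[measurable]: "finite J \<Longrightarrow> exceed k J a \<in> events"
  unfolding exceed_def by (intro sets.sets_Collect_finite_Ex) auto

lemma prob_exceed_exchange:
  assumes J: "finite J" "J \<subseteq> {1..}" "card J \<le> n" and "k \<ge> 1"
  shows "prob (exceed k J a) \<le> prob (exceed 1 {1..n} a)"
proof (cases "J = {}")
  case True
  then show ?thesis by (simp add: exceed_def)
next
  case False
  define c where "c = card J"
  obtain g where g: "bij_betw g {1..c} J"
    using J(1) unfolding c_def by (metis ex_bij_betw_nat_finite_1)
  define P :: "(nat \<Rightarrow> real) \<Rightarrow> bool" where
    "P x \<longleftrightarrow> (\<exists>i\<in>{1..c}. \<exists>j\<in>{1..c}. i \<noteq> j \<and> \<bar>x i * x j\<bar> \<ge> a)" for x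
  have c: "c \<ge> 1" using False J by (simp add: c_def Suc_le_eq card_gt_0_iff)
  have "prob {\<omega>\<in>space M. P (\<lambda>x\<in>{1..c}. entry (k, g x) \<omega>)} = prob {\<omega>\<in>space M. P (\<lambda>x\<in>{1..c}. entry (1, x) \<omega>)}"
  proof (rule prob_reindex)
    show "{1..c} \<noteq> {}" using c by simp
    have inj: "inj_on g {1..c}" using g by (rule bij_betw_imp_inj_on)
    show "inj_on (\<lambda>x. (k, g x)) {1..c}" by (rule inj_onI) (simp add: inj_onD[OF inj])
    show "(\<lambda>x. (k, g x)) ` {1..c} \<subseteq> {1..} \<times> {1..}"
    proof (rule image_subsetI)
      fix x assume "x \<in> {1..c}"
      then have "g x \<in> {1..}" using bij_betwE[OF g] J(2) by blast
      then show "(k, g x) \<in> {1..} \<times> {1..}" using \<open>k \<ge> 1\<close> by simp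
    qed
    have comp[measurable]: "(\<lambda>x. x y) \<in> borel_measurable (PiM {1..c} (\<lambda>_. borel))" if "y \<in> {1..c}" for y
      using that by (rule measurable_component_singleton)
    show "{x \<in> space (PiM {1..c} (\<lambda>_. borel)). P x} \<in> sets (PiM {1..c} (\<lambda>_. borel))"
      unfolding P_def
    proof (intro sets.sets_Collect_finite_Ex sets.sets_Collect_conj)
      fix i j assume "i \<in> {1..c}" "j \<in> {1..c}"
      then show "{x \<in> space (PiM {1..c} (\<lambda>_. borel)). a \<le> \<bar>x i * x j\<bar>} \<in> sets (PiM {1..c} (\<lambda>_. borel))"
        by (intro borel_measurable_le borel_measurable_abs borel_measurable_times comp borel_measurable_const)
    qed simp_all
    show "inj_on (\<lambda>x. (1::nat, x)) {1..c}" by (rule inj_onI) simp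
    show "(\<lambda>x. (1::nat, x)) ` {1..c} \<subseteq> {1..} \<times> {1..}" by (rule image_subsetI) simp
  qed
  moreover have "P (\<lambda>x\<in>{1..c}. entry (k, g x) \<omega>) \<longleftrightarrow> (\<exists>i\<in>J. \<exists>j\<in>J. i \<noteq> j \<and> \<bar>Z k i \<omega> * Z k j \<omega>\<bar> \<ge> a)" for \<omega>
  proof -
    have J': "J = g ` {1..c}" and inj: "inj_on g {1..c}" using g by (auto simp: bij_betw_def)
    have "P (\<lambda>x\<in>{1..c}. entry (k, g x) \<omega>) \<longleftrightarrow>
        (\<exists>i\<in>{1..c}. \<exists>j\<in>{1..c}. i \<noteq> j \<and> \<bar>Z k (g i) \<omega> * Z k (g j) \<omega>\<bar> \<ge> a)"
      unfolding P_def by simp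
    also have "\<dots> \<longleftrightarrow> (\<exists>i\<in>{1..c}. \<exists>j\<in>{1..c}. g i \<noteq> g j \<and> \<bar>Z k (g i) \<omega> * Z k (g j) \<omega>\<bar> \<ge> a)"
      using inj_on_eq_iff[OF inj] by blast
    also have "\<dots> \<longleftrightarrow> (\<exists>i\<in>J. \<exists>j\<in>J. i \<noteq> j \<and> \<bar>Z k i \<omega> * Z k j \<omega>\<bar> \<ge> a)"
      unfolding J' by blast
    finally show ?thesis .
  qed
  moreover have "P (\<lambda>x\<in>{1..c}. entry (1, x) \<omega>) \<longleftrightarrow> (\<exists>i\<in>{1..c}. \<exists>j\<in>{1..c}. i \<noteq> j \<and> \<bar>Z 1 i \<omega> * Z 1 j \<omega>\<bar> \<ge> a)" for \<omega>
    unfolding P_def by simp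
  ultimately have "prob (exceed k J a) = prob (exceed 1 {1..c} a)" unfolding exceed_def by simp
  also have "\<dots> \<le> prob (exceed 1 {1..n} a)"
  proof (rule finite_measure_mono)
    have "{1..c} \<subseteq> {1..n}" using J(3) by (auto simp: c_def)
    then show "exceed 1 {1..c} a \<subseteq> exceed 1 {1..n} a" unfolding exceed_def by blast
  qed measurable
  finally show ?thesis .
qed

text \<open>Cut the columns into \<open>R\<close> pieces of length \<open>b\<close>. The two columns
  of a large product lie in the union of two pieces, which by exchangeability is no worse than the
  first \<open>n\<close> columns of the first row.\<close>

lemma prob_exceed_blocks:
  fixes R b n p :: nat
  assumes "p \<le> R * b" "2 * b \<le> n" "k \<ge> 1"
  shows "prob (exceed k {1..p} a) \<le> (real R)\<^sup>2 * prob (exceed 1 {1..n} a)"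
proof -
  define J where "J s = {s * b + 1..s * b + b}" for s
  have "exceed k {1..p} a \<subseteq> (\<Union>(s, t)\<in>{..<R} \<times> {..<R}. exceed k (J s \<union> J t) a)"
  proof
    fix \<omega> assume "\<omega> \<in> exceed k {1..p} a"
    then obtain i j where w: "\<omega> \<in> space M" and ij: "i \<in> {1..p}" "j \<in> {1..p}" "i \<noteq> j" "\<bar>Z k i \<omega> * Z k j \<omega>\<bar> \<ge> a"
      unfolding exceed_def by blast
    have mem: "\<exists>s<R. i \<in> J s" if "i \<in> {1..p}" for i
    proof -
      have "b > 0" using that assms(1) by (cases b) auto
      have "(i - 1) div b < R" using that assms(1) \<open>b > 0\<close> by (auto simp: div_less_iff_less_mult)
      moreover have "(i - 1) div b * b \<le> i - 1" "i - 1 < (i - 1) div b * b + b"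
        using \<open>b > 0\<close> div_mult_mod_eq[of "i - 1" b] mod_less_divisor[of b "i - 1"] by linarith+
      then have "(i - 1) div b * b + 1 \<le> i" "i \<le> (i - 1) div b * b + b"
        using that by (simp_all only: atLeastAtMost_iff) linarith+
      then have "i \<in> J ((i - 1) div b)" by (simp add: J_def)
      ultimately show ?thesis by blast
    qed
    obtain s t where "s < R" "i \<in> J s" "t < R" "j \<in> J t" using mem[OF ij(1)] mem[OF ij(2)] by blast
    then show "\<omega> \<in> (\<Union>(s, t)\<in>{..<R} \<times> {..<R}. exceed k (J s \<union> J t) a)"
      using w ij by (auto simp: exceed_def)
  qed
  then have "prob (exceed k {1..p} a) \<le> prob (\<Union>(s, t)\<in>{..<R} \<times> {..<R}. exceed k (J s \<union> J t) a)"
    by (intro finite_measure_mono sets.finite_UN) (auto simp: J_def)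
  also have "\<dots> \<le> (\<Sum>x\<in>{..<R} \<times> {..<R}. prob (exceed k (J (fst x) \<union> J (snd x)) a))"
    unfolding case_prod_beta by (intro measure_UNION_le) (auto simp: J_def)
  also have "\<dots> \<le> (\<Sum>x\<in>{..<R} \<times> {..<R}. prob (exceed 1 {1..n} a))"
  proof (intro sum_mono prob_exceed_exchange)
    fix x show "card (J (fst x) \<union> J (snd x)) \<le> n"
      using card_Un_le[of "J (fst x)" "J (snd x)"] assms(2) by (simp add: J_def)
  qed (use assms in \<open>auto simp: J_def\<close>)
  also have "\<dots> = (real R)\<^sup>2 * prob (exceed 1 {1..n} a)"
    by (simp add: card_cartesian_product power2_eq_square)
  finally show ?thesis .
qed

lemma prob_exists_large:
  assumes "finite J" "J \<noteq> {}" "J \<subseteq> {1..}"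
  shows "prob {\<omega>\<in>space M. \<exists>i\<in>J. \<bar>Z 1 i \<omega>\<bar> \<ge> x} = 1 - (1 - prob {\<omega>\<in>space M. \<bar>Z 1 1 \<omega>\<bar> \<ge> x}) ^ card J"
proof -
  have ind: "indep_vars (\<lambda>_. borel) (\<lambda>i \<omega>. (\<lambda>y. \<bar>y\<bar>) (Z 1 i \<omega>)) J"
    using assms by (intro indep_row_entries) auto
  have "prob {\<omega>\<in>space M. \<not> (\<exists>i\<in>J. \<bar>Z 1 i \<omega>\<bar> \<ge> x)} = prob (\<Inter>i\<in>J. (\<lambda>\<omega>. \<bar>Z 1 i \<omega>\<bar>) -` {..<x} \<inter> space M)"
    using assms(2) by (intro arg_cong[where f=prob]) (auto simp: not_le)
  also have "\<dots> = (\<Prod>i\<in>J. prob ((\<lambda>\<omega>. \<bar>Z 1 i \<omega>\<bar>) -` {..<x} \<inter> space M))"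
    using assms by (intro indep_varsD[OF ind]) auto
  also have "\<dots> = (\<Prod>i\<in>J. 1 - prob {\<omega>\<in>space M. \<bar>Z 1 1 \<omega>\<bar> \<ge> x})"
  proof (rule prod.cong[OF refl])
    fix i assume "i \<in> J"
    then have i: "i \<ge> 1" using assms by auto
    have "(\<lambda>\<omega>. \<bar>Z 1 i \<omega>\<bar>) -` {..<x} \<inter> space M = {\<omega>\<in>space M. \<not> \<bar>Z 1 i \<omega>\<bar> \<ge> x}" by auto
    moreover have "prob {\<omega>\<in>space M. \<not> \<bar>Z 1 i \<omega>\<bar> \<ge> x} = 1 - prob {\<omega>\<in>space M. \<bar>Z 1 i \<omega>\<bar> \<ge> x}"
      by (rule prob_neg) measurable
    moreover have "prob {\<omega>\<in>space M. \<bar>Z 1 i \<omega>\<bar> \<ge> x} = prob {\<omega>\<in>space M. \<bar>Z 1 1 \<omega>\<bar> \<ge> x}"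
      using i by (intro prob_entry) auto
    ultimately show "prob ((\<lambda>\<omega>. \<bar>Z 1 i \<omega>\<bar>) -` {..<x} \<inter> space M) = 1 - prob {\<omega>\<in>space M. \<bar>Z 1 1 \<omega>\<bar> \<ge> x}" by simp
  qed
  finally have "prob {\<omega>\<in>space M. \<not> (\<exists>i\<in>J. \<bar>Z 1 i \<omega>\<bar> \<ge> x)} = (1 - prob {\<omega>\<in>space M. \<bar>Z 1 1 \<omega>\<bar> \<ge> x}) ^ card J"
    by simp
  moreover have "prob {\<omega>\<in>space M. \<not> (\<exists>i\<in>J. \<bar>Z 1 i \<omega>\<bar> \<ge> x)} = 1 - prob {\<omega>\<in>space M. \<exists>i\<in>J. \<bar>Z 1 i \<omega>\<bar> \<ge> x}"
    using assms by (intro prob_neg sets.sets_Collect_finite_Ex) auto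
  ultimately show ?thesis by simp
qed

text \<open>Uses (1 - q)^h <= exp(-hq) and, on the unit interval, exp(-y) <= 1/(1 + y) <= 1 -
  y/2.\<close>

lemma one_minus_power_ge:
  fixes q :: real
  assumes "0 \<le> q" "q \<le> 1"
  shows "min 1 (real h * q) / 2 \<le> 1 - (1 - q) ^ h"
proof -
  define y where "y = min 1 (real h * q)"
  have y: "0 \<le> y" "y \<le> 1" "y \<le> real h * q" using assms by (auto simp: y_def)
  have "(1 - q) ^ h \<le> exp (- q) ^ h"
    using assms exp_ge_add_one_self[of "- q"] by (intro power_mono) auto
  also have "\<dots> = exp (- (real h * q))" by (simp add: exp_of_nat_mult[symmetric])
  also have "\<dots> \<le> exp (- y)" using y by simp
  also have "exp (- y) \<le> 1 - y / 2"
  proof -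
    have "exp (- y) = 1 / exp y" by (simp add: exp_minus divide_inverse)
    also have "\<dots> \<le> 1 / (1 + y)" using y exp_ge_add_one_self[of y] by (intro divide_left_mono) auto
    also have "\<dots> \<le> 1 - y / 2"
    proof -
      have "0 \<le> y * (1 - y)" using y by simp
      then have "1 \<le> (1 - y / 2) * (1 + y)" by (simp add: algebra_simps)
      then show ?thesis using y by (subst pos_divide_le_eq) auto
    qed
    finally show ?thesis .
  qed
  finally show ?thesis by (simp add: y_def)
qed

text \<open>One entry above sqrt a in each of two disjoint groups of \<open>h\<close> columns
  produces a product above \<open>a\<close>. The groups are independent, hence the square.\<close>

lemma prob_exceed_ge:
  assumes "h \<ge> 1" "2 * h \<le> n" "0 \<le> a"
  shows "(min 1 (real h * prob {\<omega>\<in>space M. \<bar>Z 1 1 \<omega>\<bar> \<ge> sqrt a}) / 2)\<^sup>2 \<le> prob (exceed 1 {1..n} a)"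
proof -
  let ?q = "prob {\<omega>\<in>space M. \<bar>Z 1 1 \<omega>\<bar> \<ge> sqrt a}"
  define E where "E J = {\<omega>\<in>space M. \<exists>i\<in>J. \<bar>Z 1 i \<omega>\<bar> \<ge> sqrt a}" for J :: "nat set"
  have Em: "E J \<in> events" if "finite J" for J
    unfolding E_def using that by (intro sets.sets_Collect_finite_Ex) auto
  have pE: "min 1 (real (card J) * ?q) / 2 \<le> prob (E J)" if "finite J" "J \<noteq> {}" "J \<subseteq> {1..}" for J
    unfolding E_def prob_exists_large[OF that] by (intro one_minus_power_ge) auto
  define A where "A = {1..h}"
  define B where "B = {h+1..2*h}"
  \<comment> \<open>Counts the large entries, so that their existence becomes positivity of a real
    function.\<close>
  define F where "F J g = (\<Sum>i\<in>J. if \<bar>g (1, i)\<bar> \<ge> sqrt a then 1 else 0 :: real)" for J :: "nat set" and g :: "nat \<times> nat \<Rightarrow> real"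
  have F: "F J \<in> borel_measurable (PiM ({1} \<times> J) (\<lambda>_. borel))" for J
    unfolding F_def
    by (intro borel_measurable_sum measurable_If borel_measurable_const borel_measurable_le
        borel_measurable_abs measurable_component_singleton) auto
  have FE: "{\<omega>\<in>space M. F J (\<lambda>x\<in>{1} \<times> J. entry x \<omega>) \<in> {0<..}} = E J" if "finite J" for J
  proof -
    have "F J (\<lambda>x\<in>{1} \<times> J. entry x \<omega>) = (\<Sum>i\<in>J. if \<bar>Z 1 i \<omega>\<bar> \<ge> sqrt a then 1 else 0)" for \<omega>
      unfolding F_def by (intro sum.cong) auto
    then have "F J (\<lambda>x\<in>{1} \<times> J. entry x \<omega>) > 0 \<longleftrightarrow> (\<exists>i\<in>J. \<bar>Z 1 i \<omega>\<bar> \<ge> sqrt a)" for \<omega>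
      using sum_nonneg_eq_0_iff[OF that, of "\<lambda>i. if \<bar>Z 1 i \<omega>\<bar> \<ge> sqrt a then 1 else 0 :: real"]
        sum_nonneg[of J "\<lambda>i. if \<bar>Z 1 i \<omega>\<bar> \<ge> sqrt a then 1 else 0 :: real"]
      by (auto simp: less_le split: if_splits)
    then show ?thesis by (simp add: E_def)
  qed
  have "prob (E A \<inter> E B) = prob (E A) * prob (E B)"
  proof -
    have "prob {\<omega>\<in>space M. F A (\<lambda>x\<in>{1} \<times> A. entry x \<omega>) \<in> {0<..} \<and> F B (\<lambda>x\<in>{1} \<times> B. entry x \<omega>) \<in> {0<..}}
      = prob {\<omega>\<in>space M. F A (\<lambda>x\<in>{1} \<times> A. entry x \<omega>) \<in> {0<..}} * prob {\<omega>\<in>space M. F B (\<lambda>x\<in>{1} \<times> B. entry x \<omega>) \<in> {0<..}}"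
      by (intro prob_conj_indep_group[OF indep _ _ _ F F]) (auto simp: A_def B_def)
    moreover have "{\<omega>\<in>space M. F A (\<lambda>x\<in>{1} \<times> A. entry x \<omega>) \<in> {0<..} \<and> F B (\<lambda>x\<in>{1} \<times> B. entry x \<omega>) \<in> {0<..}} = E A \<inter> E B"
      using FE[of A] FE[of B] by (auto simp: A_def B_def)
    ultimately show ?thesis using FE[of A] FE[of B] by (simp add: A_def B_def)
  qed
  moreover have "E A \<inter> E B \<subseteq> exceed 1 {1..n} a"
  proof
    fix \<omega> assume "\<omega> \<in> E A \<inter> E B"
    then obtain i j where ij: "\<omega> \<in> space M" "i \<in> A" "j \<in> B" "\<bar>Z 1 i \<omega>\<bar> \<ge> sqrt a" "\<bar>Z 1 j \<omega>\<bar> \<ge> sqrt a"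
      unfolding E_def by blast
    then have "\<bar>Z 1 i \<omega>\<bar> * \<bar>Z 1 j \<omega>\<bar> \<ge> sqrt a * sqrt a" using assms by (intro mult_mono) auto
    then have "\<bar>Z 1 i \<omega> * Z 1 j \<omega>\<bar> \<ge> a" using assms by (simp add: abs_mult)
    moreover have "i \<in> {1..n}" "j \<in> {1..n}" "i \<noteq> j" using ij assms by (auto simp: A_def B_def)
    ultimately show "\<omega> \<in> exceed 1 {1..n} a" using ij(1) unfolding exceed_def by blast
  qed
  then have "prob (E A \<inter> E B) \<le> prob (exceed 1 {1..n} a)" by (intro finite_measure_mono) auto
  moreover have "(min 1 (real h * ?q) / 2)\<^sup>2 \<le> prob (E A) * prob (E B)"
    unfolding power2_eq_square using pE[of A] pE[of B] assms by (intro mult_mono) (auto simp: A_def B_def)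
  ultimately show ?thesis by simp
qed

end

text \<open>Shrinking the sample size by a factor \<open>q\<close> shrinks the scale at least by
  sqrt q; this trades a small factor \<epsilon> for a smaller sample size.\<close>

lemma nlog_div_le:
  assumes "0 < n" "n * q \<le> N" "q \<ge> 1"
  shows "nlog n \<le> nlog N / sqrt q"
proof -
  have nN: "n \<le> N" using assms by (metis One_nat_def mult.right_neutral mult_le_mono2 order_trans)
  have "real n * ln (real n) * real q \<le> real N * ln (real N)"
  proof -
    have "real n * real q * ln (real n) \<le> real N * ln (real N)"
      using assms nN by (intro mult_mono) (simp_all flip: of_nat_mult)
    then show ?thesis by (simp add: mult_ac)
  qed
  then have "nlog n * sqrt q \<le> nlog N"
    unfolding nlog_def real_sqrt_mult[symmetric] by (rule real_sqrt_le_mono)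
  then show ?thesis using assms by (simp add: pos_le_divide_eq)
qed

lemma abs_power5_le_levels:
  fixes y :: "nat \<Rightarrow> real"
  assumes y: "\<And>s. 0 \<le> y s" and lim: "filterlim y at_top sequentially"
  shows "ennreal (\<bar>x\<bar> ^ 5) \<le> ennreal (y s0 ^ 5)
    + (\<Sum>s. ennreal (y (Suc (s0 + s)) ^ 5) * indicator {x. \<bar>x\<bar> \<ge> y (s0 + s)} x)"
proof (cases "\<bar>x\<bar> < y s0")
  case True
  then have "\<bar>x\<bar> ^ 5 \<le> y s0 ^ 5" by (intro power_mono) auto
  then show ?thesis by (intro add_increasing2) (auto intro: ennreal_leI)
next
  case False
  have "\<exists>s. \<bar>x\<bar> < y (s0 + s)"
  proof -
    have "\<forall>\<^sub>F s in sequentially. y s > \<bar>x\<bar>" using lim by (simp add: filterlim_at_top_dense)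
    then obtain s where "s \<ge> s0" "y s > \<bar>x\<bar>"
      by (metis eventually_sequentially nat_le_linear order.refl)
    then show ?thesis by (intro exI[of _ "s - s0"]) simp
  qed
  then obtain s where s: "\<bar>x\<bar> < y (s0 + s)" "\<And>t. t < s \<Longrightarrow> \<not> \<bar>x\<bar> < y (s0 + t)"
    using exists_least_iff[of "\<lambda>s. \<bar>x\<bar> < y (s0 + s)"] by blast
  then obtain t where t: "s = Suc t" using False by (cases s) auto
  have "\<bar>x\<bar> ^ 5 \<le> y (Suc (s0 + t)) ^ 5" using s t by (intro power_mono) auto
  then have "ennreal (\<bar>x\<bar> ^ 5) \<le> ennreal (y (Suc (s0 + t)) ^ 5) * indicator {x. \<bar>x\<bar> \<ge> y (s0 + t)} x"
    using s(2)[of t] t by (simp add: ennreal_leI not_less)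
  also have "\<dots> \<le> (\<Sum>s. ennreal (y (Suc (s0 + s)) ^ 5) * indicator {x. \<bar>x\<bar> \<ge> y (s0 + s)} x)"
  proof -
    define F where "F = (\<lambda>s. ennreal (y (Suc (s0 + s)) ^ 5) * indicator {x. \<bar>x\<bar> \<ge> y (s0 + s)} x)"
    have "F t = sum F {t}" by simp
    also have "\<dots> \<le> suminf F" by (rule sum_le_suminf) auto
    finally show ?thesis by (simp only: F_def)
  qed
  finally show ?thesis by (simp add: add_increasing)
qed

section \<open>From summability to small products and five moments\<close>

context iid_array
begin

text \<open>The rows of a dyadic block cost a factor \<open>2\<^sup>m\<close>, which is the number of summands of the
  hypothesis in one dyadic block. The factor \<open>\<epsilon>\<close> and the number of columns are absorbed by splitting
  the columns into boundedly many pieces.\<close>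

lemma AE_small_products_uncentred:
  fixes D :: nat and \<epsilon> :: real
  assumes summ: "summable (\<lambda>n. prob (exceed 1 {1..n} (nlog n)))" and "\<epsilon> > 0"
  shows "AE \<omega> in M. \<forall>\<^sub>F n in sequentially. \<forall>k i j. 1 \<le> k \<longrightarrow> k \<le> n \<longrightarrow>
    1 \<le> i \<longrightarrow> i < j \<longrightarrow> j \<le> D * n \<longrightarrow> \<bar>Z k i \<omega> * Z k j \<omega>\<bar> \<le> \<epsilon> * nlog n"
proof -
  define P where "P n = prob (exceed 1 {1..n} (nlog n))" for n
  \<comment> \<open>Going down by \<open>r\<close> dyadic generations gains 2^(-r/2), which is at
    most \<epsilon>.\<close>
  obtain r :: nat where r: "1 / \<epsilon>\<^sup>2 < 2 ^ r" using real_arch_pow[of 2 "1 / \<epsilon>\<^sup>2"] by auto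
  have r\<epsilon>: "1 / sqrt (2 ^ r) \<le> \<epsilon>"
  proof -
    have "1 \<le> \<epsilon>\<^sup>2 * 2 ^ r" using r \<open>\<epsilon> > 0\<close> by (simp add: field_simps)
    then have "1 \<le> sqrt (\<epsilon>\<^sup>2 * 2 ^ r)" by simp
    also have "\<dots> = \<epsilon> * sqrt (2 ^ r)" using \<open>\<epsilon> > 0\<close> by (simp add: real_sqrt_mult)
    finally show ?thesis by (simp add: pos_divide_le_eq)
  qed
  \<comment> \<open>The number of pieces of length 2^s that cover the D 2^(s+r+3) columns of the
    block with m = s + r + 2.\<close>
  define R where "R = 2 ^ (r + 3) * D"
  define U where "U m = (\<Union>k\<in>{1..2 ^ Suc m}. exceed k {1..D * 2 ^ Suc m} (\<epsilon> * nlog (2 ^ m)))" for m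
  have [measurable]: "U m \<in> events" for m unfolding U_def by measurable
  have bound: "prob (U (s + r + 2)) \<le> 2 ^ (r + 2) * (real R)\<^sup>2 * (\<Sum>n\<in>{2 ^ Suc s..<2 ^ Suc (Suc s)}. P n)" for s
  proof -
    let ?m = "s + r + 2"
    have each: "prob (exceed k {1..D * 2 ^ Suc ?m} (\<epsilon> * nlog (2 ^ ?m))) \<le> (real R)\<^sup>2 * P n"
      if k: "k \<ge> 1" and n: "n \<in> {2 ^ Suc s..<2 ^ Suc (Suc s)}" for k n
    proof -
      have n0: "n > 0" using n by (auto intro: less_le_trans[of 0 "2 ^ Suc s"])
      have "n * 2 ^ r \<le> 2 ^ Suc (Suc s) * 2 ^ r" using n by (intro mult_right_mono) auto
      also have "\<dots> = 2 ^ ?m" by (simp add: power_add)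
      finally have "nlog n \<le> nlog (2 ^ ?m) / sqrt (real (2 ^ r))" using n0 by (intro nlog_div_le) auto
      also have "\<dots> = nlog (2 ^ ?m) * (1 / sqrt (2 ^ r))" by simp
      also have "\<dots> \<le> nlog (2 ^ ?m) * \<epsilon>" using r\<epsilon> nlog_nonneg by (intro mult_left_mono) auto
      finally have le: "nlog n \<le> \<epsilon> * nlog (2 ^ ?m)" by (simp add: mult.commute)
      have "prob (exceed k {1..D * 2 ^ Suc ?m} (\<epsilon> * nlog (2 ^ ?m)))
        \<le> prob (exceed k {1..D * 2 ^ Suc ?m} (nlog n))"
      proof (rule finite_measure_mono)
        show "exceed k {1..D * 2 ^ Suc ?m} (\<epsilon> * nlog (2 ^ ?m)) \<subseteq> exceed k {1..D * 2 ^ Suc ?m} (nlog n)"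
          unfolding exceed_def using le by (fastforce intro: order_trans)
      qed measurable
      also have "\<dots> \<le> (real R)\<^sup>2 * prob (exceed 1 {1..n} (nlog n))"
      proof (rule prob_exceed_blocks[OF _ _ k])
        show "D * 2 ^ Suc ?m \<le> R * 2 ^ s" by (simp add: R_def power_add)
        show "2 * 2 ^ s \<le> n" using n by simp
      qed
      finally show ?thesis by (simp add: P_def)
    qed
    have U: "prob (U ?m) \<le> 2 ^ Suc ?m * ((real R)\<^sup>2 * P n)" if n: "n \<in> {2 ^ Suc s..<2 ^ Suc (Suc s)}" for n
    proof -
      have "prob (U ?m) \<le> (\<Sum>k\<in>{1..2 ^ Suc ?m}. prob (exceed k {1..D * 2 ^ Suc ?m} (\<epsilon> * nlog (2 ^ ?m))))"
        unfolding U_def by (intro measure_UNION_le) auto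
      also have "\<dots> \<le> (\<Sum>k\<in>{1..2 ^ Suc ?m :: nat}. (real R)\<^sup>2 * P n)"
        using n by (intro sum_mono each) simp_all
      also have "\<dots> = 2 ^ Suc ?m * ((real R)\<^sup>2 * P n)" by simp
      finally show ?thesis .
    qed
    \<comment> \<open>The same bound holds for each n of the dyadic block starting at 2^(s+1).
      Averaging over these n reduces the number of rows 2^(m+1) to the constant 2^(r+2).\<close>
    have "2 ^ Suc s * prob (U ?m) = (\<Sum>n\<in>{2 ^ Suc s..<2 ^ Suc (Suc s) :: nat}. prob (U ?m))"
      by simp
    also have "\<dots> \<le> (\<Sum>n\<in>{2 ^ Suc s..<2 ^ Suc (Suc s)}. 2 ^ Suc ?m * ((real R)\<^sup>2 * P n))"
      by (intro sum_mono U)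
    also have "\<dots> = 2 ^ Suc s * (2 ^ (r + 2) * (real R)\<^sup>2 * (\<Sum>n\<in>{2 ^ Suc s..<2 ^ Suc (Suc s)}. P n))"
      by (simp add: sum_distrib_left power_add mult_ac)
    finally show ?thesis by simp
  qed
  have "summable (\<lambda>m. \<Sum>n\<in>{2 ^ m..<2 ^ Suc m}. P n)"
    using summ by (intro dyadic_sums) (auto simp: P_def)
  then have "summable (\<lambda>s. \<Sum>n\<in>{2 ^ Suc s..<2 ^ Suc (Suc s)}. P n)"
    by (subst (asm) summable_Suc_iff[symmetric])
  then have "summable (\<lambda>s. 2 ^ (r + 2) * (real R)\<^sup>2 * (\<Sum>n\<in>{2 ^ Suc s..<2 ^ Suc (Suc s)}. P n))"
    by (rule summable_mult)
  then have "summable (\<lambda>s. prob (U (s + (r + 2))))"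
    by (rule summable_comparison_test'[where N=0]) (use bound in \<open>simp add: add.assoc\<close>)
  then have "summable (\<lambda>m. prob (U m))" by (subst (asm) summable_iff_shift)
  then have "AE \<omega> in M. \<forall>\<^sub>F m in sequentially. \<omega> \<in> space M - U m"
    by (intro borel_cantelli_AE1) (auto simp: emeasure_eq_measure)
  then show ?thesis
  proof eventually_elim
    case (elim \<omega>)
    show ?case
    proof (rule eventually_dyadic_blocks)
      from elim show "\<forall>\<^sub>F m in sequentially. \<forall>n. 2 ^ m \<le> n \<longrightarrow> n \<le> 2 ^ Suc m \<longrightarrow> (\<forall>k i j. 1 \<le> k \<longrightarrow> k \<le> n \<longrightarrow>
        1 \<le> i \<longrightarrow> i < j \<longrightarrow> j \<le> D * n \<longrightarrow> \<bar>Z k i \<omega> * Z k j \<omega>\<bar> \<le> \<epsilon> * nlog n)"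
      proof (eventually_elim, intro allI impI)
        fix m n k i j
        assume U: "\<omega> \<in> space M - U m" and n: "2 ^ m \<le> n" "n \<le> 2 ^ Suc m"
          and k: "1 \<le> k" "k \<le> n" and ij: "1 \<le> i" "i < j" "j \<le> D * n"
        have "k \<in> {1..2 ^ Suc m}" using k n by simp
        then have ne: "\<omega> \<notin> exceed k {1..D * 2 ^ Suc m} (\<epsilon> * nlog (2 ^ m))" using U unfolding U_def by blast
        have "j \<le> D * 2 ^ Suc m" using ij(3) mult_le_mono2[OF n(2), of D] by (rule order_trans)
        then have "i \<in> {1..D * 2 ^ Suc m}" "j \<in> {1..D * 2 ^ Suc m}" "i \<noteq> j" using ij by auto
        then have "\<not> \<bar>Z k i \<omega> * Z k j \<omega>\<bar> \<ge> \<epsilon> * nlog (2 ^ m)" using ne U unfolding exceed_def by blast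
        moreover have "\<epsilon> * nlog (2 ^ m) \<le> \<epsilon> * nlog n" using \<open>\<epsilon> > 0\<close> nlog_mono[OF n(1)] by simp
        ultimately show "\<bar>Z k i \<omega> * Z k j \<omega>\<bar> \<le> \<epsilon> * nlog n" by linarith
      qed
    qed
  qed
qed

text \<open>Two halves of the first \<open>n\<close> variables both exceeding \<open>sqrt (nlog n)\<close> force a large product, so
  \<open>n P(\<bar>X\<bar> \<ge> sqrt (nlog n))\<close> is square summable; summing over a dyadic block,
  \<open>P(\<bar>X\<bar> \<ge> x)\<close> decays like \<open>x\<^bsup>-6\<^esup>\<close> up to logarithms.\<close>

lemma integrable_power5:
  assumes summ: "summable (\<lambda>n. prob (exceed 1 {1..n} (nlog n)))"
  shows "integrable M (\<lambda>\<omega>. \<bar>Z 1 1 \<omega>\<bar> ^ 5)"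
proof -
  define P where "P n = prob (exceed 1 {1..n} (nlog n))" for n
  define S where "S = suminf P"
  define y where "y s = sqrt (nlog (2 ^ Suc s))" for s
  define q where "q s = prob {\<omega>\<in>space M. \<bar>Z 1 1 \<omega>\<bar> \<ge> y s}" for s
  have y0: "0 \<le> y s" for s by (simp add: y_def nlog_nonneg)
  have P: "\<And>n. P n \<ge> 0" "summable P" using summ unfolding P_def[abs_def] by simp_all
  have S0: "S \<ge> 0" unfolding S_def using P by (intro suminf_nonneg) auto
  \<comment> \<open>Each of the 2^(s+1) sample sizes of a dyadic block contributes at least this
    square, and the whole block contributes at most \<open>S\<close>.\<close>
  have q: "(min 1 (2 ^ s * q (Suc s)) / 2)\<^sup>2 * 2 ^ Suc s \<le> S" for s
  proof -
    have "(min 1 (real (2 ^ s) * q (Suc s)) / 2)\<^sup>2 \<le> P n" if n: "n \<in> {2 ^ Suc s..<2 ^ Suc (Suc s)}" for n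
    proof -
      have "(min 1 (real (2 ^ s) * q (Suc s)) / 2)\<^sup>2 \<le> prob (exceed 1 {1..n} (nlog (2 ^ Suc (Suc s))))"
        unfolding q_def y_def using n by (intro prob_exceed_ge nlog_nonneg) auto
      also have "\<dots> \<le> P n"
        unfolding P_def
      proof (rule finite_measure_mono)
        have "nlog n \<le> nlog (2 ^ Suc (Suc s))" using n by (intro nlog_mono) auto
        then show "exceed 1 {1..n} (nlog (2 ^ Suc (Suc s))) \<subseteq> exceed 1 {1..n} (nlog n)"
          unfolding exceed_def by (fastforce intro: order_trans)
      qed measurable
      finally show ?thesis .
    qed
    then have "(\<Sum>n\<in>{2 ^ Suc s..<2 ^ Suc (Suc s) :: nat}. (min 1 (real (2 ^ s) * q (Suc s)) / 2)\<^sup>2)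
        \<le> (\<Sum>n\<in>{2 ^ Suc s..<2 ^ Suc (Suc s)}. P n)" by (intro sum_mono)
    also have "\<dots> \<le> S" unfolding S_def using P by (intro dyadic_sums(2))
    finally show ?thesis by (simp add: mult.commute)
  qed
  have "(\<lambda>s. 2 * S / 2 ^ s) \<longlonglongrightarrow> 2 * S * 0"
    unfolding divide_inverse by (intro tendsto_mult_left) real_asymp
  then have "\<forall>\<^sub>F s in sequentially. 2 * S / 2 ^ s < 1" by (intro order_tendstoD) auto
  then obtain s1 where s1: "\<And>s. s \<ge> s1 \<Longrightarrow> 2 * S / 2 ^ s < 1" unfolding eventually_sequentially by blast
  \<comment> \<open>From \<open>s1\<close> on the minimum cannot be 1, so the inequality becomes a
    bound on \<open>q\<close> itself. The levels grow like 2^(s/4) up to logarithms, so 2^(-3s/2) is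
    a tail of order x^(-6).\<close>
  have qb: "q (Suc s) \<le> sqrt (2 * S) * (2 powr (- 3/2 * real s))" if s: "s \<ge> s1" for s
  proof -
    define z where "z = min 1 (2 ^ s * q (Suc s))"
    have z0: "z \<ge> 0" by (simp add: z_def q_def)
    have z2: "z\<^sup>2 \<le> 2 * S / 2 ^ s"
    proof -
      have "(z / 2)\<^sup>2 * 2 ^ Suc s \<le> S" using q[of s] unfolding z_def .
      then show ?thesis by (simp add: power_divide field_simps)
    qed
    also have "\<dots> < 1" by (rule s1[OF s])
    finally have "z\<^sup>2 < 1\<^sup>2" by simp
    then have "z < 1" by (rule power_less_imp_less_base) simp
    then have z: "z = 2 ^ s * q (Suc s)" by (simp add: z_def min_def split: if_splits)
    have "z \<le> sqrt (2 * S / 2 ^ s)" using z2 by (rule real_le_rsqrt)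
    then have "q (Suc s) \<le> sqrt (2 * S) / (sqrt (2 ^ s) * 2 ^ s)"
      unfolding z by (simp add: real_sqrt_divide field_simps)
    also have "sqrt (2 ^ s) * 2 ^ s = 2 powr (3/2 * real s)"
    proof -
      have "sqrt (2 ^ s) * 2 ^ s = 2 powr (real s / 2) * 2 powr real s"
        by (simp add: powr_realpow[symmetric] powr_half_sqrt[symmetric] powr_powr)
      then show ?thesis by (simp add: powr_add[symmetric])
    qed
    finally have "q (Suc s) \<le> sqrt (2 * S) / 2 powr (3/2 * real s)" .
    moreover have "2 powr (- 3/2 * real s) = 1 / 2 powr (3/2 * real s)"
      using powr_minus_divide[of 2 "3/2 * real s"] by simp
    ultimately show ?thesis by simp
  qed
  have ylim: "filterlim y at_top sequentially"
    unfolding y_def nlog_def by real_asymp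
  \<comment> \<open>The tail bound is stated at successors, hence the shift by one.\<close>
  define s0 where "s0 = Suc s1"
  define f where "f s = y (Suc (s0 + s)) ^ 5 * q (s0 + s)" for s
  have fsum: "summable f"
  proof -
    \<comment> \<open>Up to logarithms the fifth power of the level is 2^(5s/4); times 2^(-3s/2)
      this leaves 2^(-s/4), and half of that exponent absorbs the logarithms.\<close>
    have "\<forall>\<^sub>F s in sequentially. sqrt (sqrt (real (2 ^ (s + 2)) * ln (real (2 ^ (s + 2))))) ^ 5 * 2 powr (- 3/2 * (real s - 1))
        \<le> (2 powr (- 1/8)) ^ s" by real_asymp
    then have ev: "\<forall>\<^sub>F s in sequentially. sqrt (sqrt (real (2 ^ (s0 + s + 2)) * ln (real (2 ^ (s0 + s + 2))))) ^ 5
        * 2 powr (- 3/2 * (real (s0 + s) - 1)) \<le> (2 powr (- 1/8)) ^ (s0 + s)"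
      by (rule eventually_compose_filterlim) (rule filterlim_add_const_nat_at_top[THEN filterlim_cong[THEN iffD1, rotated -1]], auto simp: add.commute)
    have "summable (\<lambda>s. sqrt (2 * S) * (2 powr (- 1/8)) ^ s0 * (2 powr (- 1/8)) ^ s)"
      by (intro summable_mult summable_geometric) (simp add: powr_less_one)
    moreover have "\<forall>\<^sub>F s in sequentially. norm (f s) \<le> sqrt (2 * S) * (2 powr (- 1/8)) ^ s0 * (2 powr (- 1/8)) ^ s"
      using ev
    proof eventually_elim
      case (elim s)
      have "f s \<le> y (Suc (s0 + s)) ^ 5 * (sqrt (2 * S) * (2 powr (- 3/2 * real (s1 + s))))"
        unfolding f_def using qb[of "s1 + s"] y0 by (intro mult_left_mono) (auto simp: s0_def)
      also have "\<dots> = sqrt (2 * S) * (sqrt (sqrt (real (2 ^ (s0 + s + 2)) * ln (real (2 ^ (s0 + s + 2))))) ^ 5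
        * 2 powr (- 3/2 * (real (s0 + s) - 1)))"
        by (simp add: y_def nlog_def s0_def mult_ac)
      also have "\<dots> \<le> sqrt (2 * S) * (2 powr (- 1/8)) ^ (s0 + s)"
        using elim S0 by (intro mult_left_mono) auto
      finally have "f s \<le> sqrt (2 * S) * (2 powr (- 1/8)) ^ s0 * (2 powr (- 1/8)) ^ s"
        by (simp add: power_add mult.assoc)
      moreover have "f s \<ge> 0" unfolding f_def q_def using y0 by simp
      ultimately show ?case by simp
    qed
    ultimately show ?thesis by (rule summable_comparison_test_ev[rotated])
  qed
  have "(\<integral>\<^sup>+\<omega>. ennreal (\<bar>Z 1 1 \<omega>\<bar> ^ 5) \<partial>M) \<le> (\<integral>\<^sup>+\<omega>. ennreal (y s0 ^ 5)
      + (\<Sum>s. ennreal (y (Suc (s0 + s)) ^ 5) * indicator {x. \<bar>x\<bar> \<ge> y (s0 + s)} (Z 1 1 \<omega>)) \<partial>M)"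
    by (intro nn_integral_mono abs_power5_le_levels y0 ylim)
  also have "\<dots> = ennreal (y s0 ^ 5)
      + (\<Sum>s. \<integral>\<^sup>+\<omega>. ennreal (y (Suc (s0 + s)) ^ 5) * indicator {x. \<bar>x\<bar> \<ge> y (s0 + s)} (Z 1 1 \<omega>) \<partial>M)"
    by (subst nn_integral_add, simp, simp, subst nn_integral_suminf) (auto simp: emeasure_space_1)
  also have "(\<lambda>s. \<integral>\<^sup>+\<omega>. ennreal (y (Suc (s0 + s)) ^ 5) * indicator {x. \<bar>x\<bar> \<ge> y (s0 + s)} (Z 1 1 \<omega>) \<partial>M) = (\<lambda>s. ennreal (f s))"
  proof
    fix s
    have "(\<integral>\<^sup>+\<omega>. ennreal (y (Suc (s0 + s)) ^ 5) * indicator {x. \<bar>x\<bar> \<ge> y (s0 + s)} (Z 1 1 \<omega>) \<partial>M)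
      = (\<integral>\<^sup>+\<omega>. ennreal (y (Suc (s0 + s)) ^ 5) * indicator {\<omega>\<in>space M. \<bar>Z 1 1 \<omega>\<bar> \<ge> y (s0 + s)} \<omega> \<partial>M)"
      by (intro nn_integral_cong) (auto simp: indicator_def)
    also have "\<dots> = ennreal (y (Suc (s0 + s)) ^ 5) * emeasure M {\<omega>\<in>space M. \<bar>Z 1 1 \<omega>\<bar> \<ge> y (s0 + s)}"
      by (rule nn_integral_cmult_indicator) measurable
    also have "\<dots> = ennreal (f s)"
      using y0 by (simp add: f_def q_def emeasure_eq_measure ennreal_mult)
    finally show "(\<integral>\<^sup>+\<omega>. ennreal (y (Suc (s0 + s)) ^ 5) * indicator {x. \<bar>x\<bar> \<ge> y (s0 + s)} (Z 1 1 \<omega>) \<partial>M) = ennreal (f s)" .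
  qed
  also have "(\<Sum>s. ennreal (f s)) = ennreal (suminf f)"
    by (intro suminf_ennreal2 fsum) (simp add: f_def q_def y0)
  finally have "(\<integral>\<^sup>+\<omega>. ennreal (\<bar>Z 1 1 \<omega>\<bar> ^ 5) \<partial>M) < \<infinity>"
    by (rule le_less_trans) (simp add: ennreal_add_eq_top less_top)
  then show ?thesis by (intro integrableI_bounded) auto
qed

end

subsection \<open>The limit of the coherence\<close>

lemma sample_corr_affine:
  assumes "\<sigma> > 0" "\<And>k i. X k i \<omega> = \<sigma> * Z k i \<omega> + \<mu>" "n > 0"
  shows "sample_corr X n i j \<omega> = sample_corr Z n i j \<omega>"
proof -
  have mean: "sample_mean X n i \<omega> = \<sigma> * sample_mean Z n i \<omega> + \<mu>" for i
    unfolding sample_mean_def using assms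
    by (simp add: sum.distrib sum_distrib_left[symmetric] add_divide_distrib)
  have dev: "X k i \<omega> - sample_mean X n i \<omega> = \<sigma> * (Z k i \<omega> - sample_mean Z n i \<omega>)" for k i
    using assms(2) by (simp add: mean algebra_simps)
  have num: "(\<Sum>k=1..n. (X k i \<omega> - sample_mean X n i \<omega>) * (X k j \<omega> - sample_mean X n j \<omega>))
    = \<sigma>\<^sup>2 * (\<Sum>k=1..n. (Z k i \<omega> - sample_mean Z n i \<omega>) * (Z k j \<omega> - sample_mean Z n j \<omega>))"
    unfolding dev by (simp add: sum_distrib_left power2_eq_square mult_ac)
  have den: "sqrt (\<Sum>k=1..n. (X k i \<omega> - sample_mean X n i \<omega>)\<^sup>2)
    = \<sigma> * sqrt (\<Sum>k=1..n. (Z k i \<omega> - sample_mean Z n i \<omega>)\<^sup>2)" for i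
    unfolding dev using assms(1)
    by (simp add: power_mult_distrib sum_distrib_left[symmetric] real_sqrt_mult)
  show ?thesis
    unfolding sample_corr_def num den using assms(1) by (simp add: power2_eq_square)
qed

lemma sample_corr_sums:
  assumes "n > 0"
  shows "sample_corr Z n i j \<omega> =
    ((\<Sum>k=1..n. Z k i \<omega> * Z k j \<omega>) - (\<Sum>k=1..n. Z k i \<omega>) * (\<Sum>k=1..n. Z k j \<omega>) / n) /
    (sqrt ((\<Sum>k=1..n. (Z k i \<omega>)\<^sup>2) - (\<Sum>k=1..n. Z k i \<omega>)\<^sup>2 / n) *
     sqrt ((\<Sum>k=1..n. (Z k j \<omega>)\<^sup>2) - (\<Sum>k=1..n. Z k j \<omega>)\<^sup>2 / n))"
proof -
  have cov: "(\<Sum>k=1..n. (Z k i \<omega> - sample_mean Z n i \<omega>) * (Z k j \<omega> - sample_mean Z n j \<omega>))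
    = (\<Sum>k=1..n. Z k i \<omega> * Z k j \<omega>) - (\<Sum>k=1..n. Z k i \<omega>) * (\<Sum>k=1..n. Z k j \<omega>) / n" for i j
  proof -
    let ?m = "sample_mean Z n"
    have "(\<Sum>k=1..n. (Z k i \<omega> - ?m i \<omega>) * (Z k j \<omega> - ?m j \<omega>))
      = (\<Sum>k=1..n. Z k i \<omega> * Z k j \<omega> - ?m j \<omega> * Z k i \<omega> - ?m i \<omega> * Z k j \<omega> + ?m i \<omega> * ?m j \<omega>)"
      by (intro sum.cong refl) (simp add: algebra_simps)
    also have "\<dots> = (\<Sum>k=1..n. Z k i \<omega> * Z k j \<omega>) - ?m j \<omega> * (\<Sum>k=1..n. Z k i \<omega>)
      - ?m i \<omega> * (\<Sum>k=1..n. Z k j \<omega>) + n * (?m i \<omega> * ?m j \<omega>)"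
      by (simp add: sum.distrib sum_subtractf sum_distrib_left[symmetric])
    also have "\<dots> = (\<Sum>k=1..n. Z k i \<omega> * Z k j \<omega>) - (\<Sum>k=1..n. Z k i \<omega>) * (\<Sum>k=1..n. Z k j \<omega>) / n"
      unfolding sample_mean_def using assms by (simp add: field_simps)
    finally show ?thesis .
  qed
  have var: "(\<Sum>k=1..n. (Z k i \<omega> - sample_mean Z n i \<omega>)\<^sup>2)
    = (\<Sum>k=1..n. (Z k i \<omega>)\<^sup>2) - (\<Sum>k=1..n. Z k i \<omega>)\<^sup>2 / n" for i
    using cov[of i i] by (simp add: power2_eq_square)
  show ?thesis unfolding sample_corr_def cov var ..
qed

lemma coherence_le:
  assumes "\<And>i j. 1 \<le> i \<Longrightarrow> i < j \<Longrightarrow> j \<le> p \<Longrightarrow> \<bar>sample_corr X n i j \<omega>\<bar> \<le> b" "0 \<le> b"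
  shows "coherence X n p \<omega> \<le> b"
proof -
  let ?S = "{\<bar>sample_corr X n i j \<omega>\<bar> | i j. 1 \<le> i \<and> i < j \<and> j \<le> p}"
  have "?S \<subseteq> (\<lambda>(i, j). \<bar>sample_corr X n i j \<omega>\<bar>) ` ({1..p} \<times> {1..p})" by auto
  then have "finite ?S" by (rule finite_subset) simp
  then show ?thesis unfolding coherence_def using assms by (subst Max_le_iff) auto
qed

lemma coherence_ge:
  assumes "1 \<le> i" "i < j" "j \<le> p"
  shows "\<bar>sample_corr X n i j \<omega>\<bar> \<le> coherence X n p \<omega>"
proof -
  let ?S = "{\<bar>sample_corr X n i j \<omega>\<bar> | i j. 1 \<le> i \<and> i < j \<and> j \<le> p}"
  have "?S \<subseteq> (\<lambda>(i, j). \<bar>sample_corr X n i j \<omega>\<bar>) ` ({1..p} \<times> {1..p})" by auto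
  then have "finite ?S" by (rule finite_subset) simp
  then show ?thesis unfolding coherence_def using assms by (intro Max_ge) auto
qed

text \<open>\<open>E\<close> is a set of tolerances accumulating at \<open>0\<close>: the almost sure bounds are only available
  for countably many tolerances at once.\<close>

lemma coherence_limit_deterministic:
  fixes Z :: "nat \<Rightarrow> nat \<Rightarrow> 'a \<Rightarrow> real" and p :: "nat \<Rightarrow> nat" and D :: nat and C :: real
  assumes pD: "\<And>n. n \<ge> 1 \<Longrightarrow> p n \<le> D * n" "\<And>n. n \<ge> 1 \<Longrightarrow> n \<le> D * p n"
    and rows: "\<forall>\<^sub>F n in sequentially. \<forall>i. 1 \<le> i \<longrightarrow> i \<le> D * n \<longrightarrow> \<bar>\<Sum>k=1..n. Z k i \<omega>\<bar> < 5 * nlog n"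
    and sq: "\<forall>\<^sub>F n in sequentially. \<forall>i. 1 \<le> i \<longrightarrow> i \<le> D * n \<longrightarrow>
      \<bar>(\<Sum>k=1..n. (Z k i \<omega>)\<^sup>2) - real n\<bar> < C * nlog n * real n powr (9/20)"
    and up: "\<And>\<epsilon>. \<epsilon> \<in> E \<Longrightarrow> \<forall>\<^sub>F n in sequentially. \<forall>i j. 1 \<le> i \<longrightarrow> i < j \<longrightarrow> j \<le> D * n \<longrightarrow>
      \<bar>\<Sum>k=1..n. Z k i \<omega> * Z k j \<omega>\<bar> \<le> (2 + \<epsilon>) * nlog n"
    and lo: "\<And>\<epsilon>. \<epsilon> \<in> E \<Longrightarrow> \<forall>\<^sub>F n in sequentially. \<forall>q. n \<le> D * q \<longrightarrow>
      (\<exists>i j. 1 \<le> i \<and> i < j \<and> j \<le> q \<and> j \<le> D * n \<and> (2 - \<epsilon>) * nlog n \<le> \<bar>\<Sum>k=1..n. Z k i \<omega> * Z k j \<omega>\<bar>)"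
    and E: "\<And>\<delta>::real. \<delta> > 0 \<Longrightarrow> \<exists>\<epsilon>\<in>E. 0 < \<epsilon> \<and> \<epsilon> < \<delta>"
  shows "(\<lambda>n. sqrt (real n / ln (real n)) * coherence Z n (p n) \<omega>) \<longlonglongrightarrow> 2"
proof -
  \<comment> \<open>Numerator: one \<epsilon> from the sum of products and one from centring by the
    sample means. Denominator: one from the sum of squares and one from centring. The bound 1/4
    keeps 1 - 2 \<epsilon> positive.\<close>
  have lim: "\<forall>\<^sub>F n in sequentially. (2 - 2 * \<epsilon>) / (1 + 2 * \<epsilon>) \<le> sqrt (real n / ln (real n)) * coherence Z n (p n) \<omega>
    \<and> sqrt (real n / ln (real n)) * coherence Z n (p n) \<omega> \<le> (2 + 2 * \<epsilon>) / (1 - 2 * \<epsilon>)"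
    if \<epsilon>: "\<epsilon> \<in> E" "0 < \<epsilon>" "\<epsilon> < 1/4" for \<epsilon>
  proof -
    \<comment> \<open>The centring term is at most (5 a(n))^2 / n = 25 ln n, which is negligible
      against both a(n) and n.\<close>
    have "(\<lambda>n. 25 * (nlog n)\<^sup>2 / real n / nlog n) \<longlonglongrightarrow> 0" unfolding nlog_def by real_asymp
    then have e1: "\<forall>\<^sub>F n in sequentially. 25 * (nlog n)\<^sup>2 / real n / nlog n < \<epsilon>"
      using \<epsilon> by (intro order_tendstoD) auto
    have "(\<lambda>n. 25 * (nlog n)\<^sup>2 / real n / real n) \<longlonglongrightarrow> 0" unfolding nlog_def by real_asymp
    then have e2: "\<forall>\<^sub>F n in sequentially. 25 * (nlog n)\<^sup>2 / real n / real n < \<epsilon>"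
      using \<epsilon> by (intro order_tendstoD) auto
    have "(\<lambda>n. C * (nlog n * real n powr (9/20) / real n)) \<longlonglongrightarrow> C * 0"
      unfolding nlog_def by (intro tendsto_mult_left) real_asymp
    then have e3: "\<forall>\<^sub>F n in sequentially. C * (nlog n * real n powr (9/20) / real n) < \<epsilon>"
      using \<epsilon> by (intro order_tendstoD) auto
    show ?thesis
      using rows sq up[OF \<epsilon>(1)] lo[OF \<epsilon>(1)] e1 e2 e3 eventually_gt_at_top[of 1]
    proof eventually_elim
      case (elim n)
      define R where "R i = (\<Sum>k=1..n. Z k i \<omega>)" for i
      define S where "S i j = (\<Sum>k=1..n. Z k i \<omega> * Z k j \<omega>)" for i j
      define V where "V i = (\<Sum>k=1..n. (Z k i \<omega>)\<^sup>2) - (R i)\<^sup>2 / n" for i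
      have n: "real n > 1" using elim(8) by simp
      have np: "nlog n > 0" using n by (simp add: nlog_def)
      have RR: "\<bar>R i * R j / n\<bar> \<le> 25 * (nlog n)\<^sup>2 / real n" if "1 \<le> i" "i \<le> D * n" "1 \<le> j" "j \<le> D * n" for i j
      proof -
        have "\<bar>R i\<bar> \<le> 5 * nlog n" "\<bar>R j\<bar> \<le> 5 * nlog n"
          using elim(1) that unfolding R_def by (auto intro: less_imp_le)
        then have "\<bar>R i\<bar> * \<bar>R j\<bar> \<le> (5 * nlog n) * (5 * nlog n)" by (intro mult_mono) auto
        then show ?thesis using n by (simp add: abs_mult power2_eq_square divide_right_mono)
      qed
      have RRS: "\<bar>R i * R j / n\<bar> \<le> \<epsilon> * nlog n" and RRn: "\<bar>R i * R j / n\<bar> \<le> \<epsilon> * n"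
        if "1 \<le> i" "i \<le> D * n" "1 \<le> j" "j \<le> D * n" for i j
      proof -
        have "25 * (nlog n)\<^sup>2 / real n < \<epsilon> * nlog n" using elim(5) np by (subst (asm) pos_divide_less_eq) auto
        then show "\<bar>R i * R j / n\<bar> \<le> \<epsilon> * nlog n" using RR[OF that] by linarith
        have "25 * (nlog n)\<^sup>2 / real n < \<epsilon> * n" using elim(6) n by (subst (asm) pos_divide_less_eq) auto
        then show "\<bar>R i * R j / n\<bar> \<le> \<epsilon> * n" using RR[OF that] by linarith
      qed
      have V: "(1 - 2 * \<epsilon>) * n \<le> V i" "V i \<le> (1 + 2 * \<epsilon>) * n" if i: "1 \<le> i" "i \<le> D * n" for i
      proof -
        have "C * (nlog n * real n powr (9/20)) / real n < \<epsilon>" using elim(7) by simp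
        then have "C * nlog n * real n powr (9/20) < \<epsilon> * n" using n by (simp add: pos_divide_less_eq mult.assoc)
        moreover have "\<bar>(\<Sum>k=1..n. (Z k i \<omega>)\<^sup>2) - real n\<bar> < C * nlog n * real n powr (9/20)" using elim(2) i by blast
        moreover have "\<bar>(R i)\<^sup>2 / n\<bar> \<le> \<epsilon> * n" using RRn[OF i i] by (simp add: power2_eq_square)
        ultimately have "\<bar>V i - n\<bar> \<le> 2 * (\<epsilon> * n)" unfolding V_def by linarith
        then show "(1 - 2 * \<epsilon>) * n \<le> V i" "V i \<le> (1 + 2 * \<epsilon>) * n"
          by (simp_all add: algebra_simps abs_le_iff)
      qed
      have corr: "sample_corr Z n i j \<omega> = (S i j - R i * R j / n) / (sqrt (V i) * sqrt (V j))" for i j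
        unfolding S_def R_def V_def using n by (intro sample_corr_sums) simp
      have den: "(1 - 2 * \<epsilon>) * n \<le> sqrt (V i) * sqrt (V j)" "sqrt (V i) * sqrt (V j) \<le> (1 + 2 * \<epsilon>) * n"
        if i: "1 \<le> i" "i \<le> D * n" and j: "1 \<le> j" "j \<le> D * n" for i j
      proof -
        have c0: "(1 - 2 * \<epsilon>) * n > 0" using \<epsilon> n by simp
        then have "sqrt ((1 - 2 * \<epsilon>) * n) * sqrt ((1 - 2 * \<epsilon>) * n) \<le> sqrt (V i) * sqrt (V j)"
          using V(1)[OF i] V(1)[OF j] by (intro mult_mono real_sqrt_le_mono) auto
        then show "(1 - 2 * \<epsilon>) * n \<le> sqrt (V i) * sqrt (V j)" using c0 by simp
        have "sqrt (V i) * sqrt (V j) \<le> sqrt ((1 + 2 * \<epsilon>) * n) * sqrt ((1 + 2 * \<epsilon>) * n)"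
          using V[OF i] V[OF j] c0 \<epsilon> by (intro mult_mono real_sqrt_le_mono real_sqrt_ge_zero) auto
        then show "sqrt (V i) * sqrt (V j) \<le> (1 + 2 * \<epsilon>) * n" using \<epsilon> n by simp
      qed
      have scale: "sqrt (real n / ln (real n)) * (nlog n / n) = 1"
        using n by (simp add: nlog_def real_sqrt_divide real_sqrt_mult)
      have scale0: "sqrt (real n / ln (real n)) \<ge> 0" using n by simp
      have n1: "n \<ge> 1" using elim(8) by simp
      have "coherence Z n (p n) \<omega> \<le> (2 + 2 * \<epsilon>) / (1 - 2 * \<epsilon>) * (nlog n / n)"
      proof (rule coherence_le)
        fix i j assume ij: "1 \<le> i" "i < j" "j \<le> p n"
        then have i: "1 \<le> i" "i \<le> D * n" and j: "1 \<le> j" "j \<le> D * n" using pD(1)[OF n1] by auto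
        have "\<bar>S i j\<bar> \<le> (2 + \<epsilon>) * nlog n" using elim(3) ij(1,2) j unfolding S_def by blast
        then have "\<bar>S i j - R i * R j / n\<bar> \<le> (2 + \<epsilon>) * nlog n + \<epsilon> * nlog n"
          using RRS[OF i j] by linarith
        then have num: "\<bar>S i j - R i * R j / n\<bar> \<le> (2 + 2 * \<epsilon>) * nlog n" by (simp add: algebra_simps)
        have d0: "(1 - 2 * \<epsilon>) * n > 0" using \<epsilon> n by simp
        have "\<bar>sample_corr Z n i j \<omega>\<bar> = \<bar>S i j - R i * R j / n\<bar> / (sqrt (V i) * sqrt (V j))"
          unfolding corr abs_divide using den(1)[OF i j] d0 by simp
        also have "\<dots> \<le> (2 + 2 * \<epsilon>) * nlog n / ((1 - 2 * \<epsilon>) * n)"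
          using num den(1)[OF i j] d0 \<epsilon> np by (intro frac_le) auto
        finally show "\<bar>sample_corr Z n i j \<omega>\<bar> \<le> (2 + 2 * \<epsilon>) / (1 - 2 * \<epsilon>) * (nlog n / n)" by simp
      qed (use \<epsilon> np n in auto)
      then have "sqrt (real n / ln (real n)) * coherence Z n (p n) \<omega>
          \<le> sqrt (real n / ln (real n)) * ((2 + 2 * \<epsilon>) / (1 - 2 * \<epsilon>) * (nlog n / n))"
        using scale0 by (rule mult_left_mono)
      also have "\<dots> = (2 + 2 * \<epsilon>) / (1 - 2 * \<epsilon>) * (sqrt (real n / ln (real n)) * (nlog n / n))"
        by (simp only: mult.left_commute)
      also have "\<dots> = (2 + 2 * \<epsilon>) / (1 - 2 * \<epsilon>)" by (simp only: scale mult_1_right)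
      finally have upper: "sqrt (real n / ln (real n)) * coherence Z n (p n) \<omega> \<le> (2 + 2 * \<epsilon>) / (1 - 2 * \<epsilon>)" .
      obtain i j where ij: "1 \<le> i" "i < j" "j \<le> p n" "j \<le> D * n"
        and Sij: "(2 - \<epsilon>) * nlog n \<le> \<bar>S i j\<bar>"
        using elim(4) pD(2)[OF n1] unfolding S_def by blast
      have i: "1 \<le> i" "i \<le> D * n" and j: "1 \<le> j" "j \<le> D * n" using ij by auto
      have num: "(2 - 2 * \<epsilon>) * nlog n \<le> \<bar>S i j - R i * R j / n\<bar>"
      proof -
        have "(2 - \<epsilon>) * nlog n - \<epsilon> * nlog n \<le> \<bar>S i j - R i * R j / n\<bar>"
          using RRS[OF i j] Sij by linarith
        then show ?thesis by (simp add: algebra_simps)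
      qed
      have d0: "(1 - 2 * \<epsilon>) * n > 0" using \<epsilon> n by simp
      have "(2 - 2 * \<epsilon>) / (1 + 2 * \<epsilon>) * (nlog n / n) = (2 - 2 * \<epsilon>) * nlog n / ((1 + 2 * \<epsilon>) * n)" by simp
      also have "\<dots> \<le> \<bar>S i j - R i * R j / n\<bar> / (sqrt (V i) * sqrt (V j))"
        using num den[OF i j] d0 \<epsilon> np by (intro frac_le) auto
      also have "\<dots> = \<bar>sample_corr Z n i j \<omega>\<bar>"
        unfolding corr abs_divide using den(1)[OF i j] d0 by simp
      also have "\<dots> \<le> coherence Z n (p n) \<omega>" by (rule coherence_ge[OF ij(1-3)])
      finally have "sqrt (real n / ln (real n)) * ((2 - 2 * \<epsilon>) / (1 + 2 * \<epsilon>) * (nlog n / n))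
          \<le> sqrt (real n / ln (real n)) * coherence Z n (p n) \<omega>"
        using scale0 by (rule mult_left_mono)
      moreover have "sqrt (real n / ln (real n)) * ((2 - 2 * \<epsilon>) / (1 + 2 * \<epsilon>) * (nlog n / n))
          = (2 - 2 * \<epsilon>) / (1 + 2 * \<epsilon>)"
        by (simp only: mult.left_commute[of "sqrt _"] scale mult_1_right)
      ultimately show ?case using upper by simp
    qed
  qed
  show ?thesis
  proof (rule order_tendstoI)
    fix a :: real assume "a < 2"
    have "((\<lambda>\<epsilon>. (2 - 2 * \<epsilon>) / (1 + 2 * \<epsilon>)) \<longlongrightarrow> (2 - 2 * 0) / (1 + 2 * 0)) (at_right (0::real))"
      by (intro tendsto_intros) auto
    then have "\<forall>\<^sub>F \<epsilon> in at_right (0::real). a < (2 - 2 * \<epsilon>) / (1 + 2 * \<epsilon>)"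
      using \<open>a < 2\<close> by (intro order_tendstoD) auto
    then obtain \<delta> where \<delta>: "\<delta> > 0" "\<And>\<epsilon>. 0 < \<epsilon> \<Longrightarrow> \<epsilon> < \<delta> \<Longrightarrow> a < (2 - 2 * \<epsilon>) / (1 + 2 * \<epsilon>)"
      unfolding eventually_at_right_field by auto
    obtain \<epsilon> where "\<epsilon> \<in> E" "0 < \<epsilon>" "\<epsilon> < min \<delta> (1/4)" using E[of "min \<delta> (1/4)"] \<delta>(1) by auto
    then show "\<forall>\<^sub>F n in sequentially. a < sqrt (real n / ln (real n)) * coherence Z n (p n) \<omega>"
      using lim[of \<epsilon>] \<delta>(2)[of \<epsilon>] by (auto elim!: eventually_mono)
  next
    fix a :: real assume "2 < a"
    have "((\<lambda>\<epsilon>. (2 + 2 * \<epsilon>) / (1 - 2 * \<epsilon>)) \<longlongrightarrow> (2 + 2 * 0) / (1 - 2 * 0)) (at_right (0::real))"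
      by (intro tendsto_intros) auto
    then have "\<forall>\<^sub>F \<epsilon> in at_right (0::real). (2 + 2 * \<epsilon>) / (1 - 2 * \<epsilon>) < a"
      using \<open>2 < a\<close> by (intro order_tendstoD) auto
    then obtain \<delta> where \<delta>: "\<delta> > 0" "\<And>\<epsilon>. 0 < \<epsilon> \<Longrightarrow> \<epsilon> < \<delta> \<Longrightarrow> (2 + 2 * \<epsilon>) / (1 - 2 * \<epsilon>) < a"
      unfolding eventually_at_right_field by auto
    obtain \<epsilon> where "\<epsilon> \<in> E" "0 < \<epsilon>" "\<epsilon> < min \<delta> (1/4)" using E[of "min \<delta> (1/4)"] \<delta>(1) by auto
    then show "\<forall>\<^sub>F n in sequentially. sqrt (real n / ln (real n)) * coherence Z n (p n) \<omega> < a"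
      using lim[of \<epsilon>] \<delta>(2)[of \<epsilon>] by (auto elim!: eventually_mono)
  qed
qed

lemma (in std_array) AE_coherence_limit:
  fixes p :: "nat \<Rightarrow> nat" and D :: nat
  assumes "\<And>n. n \<ge> 1 \<Longrightarrow> p n \<le> D * n" "\<And>n. n \<ge> 1 \<Longrightarrow> n \<le> D * p n"
    and "AE \<omega> in M. small_products D \<omega>"
  shows "AE \<omega> in M. (\<lambda>n. sqrt (real n / ln (real n)) * coherence Z n (p n) \<omega>) \<longlonglongrightarrow> 2"
proof -
  have D: "D \<ge> 1" using assms(2)[of 1] by (cases D) auto
  \<comment> \<open>Countably many tolerances tending to 0, all below 1 as the lower bound
    requires.\<close>
  define e where "e r = 1 / (real r + 2)" for r :: nat
  have e: "0 < e r" "e r < 1" for r by (auto simp: e_def)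
  have "AE \<omega> in M. \<forall>r. small_products D \<omega> \<longrightarrow> (\<forall>\<^sub>F n in sequentially. \<forall>i j. 1 \<le> i \<longrightarrow> i < j \<longrightarrow> j \<le> D * n \<longrightarrow>
    \<bar>\<Sum>k=1..n. Y k i j \<omega>\<bar> \<le> (2 + e r) * nlog n)"
    unfolding AE_all_countable by (intro allI AE_S_upper e)
  moreover have "AE \<omega> in M. \<forall>r. small_products D \<omega> \<longrightarrow> (\<forall>\<^sub>F n in sequentially. \<forall>q. n \<le> D * q \<longrightarrow>
    (\<exists>i j. 1 \<le> i \<and> i < j \<and> j \<le> q \<and> j \<le> D * n \<and> (2 - e r) * nlog n \<le> \<bar>\<Sum>k=1..n. Y k i j \<omega>\<bar>))"
    unfolding AE_all_countable by (intro allI AE_S_lower e D)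
  ultimately show ?thesis
    using assms(3) AE_row_sums[of D] AE_row_squares[of D]
  proof eventually_elim
    case (elim \<omega>)
    show ?case
    proof (rule coherence_limit_deterministic[where E="range e" and Z=Z and \<omega>=\<omega> and D=D and p=p, OF assms(1,2) elim(4,5)])
      show "\<exists>\<epsilon>\<in>range e. 0 < \<epsilon> \<and> \<epsilon> < \<delta>" if \<delta>: "\<delta> > 0" for \<delta>
      proof -
        obtain r where "inverse (real (Suc r)) < \<delta>" using reals_Archimedean[OF \<delta>] by auto
        then have "e r < \<delta>"
          by (rule le_less_trans[rotated]) (simp add: e_def field_simps)
        then show ?thesis using e by auto
      qed
    qed (use elim(1-3) in auto)
  qed
qed

section \<open>Reduction to a standardised array\<close>

lemma (in iid_array) variance_pos:
  assumes "integrable M (\<lambda>\<omega>. (Z 1 1 \<omega>)\<^sup>2)" "\<not> (\<exists>c. AE \<omega> in M. Z 1 1 \<omega> = c)"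
  shows "variance (Z 1 1) > 0"
proof -
  have i1: "integrable M (Z 1 1)" by (rule square_integrable_imp_integrable[OF _ assms(1)]) simp
  have i2: "integrable M (\<lambda>\<omega>. (Z 1 1 \<omega> - expectation (Z 1 1))\<^sup>2)"
    using assms(1) i1 by (simp add: power2_diff)
  have "variance (Z 1 1) \<noteq> 0"
  proof
    assume "variance (Z 1 1) = 0"
    then have "AE \<omega> in M. (Z 1 1 \<omega> - expectation (Z 1 1))\<^sup>2 = 0"
      using i2 by (subst (asm) integral_nonneg_eq_0_iff_AE) auto
    then have "AE \<omega> in M. Z 1 1 \<omega> = expectation (Z 1 1)" by eventually_elim simp
    then show False using assms(2) by blast
  qed
  moreover have "variance (Z 1 1) \<ge> 0" by (intro integral_nonneg_AE) auto
  ultimately show ?thesis by linarith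
qed

lemma (in iid_array) iid_array_affine:
  "iid_array M (\<lambda>k i \<omega>. (Z k i \<omega> - \<mu>) / \<sigma>)"
proof unfold_locales
  have "indep_vars (\<lambda>_. borel) (\<lambda>x \<omega>. (entry x \<omega> - \<mu>) / \<sigma>) ({1..} \<times> {1..})"
    by (rule indep_vars_compose2[OF indep]) measurable
  moreover have "(\<lambda>x \<omega>. (entry x \<omega> - \<mu>) / \<sigma>) = (\<lambda>(k, i) \<omega>. (Z k i \<omega> - \<mu>) / \<sigma>)"
    by (auto simp: fun_eq_iff)
  ultimately show "indep_vars (\<lambda>_. borel) (\<lambda>(k, i) \<omega>. (Z k i \<omega> - \<mu>) / \<sigma>) ({1..} \<times> {1..})" by simp
  fix k i :: nat assume ki: "1 \<le> k" "1 \<le> i"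
  have "distr M borel (\<lambda>\<omega>. (Z k i \<omega> - \<mu>) / \<sigma>) = distr (distr M borel (Z k i)) borel (\<lambda>x. (x - \<mu>) / \<sigma>)" for k i
    by (subst distr_distr) (auto simp: comp_def)
  then show "distr M borel (\<lambda>\<omega>. (Z k i \<omega> - \<mu>) / \<sigma>) = distr M borel (\<lambda>\<omega>. (Z 1 1 \<omega> - \<mu>) / \<sigma>)"
    using ident[OF ki] by simp
qed measurable

lemma (in iid_array) std_array_standardise:
  assumes i5: "integrable M (\<lambda>\<omega>. \<bar>Z 1 1 \<omega>\<bar> ^ 5)"
    and "\<not> (\<exists>c. AE \<omega> in M. Z 1 1 \<omega> = c)"
    and \<mu>: "\<mu> = expectation (Z 1 1)" and \<sigma>: "\<sigma> = sqrt (variance (Z 1 1))"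
  shows "std_array M (\<lambda>k i \<omega>. (Z k i \<omega> - \<mu>) / \<sigma>)" and "\<sigma> > 0"
proof -
  have i2: "integrable M (\<lambda>\<omega>. (Z 1 1 \<omega>)\<^sup>2)"
  proof (rule Bochner_Integration.integrable_bound[of _ "\<lambda>\<omega>. 1 + \<bar>Z 1 1 \<omega>\<bar> ^ 5"])
    have "x\<^sup>2 \<le> 1 + \<bar>x\<bar> ^ 5" for x :: real
    proof (cases "\<bar>x\<bar> \<le> 1")
      case True
      then have "\<bar>x\<bar>\<^sup>2 \<le> 1" by (intro power_le_one) auto
      moreover have "0 \<le> \<bar>x\<bar> ^ 5" by simp
      ultimately show ?thesis unfolding power2_abs by linarith
    next
      case False
      then have "\<bar>x\<bar>\<^sup>2 \<le> \<bar>x\<bar> ^ 5" by (intro power_increasing) auto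
      then show ?thesis unfolding power2_abs by linarith
    qed
    then show "AE \<omega> in M. norm ((Z 1 1 \<omega>)\<^sup>2) \<le> norm (1 + \<bar>Z 1 1 \<omega>\<bar> ^ 5)" by simp
  qed (use i5 in auto)
  have i1: "integrable M (Z 1 1)" by (rule square_integrable_imp_integrable[OF _ i2]) simp
  have v: "variance (Z 1 1) > 0" by (rule variance_pos[OF i2 assms(2)])
  then show \<sigma>0: "\<sigma> > 0" by (simp add: \<sigma>)
  interpret W: iid_array M "\<lambda>k i \<omega>. (Z k i \<omega> - \<mu>) / \<sigma>" by (rule iid_array_affine)
  show "std_array M (\<lambda>k i \<omega>. (Z k i \<omega> - \<mu>) / \<sigma>)"
  proof unfold_locales
    \<comment> \<open>From |x - \<mu>| <= 2 max(|x|, |\<mu>|), with 32 = 2^5.\<close>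
    have b: "\<bar>(x - \<mu>) / \<sigma>\<bar> ^ 5 \<le> 32 * (\<bar>x\<bar> ^ 5 + \<bar>\<mu>\<bar> ^ 5) / \<sigma> ^ 5" for x
    proof -
      have "\<bar>x - \<mu>\<bar> ^ 5 \<le> (2 * max \<bar>x\<bar> \<bar>\<mu>\<bar>) ^ 5" by (intro power_mono) auto
      also have "\<dots> = 32 * max \<bar>x\<bar> \<bar>\<mu>\<bar> ^ 5" by (simp add: power_mult_distrib)
      also have "max \<bar>x\<bar> \<bar>\<mu>\<bar> ^ 5 \<le> \<bar>x\<bar> ^ 5 + \<bar>\<mu>\<bar> ^ 5" by (auto simp: max_def)
      finally have "\<bar>x - \<mu>\<bar> ^ 5 \<le> 32 * (\<bar>x\<bar> ^ 5 + \<bar>\<mu>\<bar> ^ 5)" by simp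
      then show ?thesis using \<sigma>0 by (simp add: abs_divide power_divide divide_right_mono)
    qed
    show "integrable M (\<lambda>\<omega>. \<bar>(Z 1 1 \<omega> - \<mu>) / \<sigma>\<bar> ^ 5)"
    proof (rule Bochner_Integration.integrable_bound[of _ "\<lambda>\<omega>. 32 * (\<bar>Z 1 1 \<omega>\<bar> ^ 5 + \<bar>\<mu>\<bar> ^ 5) / \<sigma> ^ 5"])
      show "integrable M (\<lambda>\<omega>. 32 * (\<bar>Z 1 1 \<omega>\<bar> ^ 5 + \<bar>\<mu>\<bar> ^ 5) / \<sigma> ^ 5)" using i5 by simp
      show "AE \<omega> in M. norm (\<bar>(Z 1 1 \<omega> - \<mu>) / \<sigma>\<bar> ^ 5) \<le> norm (32 * (\<bar>Z 1 1 \<omega>\<bar> ^ 5 + \<bar>\<mu>\<bar> ^ 5) / \<sigma> ^ 5)"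
        using order_trans[OF b abs_ge_self] by (intro AE_I2) simp
    qed simp
    show "expectation (\<lambda>\<omega>. (Z 1 1 \<omega> - \<mu>) / \<sigma>) = 0"
      using i1 by (simp add: \<mu> prob_space)
    have "expectation (\<lambda>\<omega>. ((Z 1 1 \<omega> - \<mu>) / \<sigma>)\<^sup>2) = variance (Z 1 1) / \<sigma>\<^sup>2"
      by (simp add: power_divide \<mu>)
    then show "expectation (\<lambda>\<omega>. ((Z 1 1 \<omega> - \<mu>) / \<sigma>)\<^sup>2) = 1" using v by (simp add: \<sigma>)
  qed
qed

theorem theorem2p4:
  fixes M :: "'a measure" and X :: "nat \<Rightarrow> nat \<Rightarrow> 'a \<Rightarrow> real" and p :: "nat \<Rightarrow> nat"
  assumes "prob_space M"
    and rv: "\<And>k i. X k i \<in> borel_measurable M"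
    and indep: "prob_space.indep_vars M (\<lambda>_. borel) (\<lambda>(k, i). X k i) ({1..} \<times> {1..})"
    and ident: "\<And>k i. k \<ge> 1 \<Longrightarrow> i \<ge> 1 \<Longrightarrow> distr M borel (X k i) = distr M borel (X 1 1)"
    and p_pos: "\<And>n. p n \<ge> 1"
    and p_ratio: "\<exists>c C. 0 < c \<and> c \<le> C \<and> (\<forall>n\<ge>1. c \<le> real n / real (p n) \<and> real n / real (p n) \<le> C)"
    and nondeg: "\<not> (\<exists>c. AE w in M. X 1 1 w = c)"
    and summ: "summable (\<lambda>n. measure M {w \<in> space M.
                   max_prod (X 1) n w \<ge> sqrt (real n * ln (real n))})"
  shows "AE w in M. ((\<lambda>n. sqrt (real n / ln (real n)) * coherence X n (p n) w) \<longlongrightarrow> 2) sequentially"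
proof -
  interpret prob_space M by fact
  interpret X: iid_array M X
    by unfold_locales (rule rv indep ident; assumption)+
  have summ': "summable (\<lambda>n. prob (X.exceed 1 {1..n} (nlog n)))"
  proof (rule summable_comparison_test'[OF summ])
    \<comment> \<open>For n at least 2 the scale is positive, and the event of the hypothesis
      coincides with \<open>X.exceed\<close>; summability ignores the first two terms.\<close>
    fix n :: nat assume "n \<ge> 2"
    then have "nlog n > 0" by (simp add: nlog_def)
    then show "norm (prob (X.exceed 1 {1..n} (nlog n)))
        \<le> prob {w \<in> space M. max_prod (X 1) n w \<ge> sqrt (real n * ln (real n))}"
      unfolding nlog_def[symmetric] by (simp add: X.exceed_def max_prod_ge_iff)
  qed
  define \<mu> where "\<mu> = expectation (X 1 1)"
  define \<sigma> where "\<sigma> = sqrt (variance (X 1 1))"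
  define Z where "Z = (\<lambda>k i w. (X k i w - \<mu>) / \<sigma>)"
  have \<sigma>: "\<sigma> > 0" and "std_array M Z"
    unfolding Z_def using X.std_array_standardise[OF X.integrable_power5[OF summ'] nondeg \<mu>_def \<sigma>_def] by auto
  then interpret Z: std_array M Z by simp
  have XZ: "X k i w = \<sigma> * Z k i w + \<mu>" for k i w using \<sigma> by (simp add: Z_def)
  obtain c C where c: "0 < c" and pc: "\<And>n. n \<ge> 1 \<Longrightarrow> c \<le> real n / real (p n)"
    and pC: "\<And>n. n \<ge> 1 \<Longrightarrow> real n / real (p n) \<le> C" using p_ratio by blast
  \<comment> \<open>One integer serves both directions, bounding \<open>p n\<close> by a multiple of
    \<open>n\<close> and \<open>n\<close> by a multiple of \<open>p n\<close>.\<close>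
  define D where "D = nat \<lceil>max (1 / c) C\<rceil>"
  have D: "1 / c \<le> real D" "C \<le> real D" unfolding D_def by linarith+
  have p1: "p n \<le> D * n" if "n \<ge> 1" for n
  proof -
    have pn: "real (p n) > 0" using p_pos[of n] by simp
    have "real (p n) \<le> 1 / c * real n" using pc[OF that] c pn by (simp add: field_simps)
    also have "\<dots> \<le> real D * real n" using D by (intro mult_right_mono) auto
    finally show ?thesis by (simp only: of_nat_mult[symmetric] of_nat_le_iff)
  qed
  have p2: "n \<le> D * p n" if "n \<ge> 1" for n
  proof -
    have pn: "real (p n) > 0" using p_pos[of n] by simp
    have "real n \<le> C * real (p n)" using pC[OF that] pn by (simp add: field_simps)
    also have "\<dots> \<le> real D * real (p n)" using D by (intro mult_right_mono) auto
    finally show ?thesis by (simp only: of_nat_mult[symmetric] of_nat_le_iff)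
  qed
  have "AE w in M. \<forall>r. \<forall>\<^sub>F n in sequentially. \<forall>k i j. 1 \<le> k \<longrightarrow> k \<le> n \<longrightarrow>
    1 \<le> i \<longrightarrow> i < j \<longrightarrow> j \<le> D * n \<longrightarrow> \<bar>X k i w * X k j w\<bar> \<le> inverse (real (Suc r)) * nlog n"
    unfolding AE_all_countable by (intro allI X.AE_small_products_uncentred summ') simp
  then have "AE w in M. Z.small_products D w"
    using Z.AE_entries_bounded[of D]
  proof eventually_elim
    case (elim w)
    show ?case unfolding Z.small_products_def
    proof (intro allI impI)
      fix \<epsilon> :: real assume \<epsilon>: "\<epsilon> > 0"
      then obtain r where r: "inverse (real (Suc r)) < \<epsilon> * \<sigma>\<^sup>2 / 2"
        using reals_Archimedean[of "\<epsilon> * \<sigma>\<^sup>2 / 2"] \<sigma> by auto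
      \<comment> \<open>The cost of centring a product: entries are at most n^(9/20) and therefore
        o(a(n)). Half of the tolerance goes here, the other half to the products of the given
        array.\<close>
      have "(\<lambda>n. 2 * \<bar>\<mu>\<bar> * \<sigma> * (real n powr (9/20) / nlog n) + \<mu>\<^sup>2 * (1 / nlog n)) \<longlonglongrightarrow> 2 * \<bar>\<mu>\<bar> * \<sigma> * 0 + \<mu>\<^sup>2 * 0"
        unfolding nlog_def by (intro tendsto_add tendsto_mult_left) real_asymp+
      then have ev: "\<forall>\<^sub>F n in sequentially. 2 * \<bar>\<mu>\<bar> * \<sigma> * (real n powr (9/20) / nlog n) + \<mu>\<^sup>2 * (1 / nlog n) < \<epsilon> * \<sigma>\<^sup>2 / 2"
        using \<epsilon> \<sigma> by (intro order_tendstoD) auto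
      from elim(1)[rule_format, of r] elim(2) ev eventually_ge_at_top[of 2]
      show "\<forall>\<^sub>F n in sequentially. \<forall>k i j. 1 \<le> k \<longrightarrow> k \<le> n \<longrightarrow>
        1 \<le> i \<longrightarrow> i < j \<longrightarrow> j \<le> D * n \<longrightarrow> \<bar>Z k i w * Z k j w\<bar> \<le> \<epsilon> * nlog n"
      proof (eventually_elim, intro allI impI)
        fix n k i j :: nat
        assume x: "\<forall>k i j. 1 \<le> k \<longrightarrow> k \<le> n \<longrightarrow> 1 \<le> i \<longrightarrow> i < j \<longrightarrow> j \<le> D * n \<longrightarrow>
            \<bar>X k i w * X k j w\<bar> \<le> inverse (real (Suc r)) * nlog n"
          and z: "\<forall>k i. 1 \<le> k \<longrightarrow> k \<le> n \<longrightarrow> 1 \<le> i \<longrightarrow> i \<le> D * n \<longrightarrow> \<bar>Z k i w\<bar> \<le> real n powr (9/20)"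
          and small: "2 * \<bar>\<mu>\<bar> * \<sigma> * (real n powr (9/20) / nlog n) + \<mu>\<^sup>2 * (1 / nlog n) < \<epsilon> * \<sigma>\<^sup>2 / 2"
          and n: "2 \<le> n" and k: "1 \<le> k" "k \<le> n" and ij: "1 \<le> i" "i < j" "j \<le> D * n"
        have np: "nlog n > 0" using n by (simp add: nlog_def)
        let ?b = "real n powr (9/20)"
        have "(2 * \<bar>\<mu>\<bar> * \<sigma> * (?b / nlog n) + \<mu>\<^sup>2 * (1 / nlog n)) * nlog n \<le> \<epsilon> * \<sigma>\<^sup>2 / 2 * nlog n"
          using small np by (intro mult_right_mono) auto
        then have s: "2 * \<bar>\<mu>\<bar> * \<sigma> * ?b + \<mu>\<^sup>2 \<le> \<epsilon> * \<sigma>\<^sup>2 / 2 * nlog n"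
          using np by (simp add: distrib_right)
        have xx: "\<bar>X k i w * X k j w\<bar> \<le> \<epsilon> * \<sigma>\<^sup>2 / 2 * nlog n"
        proof -
          have "\<bar>X k i w * X k j w\<bar> \<le> inverse (real (Suc r)) * nlog n" using x k ij by blast
          also have "\<dots> \<le> \<epsilon> * \<sigma>\<^sup>2 / 2 * nlog n" using r np by (intro mult_right_mono) auto
          finally show ?thesis .
        qed
        have "\<bar>Z k i w + Z k j w\<bar> \<le> ?b + ?b"
          using z[rule_format, of k i] z[rule_format, of k j] k ij by linarith
        then have "\<bar>\<mu>\<bar> * \<sigma> * \<bar>Z k i w + Z k j w\<bar> \<le> \<bar>\<mu>\<bar> * \<sigma> * (?b + ?b)"
          using \<sigma> by (intro mult_left_mono) auto
        then have zz: "\<bar>\<mu> * \<sigma> * (Z k i w + Z k j w)\<bar> \<le> 2 * \<bar>\<mu>\<bar> * \<sigma> * ?b"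
          using \<sigma> by (simp add: abs_mult)
        have "\<sigma>\<^sup>2 * (Z k i w * Z k j w) = X k i w * X k j w - \<mu> * \<sigma> * (Z k i w + Z k j w) - \<mu>\<^sup>2"
          unfolding XZ by (simp add: power2_eq_square algebra_simps)
        then have "\<bar>\<sigma>\<^sup>2 * (Z k i w * Z k j w)\<bar> \<le> \<epsilon> * \<sigma>\<^sup>2 / 2 * nlog n + (2 * \<bar>\<mu>\<bar> * \<sigma> * ?b + \<mu>\<^sup>2)"
          using xx zz zero_le_power2[of \<mu>] by linarith
        also have "\<dots> \<le> \<sigma>\<^sup>2 * (\<epsilon> * nlog n)" using s by (simp add: algebra_simps)
        finally show "\<bar>Z k i w * Z k j w\<bar> \<le> \<epsilon> * nlog n"
          using \<sigma> by (simp add: abs_mult)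
      qed
    qed
  qed
  then have "AE w in M. (\<lambda>n. sqrt (real n / ln (real n)) * coherence Z n (p n) w) \<longlonglongrightarrow> 2"
    by (rule Z.AE_coherence_limit[where p=p and D=D, rotated 2]) (use p1 p2 in auto)
  then show ?thesis
  proof eventually_elim
    case (elim w)
    have "sample_corr X n i j w = sample_corr Z n i j w" if "n > 0" for n i j
      using \<sigma> XZ that by (rule sample_corr_affine)
    \<comment> \<open>The affine invariance needs a nonempty sample, so the two coherences are
      compared for positive \<open>n\<close> only, which suffices for the limit.\<close>
    then have "coherence X n (p n) w = coherence Z n (p n) w" if "n > 0" for n
      using that by (simp add: coherence_def)
    then have "\<forall>\<^sub>F n in sequentially. sqrt (real n / ln (real n)) * coherence Z n (p n) w
        = sqrt (real n / ln (real n)) * coherence X n (p n) w"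
      by (intro eventually_mono[OF eventually_gt_at_top[of 0]]) simp
    from Lim_transform_eventually[OF elim this] show ?case .
  qed
qed

end
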